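(* Let $p,n\in\mathbb{N}$ and let $\mathbf{a},\mathbf{b}\in\mathbb{C}^p$ be arbitrary. Put $\psi=\sum_{k=1}^p(b_k-a_k)$. (i) If $\Re(\psi)+n-1>0$ or if $\mathbf{a}$ contains non-positive integers, then $$\frac{\widehat{G}_n(x)}{\Gamma(\mathbf{a})}=\frac{{}_{p+1}F_p(-n+1,\mathbf{a};\mathbf{b};1)}{(n-1)!\,\Gamma(\mathbf{b})}+o(1)\quad\text{as }x\to1^-.$$ (ii) If $\psi=-m$ with integer $m\ge n-1$ and $-\mathbf{a}\notin\mathbb{N}_0$, then $$\frac{\widehat{G}_n(x)}{\Gamma(\mathbf{a})}=\frac{{}_{p+1}F_p(-n+1,\mathbf{a};\mathbf{b};1)}{\Gamma(\mathbf{b})(n-1)!}-\frac{1}{\Gamma(\mathbf{a})}\sum_{j=0}^{n-1}\frac{(-1)^jq(j)}{(n-1-j)!\,j!}+o(1)\quad\text{as }x\to1^-,$$ where $q$ is the polynomial of degree $m$ given by $q(s)=\sum_{j=0}^{m}g_{m-j}(\mathbf{a}_{[p]};\mathbf{b})\,(s+a_p-j)_j$. (iii) If $\Re(\psi)+n-1<0$, $-\psi\notin\mathbb{N}_0$ and $-\mathbf{a}\notin\mathbb{N}_0$, then $$\frac{\widehat{G}_n(x)}{\Gamma(\mathbf{a})}=\frac{(-1)^n(1-x)^{\psi+n-1}}{\Gamma(\mathbf{a})\Gamma(\psi+n)}(1+o(1))\quad\text{as }x\to1^-.$$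
   Context: $\mathbb{N}_0=\mathbb{N}\cup\{0\}$. For a vector $\mathbf{a}=(a_1,\dots,a_p)$: $\Gamma(\mathbf{a})=\prod_i\Gamma(a_i)$, $(\mathbf{a})_j=\prod_i(a_i)_j$, $\mathbf{a}+\mu=(a_1+\mu,\dots,a_p+\mu)$; conditions such as $-\mathbf{a}\notin\mathbb{N}_0$ are element-wise. For $0<t<1$ and $-\mathbf{a}\notin\mathbb{N}_0$, $$\widehat{G}_n(t)=G^{p,1}_{p+1,p+1}\!\left(t\,\Big|\begin{array}{l}n,\mathbf{b}+n-1\\ \mathbf{a}+n-1,0\end{array}\right)=\frac{1}{2\pi i}\int_{\mathcal{L}}\frac{\Gamma(\mathbf{a}+n-1+s)\,\Gamma(1-n-s)}{\Gamma(\mathbf{b}+n-1+s)\,\Gamma(1-s)}\,t^{-s}\,ds,$$ where $\mathcal{L}$ is a left loop (starting and ending at $-\infty$, traversed counterclockwise) that leaves all the points $1-a_j-n-l$, $l\in\mathbb{N}_0$, on its left and all the points $1-n+k$, $k\in\mathbb{N}_0$, on its right. If some components of $\mathbf{a}$ are non-positive integers, $\widehat{G}_n(t)/\Gamma(\mathbf{a})$ denotes its extension by continuity in $\mathbf{a}$, namely $\frac{t^{n-1}}{(n-1)!}\sum_{j=0}^{n-1}\frac{(1-n)_j(\mathbf{a})_j}{\Gamma(\mathbf{b}+j)\,j!}t^{-j}$. The quotient $\frac{1}{\Gamma(\mathbf{b})}{}_{p+1}F_p(-n+1,\mathbf{a};\mathbf{b};1)$ is understood as $\sum_{j=0}^{n-1}\frac{(1-n)_j(\mathbf{a})_j}{\Gamma(\mathbf{b}+j)\,j!}$.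 Nørlund's coefficients are $$g_j(\mathbf{a}_{[p]};\mathbf{b})=\sum_{0\le j_1\le j_2\le\cdots\le j_{p-2}\le j}\ \prod_{m=1}^{p-1}\frac{(\psi_m+j_{m-1})_{j_m-j_{m-1}}}{(j_m-j_{m-1})!}(b_{m+1}-a_m)_{j_m-j_{m-1}},$$ where $\mathbf{a}_{[p]}=(a_1,\dots,a_{p-1})$, $\psi_m=\sum_{i=1}^m(b_i-a_i)$, $j_0=0$, $j_{p-1}=j$ (for $p=1$: $g_0=1$ and $g_j=0$ for $j\ge1$). *)

theory Defs
  imports "HOL-Complex_Analysis.Complex_Analysis" "HOL-Library.Landau_Symbols"
begin

text \<open>
  A vector in \<open>\<complex>\<^sup>p\<close> is a function \<open>nat \<Rightarrow> complex\<close> of which only the components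
  \<open>1, \<dots>, p\<close> matter. Reciprocals of Gamma values are written with \<^const>\<open>rGamma\<close>, the
  entire function \<open>1 / \<Gamma>\<close>, so that no condition on the components of \<open>b\<close> is needed.
\<close>

text \<open>
  Left loops are eventually horizontal: a path \<open>\<gamma>\<close> together with the two rays
  \<open>{pathstart \<gamma> - u | u \<ge> 0}\<close> (traversed from \<open>-\<infinity>\<close>) and \<open>{pathfinish \<gamma> - u | u \<ge> 0}\<close>
  (traversed towards \<open>-\<infinity>\<close>). Below, both rays are cut off at length \<open>R\<close>, and integrals and
  winding numbers along the unbounded curve are obtained for \<open>R \<rightarrow> \<infinity>\<close>.
\<close>

definition truncated_loop :: "(real \<Rightarrow> complex) \<Rightarrow> real \<Rightarrow> real \<Rightarrow> complex" where
  "truncated_loop \<gamma> R =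
     linepath (pathstart \<gamma> - of_real R) (pathstart \<gamma>) +++ \<gamma> +++
     linepath (pathfinish \<gamma>) (pathfinish \<gamma> - of_real R)"

definition closed_loop :: "(real \<Rightarrow> complex) \<Rightarrow> real \<Rightarrow> real \<Rightarrow> complex" where
  "closed_loop \<gamma> R =
     truncated_loop \<gamma> R +++ linepath (pathfinish \<gamma> - of_real R) (pathstart \<gamma> - of_real R)"

definition left_loop :: "(real \<Rightarrow> complex) \<Rightarrow> bool" where
  "left_loop \<gamma> \<longleftrightarrow> valid_path \<gamma> \<and> Im (pathstart \<gamma>) < Im (pathfinish \<gamma>)"

text \<open>
  The points to the left of a counterclockwise loop are those it encircles once; those to its
  right are the ones it does not encircle.
\<close>

definition on_left_of_loop :: "(real \<Rightarrow> complex) \<Rightarrow> complex \<Rightarrow> bool" where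
  "on_left_of_loop \<gamma> z \<longleftrightarrow>
     (\<forall>\<^sub>F R in at_top. z \<notin> path_image (closed_loop \<gamma> R) \<and> winding_number (closed_loop \<gamma> R) z = 1)"

definition on_right_of_loop :: "(real \<Rightarrow> complex) \<Rightarrow> complex \<Rightarrow> bool" where
  "on_right_of_loop \<gamma> z \<longleftrightarrow>
     (\<forall>\<^sub>F R in at_top. z \<notin> path_image (closed_loop \<gamma> R) \<and> winding_number (closed_loop \<gamma> R) z = 0)"

definition separating_left_loop ::
    "nat \<Rightarrow> nat \<Rightarrow> (nat \<Rightarrow> complex) \<Rightarrow> (real \<Rightarrow> complex) \<Rightarrow> bool" where
  "separating_left_loop p n a \<gamma> \<longleftrightarrow>
     left_loop \<gamma> \<and>
     (\<forall>k\<in>{1..p}. \<forall>l::nat. on_left_of_loop \<gamma> (1 - a k - of_nat n - of_nat l)) \<and>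
     (\<forall>k::nat. on_right_of_loop \<gamma> (1 - of_nat n + of_nat k))"

definition loop_integral :: "(real \<Rightarrow> complex) \<Rightarrow> (complex \<Rightarrow> complex) \<Rightarrow> complex" where
  "loop_integral \<gamma> f = Lim at_top (\<lambda>R. contour_integral (truncated_loop \<gamma> R) f)"

definition G_hat ::
    "(real \<Rightarrow> complex) \<Rightarrow> nat \<Rightarrow> nat \<Rightarrow> (nat \<Rightarrow> complex) \<Rightarrow> (nat \<Rightarrow> complex) \<Rightarrow> real \<Rightarrow> complex" where
  "G_hat \<gamma> p n a b t =
     1 / (2 * of_real pi * \<i>) *
     loop_integral \<gamma> (\<lambda>s.
       (\<Prod>k=1..p. Gamma (a k + of_nat n - 1 + s)) * Gamma (1 - of_nat n - s) *
       (\<Prod>k=1..p. rGamma (b k + of_nat n - 1 + s)) * rGamma (1 - s) *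
       of_real t powr (- s))"

text \<open>
  The quotient of \<^const>\<open>G_hat\<close> by the product of the \<open>\<Gamma>(a k)\<close>. If some \<open>a k\<close> is a non-positive
  integer, no separating loop exists and the quotient is given by its extension by continuity
  in \<open>a\<close>; the value does not depend on \<open>\<gamma>\<close> then.
\<close>

definition G_hat_div_Gamma ::
    "(real \<Rightarrow> complex) \<Rightarrow> nat \<Rightarrow> nat \<Rightarrow> (nat \<Rightarrow> complex) \<Rightarrow> (nat \<Rightarrow> complex) \<Rightarrow> real \<Rightarrow> complex" where
  "G_hat_div_Gamma \<gamma> p n a b t =
     (if \<exists>k\<in>{1..p}. - a k \<in> \<nat>
      then of_real t ^ (n - 1) / fact (n - 1) *
           (\<Sum>j=0..n-1. pochhammer (1 - of_nat n) j * (\<Prod>k=1..p. pochhammer (a k) j) *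
              (\<Prod>k=1..p. rGamma (b k + of_nat j)) / fact j * of_real t powi (- int j))
      else G_hat \<gamma> p n a b t / (\<Prod>k=1..p. Gamma (a k)))"

text \<open>The terminating series \<open>\<^bsub>p+1\<^esub>F\<^bsub>p\<^esub>(-n+1, a; b; 1) / \<Gamma>(b)\<close>.\<close>

definition hyp_F_one_div_Gamma ::
    "nat \<Rightarrow> nat \<Rightarrow> (nat \<Rightarrow> complex) \<Rightarrow> (nat \<Rightarrow> complex) \<Rightarrow> complex" where
  "hyp_F_one_div_Gamma p n a b =
     (\<Sum>j=0..n-1. pochhammer (1 - of_nat n) j * (\<Prod>k=1..p. pochhammer (a k) j) *
        (\<Prod>k=1..p. rGamma (b k + of_nat j)) / fact j)"

text \<open>
  The index tuples \<open>0 = j\<^sub>0 \<le> j\<^sub>1 \<le> \<dots> \<le> j\<^bsub>p-1\<^esub> = j\<close>. For \<open>p = 1\<close> there is one such tuple if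
  \<open>j = 0\<close> and none otherwise.
\<close>

definition norlund_indices :: "nat \<Rightarrow> nat \<Rightarrow> (nat \<Rightarrow> nat) set" where
  "norlund_indices p j =
     {J \<in> extensional {0..p-1}. J 0 = 0 \<and> J (p - 1) = j \<and> (\<forall>m\<in>{1..p-1}. J (m - 1) \<le> J m)}"

definition norlund_coeff :: "nat \<Rightarrow> (nat \<Rightarrow> complex) \<Rightarrow> (nat \<Rightarrow> complex) \<Rightarrow> nat \<Rightarrow> complex" where
  "norlund_coeff p a b j =
     (\<Sum>J\<in>norlund_indices p j. \<Prod>m=1..p-1.
        pochhammer ((\<Sum>i=1..m. b i - a i) + of_nat (J (m - 1))) (J m - J (m - 1)) /
        fact (J m - J (m - 1)) *
        pochhammer (b (m + 1) - a m) (J m - J (m - 1)))"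

text \<open>The polynomial \<open>q(s) = \<Sum>\<^bsub>j\<le>m\<^esub> g\<^bsub>m-j\<^esub> (s + a\<^sub>p - j)\<^sub>j\<close> in the indeterminate \<open>s = [:0, 1:]\<close>.\<close>

definition norlund_poly :: "nat \<Rightarrow> nat \<Rightarrow> (nat \<Rightarrow> complex) \<Rightarrow> (nat \<Rightarrow> complex) \<Rightarrow> complex poly" where
  "norlund_poly p m a b =
     (\<Sum>j=0..m. smult (norlund_coeff p a b (m - j)) (pochhammer [:a p - of_nat j, 1:] j))"

end

theory Submission
  imports Defs
begin

text \<open>
  Put \<open>A = a + n - 1\<close>, \<open>B = b + n - 1\<close> and \<open>F(s) = \<Prod>\<^sub>k \<Gamma>(s + A\<^sub>k) / \<Gamma>(s + B\<^sub>k)\<close>. The other two Gamma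
  factors of the integrand form a rational function, \<open>\<Gamma>(1 - n - s) / \<Gamma>(1 - s) = (-1)\<^sup>n / (s)\<^sub>n\<close>.
  So \<open>G\<close> is the integral of \<open>E(s) t\<^bsup>-s\<^esup>\<close> over the loop, where \<open>E(s) = (-1)\<^sup>n F(s) / (s)\<^sub>n\<close>: the
  poles of the \<open>\<Gamma>(s + A\<^sub>k)\<close> lie on the left of the loop, and the remaining poles
  \<open>0, -1, \<dots>, 1 - n\<close>, which are simple, on its right.

  Suppose that \<open>E\<close> decays like \<open>|s|\<^bsup>-1-\<epsilon>\<^esup>\<close> in the sector \<open>Re s \<ge> - |Im s|\<close>. For \<open>t < 1\<close> the factor
  \<open>t\<^bsup>-s\<^esup>\<close> is exponentially small far to the left, so the loop can be opened up until it is the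
  vertical line \<open>Re s = c\<close>, to the right of all poles. This costs the residues on the right, which
  are passed over, and the integral over the line is \<open>O(t\<^bsup>-c\<^esup> c\<^bsup>-\<epsilon>\<^esup>)\<close>. With \<open>c = 1 / (1 - t)\<close> the
  factor \<open>t\<^bsup>-c\<^esup>\<close> stays bounded and the bound is \<open>O((1 - t)\<^sup>\<epsilon>)\<close>. Hence the loop integral tends to
  \<open>-2\<pi>\<i>\<close> times the sum of the residues (\<open>loop_integral_tendsto_residue_sum\<close>), and for \<open>E\<close> as above that
  sum is the terminating hypergeometric series (\<open>F_residue_sum\<close>). As \<open>F(s) = O(s\<^bsup>-\<psi>\<^esup>)\<close>, this
  settles the case \<open>Re \<psi> + n - 1 > 0\<close>. If some \<open>a\<^sub>k\<close> is a non-positive integer, \<open>G / \<Gamma>(a)\<close> is by definition a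
  finite sum of powers of \<open>t\<close>, whose limit is its value at \<open>1\<close>.

  In the other two cases the part of \<open>E\<close> that does not decay is subtracted first. It is supplied by
  Noerlund's expansion (\<open>norlund_expansion\<close>)
  \<open>F(s) = \<Sum>\<^bsub>j<N\<^esub> g\<^sub>j \<Gamma>(s + A\<^sub>p) / \<Gamma>(s + A\<^sub>p + \<psi> + j) + O(s\<^bsup>-\<psi>-N\<^esup>)\<close>.
  If \<open>\<psi> = -m\<close>, its first \<open>m + 1\<close> terms add up to the polynomial \<open>q\<close>, up to a shift of the argument.
  The loop integral of \<open>q / (s)\<^sub>n\<close> vanishes, because there are no poles on the left
  (\<open>loop_integral_rational_eq_0\<close>). So the subtraction leaves the function unchanged, while in the
  residues \<open>F\<close> is replaced by \<open>F - q\<close>; this is where the additional sum over \<open>q(j)\<close> comes from.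
  If \<open>Re \<psi> + n - 1 < 0\<close>, then \<open>1 / (s)\<^sub>n = \<Gamma>(s) / \<Gamma>(s + n)\<close> is counted as one more pair of parameters, and
  with \<open>\<delta> = \<psi> + n\<close> each term of the expansion of \<open>E\<close> can be integrated in closed form: its residues on
  the left sum to the binomial series of \<open>t\<^bsup>A_p\<^esup> (1 - t)\<^bsup>\<delta>+j-1\<^esup> / \<Gamma>(\<delta> + j)\<close> (\<open>loop_integral_Gamma_quotient\<close>).
  The term for \<open>j = 0\<close> dominates all others, and also the bounded contribution of the remainder.

  The asymptotics in the sector do not use Stirling's formula. The functions in question satisfy
  recurrences \<open>D(s) = \<rho>(s) D(s + 1) + e(s)\<close> with \<open>\<rho>(s) = 1 + O(s\<^bsup>-2\<^esup>)\<close> and a known limit of \<open>D(s + N)\<close> for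
  \<open>N \<rightarrow> \<infinity>\<close>; iterating them bounds \<open>D\<close> (\<open>sector_recurrence_bound\<close>).
\<close>

section \<open>First-order recurrences in a sector\<close>

text \<open>
  The sector is invariant under \<open>s \<mapsto> s + 1\<close>, avoids the negative real axis, and contains the upper,
  lower and right sides of large rectangles that are open to the left.
\<close>

definition sector :: "complex set" where
  "sector = {s. - \<bar>Im s\<bar> \<le> Re s}"

definition at_sector :: "complex filter" where
  "at_sector = inf at_infinity (principal sector)"

lemma eventually_at_sector:
  "eventually P at_sector \<longleftrightarrow> (\<exists>r. \<forall>s\<in>sector. r \<le> norm s \<longrightarrow> P s)"
  unfolding at_sector_def eventually_inf_principal eventually_at_infinity by blast

lemma eventually_at_sector_norm_ge: "\<forall>\<^sub>F s in at_sector. s \<in> sector \<and> r \<le> norm s"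
  unfolding eventually_at_sector by blast

lemma filterlim_at_sector_at_infinity: "filterlim (\<lambda>s. s) at_infinity at_sector"
  unfolding at_sector_def by (simp add: filterlim_def)

lemma eventually_at_sector_nonpole: "\<forall>\<^sub>F s in at_sector. s + c \<notin> \<int>\<^sub>\<le>\<^sub>0"
proof -
  have "s + c \<notin> \<int>\<^sub>\<le>\<^sub>0" if s: "s \<in> sector" "3 * norm c + 1 \<le> norm s" for s
  proof
    assume "s + c \<in> \<int>\<^sub>\<le>\<^sub>0"
    then obtain k where k: "s + c = - of_nat k" by (elim nonpos_Ints_cases')
    have im: "Im s = - Im c" and re: "Re s = - real k - Re c"
      using k by (simp_all add: complex_eq_iff)
    have "\<bar>Im s\<bar> \<le> norm c" using im abs_Im_le_cmod[of c] by simp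
    moreover have "\<bar>Re s\<bar> \<le> norm c"
      using s(1) re im abs_Re_le_cmod[of c] abs_Im_le_cmod[of c] by (auto simp: sector_def)
    moreover have "norm s \<le> \<bar>Re s\<bar> + \<bar>Im s\<bar>" by (rule cmod_le)
    ultimately show False using s(2) norm_ge_zero[of c] by linarith
  qed
  thus ?thesis unfolding eventually_at_sector by blast
qed

lemma eventually_at_sector_nonzero: "\<forall>\<^sub>F s in at_sector. s + c \<noteq> 0"
  using eventually_at_sector_nonpole[of c] by eventually_elim auto

lemma sector_add_of_nat: "s \<in> sector \<Longrightarrow> s + of_nat k \<in> sector"
  by (simp add: sector_def)

text \<open>
  The angle between \<open>s\<close> and the positive axis is at most \<open>3\<pi>/4\<close>, so a step to the right cannot
  cancel more than a fixed proportion of \<open>s\<close>. This is what makes sums over \<open>s + k\<close> converge uniformly.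
\<close>

lemma norm_sector_add_of_nat:
  assumes "s \<in> sector"
  shows "(norm s + real k) / 3 \<le> norm (s + of_nat k)"
proof -
  define x where "x = Re s" define y where "y = Im s"
  have xy: "- \<bar>y\<bar> \<le> x" using assms by (simp add: sector_def x_def y_def)
  have n2: "norm s ^ 2 = x^2 + y^2" by (simp add: cmod_power2 x_def y_def)
  have "((norm s + real k))\<^sup>2 \<le> 2 * (norm s)\<^sup>2 + 2 * (real k)\<^sup>2"
    using sum_squares_bound[of "norm s" "real k"] by (simp add: power2_sum)
  also have "\<dots> \<le> 9 * ((x + real k)^2 + y^2)"
  proof -
    have "0 \<le> 7 * x^2 + 7 * y^2 + 18 * x * k + 7 * (real k)^2"
    proof (cases "x \<ge> 0")
      case False
      then have "x^2 \<le> y^2" using xy by (intro abs_le_square_iff[THEN iffD1]) linarith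
      moreover have "0 \<le> 14 * x^2 + 18 * x * k + 7 * (real k)^2"
      proof -
        have "14 * x^2 + 18 * x * k + 7 * (real k)^2 = 14 * (x + 9/14 * k)^2 + (7 - 81/14) * (real k)^2"
          by (simp add: power2_eq_square algebra_simps)
        thus ?thesis by simp
      qed
      ultimately show ?thesis by linarith
    qed auto
    thus ?thesis unfolding n2 by (simp add: power2_eq_square algebra_simps)
  qed
  also have "\<dots> = (3 * norm (s + of_nat k))^2"
    by (simp add: power_mult_distrib cmod_power2 x_def y_def)
  finally have "norm s + real k \<le> 3 * norm (s + of_nat k)"
    by (rule power2_le_imp_le) simp
  thus ?thesis by simp
qed

lemma sum_inverse_square_shift_le:
  fixes x :: real
  assumes "x \<ge> 2"
  shows "(\<Sum>k<N. 1 / (x + real k)\<^sup>2) \<le> 2 / x"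
proof -
  have "(\<Sum>k<N. 1 / (x + real k)\<^sup>2) \<le> 1 / (x - 1) - 1 / (x + real N - 1)"
  proof (induction N)
    case (Suc N)
    have "1 / (x + real N)^2 \<le> 1 / ((x + real N - 1) * (x + real N))"
      using assms by (intro divide_left_mono) (auto simp: power2_eq_square)
    also have "\<dots> = 1 / (x + real N - 1) - 1 / (x + real N)"
      using assms by (simp add: field_simps)
    finally show ?case using Suc by (simp add: algebra_simps)
  qed simp
  also have "\<dots> \<le> 1 / (x - 1)" using assms by simp
  also have "\<dots> \<le> 2 / x" using assms by (simp add: field_simps)
  finally show ?thesis .
qed

text \<open>
  Iterating the recurrence \<open>N\<close> times multiplies by \<open>\<Prod>\<rho>(s + k)\<close>, which is bounded since
  \<open>\<Sum> |s + k|\<^bsup>-2\<^esup>\<close> is, and adds the errors \<open>e(s + k)\<close>, whose sum is \<open>O(|s|\<^bsup>-M\<^esup>)\<close>. Letting \<open>N\<close> tend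
  to infinity replaces \<open>D(s + N)\<close> by its limit.
\<close>

lemma sector_recurrence_bound:
  fixes D \<rho> e :: "complex \<Rightarrow> complex" and M :: nat
  assumes rec: "\<forall>\<^sub>F s in at_sector. D s = \<rho> s * D (s + 1) + e s"
    and rho: "(\<lambda>s. \<rho> s - 1) \<in> O[at_sector](\<lambda>s. 1 / s ^ 2)"
    and e: "e \<in> O[at_sector](\<lambda>s. 1 / s ^ (M + 1))"
    and M: "M \<ge> 1"
    and lim: "\<forall>\<^sub>F s in at_sector. (\<lambda>N. D (s + of_nat N)) \<longlonglongrightarrow> L"
  shows "\<exists>K\<ge>0. \<forall>\<^sub>F s in at_sector. norm (D s) \<le> K * (norm L + 1 / norm s ^ M)"
proof -
  obtain C1 where C1: "C1 > 0" "\<forall>\<^sub>F s in at_sector. norm (\<rho> s - 1) \<le> C1 * norm (1 / s ^ 2)"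
    using rho by (elim landau_o.bigE)
  obtain C2 where C2: "C2 > 0" "\<forall>\<^sub>F s in at_sector. norm (e s) \<le> C2 * norm (1 / s ^ (M + 1))"
    using e by (elim landau_o.bigE)
  obtain r where r: "\<And>s. s \<in> sector \<Longrightarrow> r \<le> norm s \<Longrightarrow>
      D s = \<rho> s * D (s + 1) + e s \<and> norm (\<rho> s - 1) \<le> C1 * norm (1 / s ^ 2) \<and>
      norm (e s) \<le> C2 * norm (1 / s ^ (M + 1)) \<and> (\<lambda>N. D (s + of_nat N)) \<longlonglongrightarrow> L"
    using eventually_conj[OF rec eventually_conj[OF C1(2) eventually_conj[OF C2(2) lim]]]
    unfolding eventually_at_sector by blast
  define P where "P = exp (9 * C1)"
  define K where "K = P * (1 + 2 * C2 * 3 ^ (M + 1))"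
  have main: "norm (D s) \<le> K * (norm L + 1 / norm s ^ M)"
    if s: "s \<in> sector" "max 2 (3 * \<bar>r\<bar>) \<le> norm s" for s
  proof -
    have s2: "norm s \<ge> 2" using s by simp
    have sk: "s + of_nat k \<in> sector" "r \<le> norm (s + of_nat k)" for k
      using s sector_add_of_nat[of s k] norm_sector_add_of_nat[of s k] by (auto simp: field_simps)
    define E where "E = (\<lambda>N. \<Sum>k<N. C1 / norm (s + of_nat k) ^ 2)"
    define F where "F = (\<lambda>N. \<Sum>k<N. C2 / norm (s + of_nat k) ^ (M + 1))"
    \<comment> \<open>Since \<open>1 + x \<le> exp x\<close>, the product of the factors is at most \<open>exp (E N)\<close>; the errors only
       have to be multiplied by the same factor.\<close>
    have iter: "norm (D s) \<le> exp (E N) * (norm (D (s + of_nat N)) + F N)" for N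
    proof (induction N)
      case (Suc N)
      let ?z = "s + of_nat N"
      have z: "D ?z = \<rho> ?z * D (?z + 1) + e ?z" "norm (\<rho> ?z - 1) \<le> C1 / norm ?z ^ 2"
         "norm (e ?z) \<le> C2 / norm ?z ^ (M + 1)"
        using r[OF sk[of N]] by (simp_all add: norm_divide norm_power norm_mult)
      have "norm (\<rho> ?z) \<le> 1 + C1 / norm ?z ^ 2"
        using z(2) norm_triangle_sub[of "\<rho> ?z" 1] by simp
      also have "\<dots> \<le> exp (C1 / norm ?z ^ 2)" by (rule exp_ge_add_one_self)
      finally have rz: "norm (\<rho> ?z) \<le> exp (C1 / norm ?z ^ 2)" .
      have F0: "F N \<ge> 0" using C2 by (auto simp: F_def intro!: sum_nonneg)
      have x1: "1 \<le> exp (C1 / norm ?z ^ 2)" using C1 by simp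
      have "norm (D ?z) \<le> norm (\<rho> ?z) * norm (D (?z + 1)) + norm (e ?z)"
        unfolding z(1) using norm_triangle_ineq[of "\<rho> ?z * D (?z + 1)" "e ?z"]
        by (simp add: norm_mult)
      also have "\<dots> \<le> exp (C1 / norm ?z ^ 2) * norm (D (?z + 1)) + 1 * (C2 / norm ?z ^ (M + 1))"
        using rz z(3) by (intro add_mono mult_right_mono) auto
      also have "\<dots> \<le> exp (C1 / norm ?z ^ 2) * (norm (D (?z + 1)) + C2 / norm ?z ^ (M + 1))"
        using x1 C2 unfolding distrib_left by (intro add_mono mult_right_mono order_refl) auto
      finally have "norm (D ?z) + F N \<le>
          exp (C1 / norm ?z ^ 2) * (norm (D (?z + 1)) + C2 / norm ?z ^ (M + 1)) + 1 * F N" by simp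
      also have "\<dots> \<le> exp (C1 / norm ?z ^ 2) * (norm (D (?z + 1)) + C2 / norm ?z ^ (M + 1)) +
          exp (C1 / norm ?z ^ 2) * F N"
        using x1 F0 by (intro add_left_mono mult_right_mono)
      finally have *: "norm (D ?z) + F N \<le>
          exp (C1 / norm ?z ^ 2) * (norm (D (s + of_nat (Suc N))) + F (Suc N))"
        by (simp add: F_def algebra_simps)
      have "norm (D s) \<le> exp (E N) * (norm (D ?z) + F N)" by (rule Suc)
      also have "\<dots> \<le> exp (E N) *
          (exp (C1 / norm ?z ^ 2) * (norm (D (s + of_nat (Suc N))) + F (Suc N)))"
        using * by (intro mult_left_mono) auto
      also have "\<dots> = exp (E (Suc N)) * (norm (D (s + of_nat (Suc N))) + F (Suc N))"
        by (simp add: E_def exp_add)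
      finally show ?case .
    qed (simp add: E_def F_def)
    have inv: "1 / norm (s + of_nat k) ^ j \<le> 3 ^ j / (norm s + real k) ^ j" for k j :: nat
    proof -
      have "1 / norm (s + of_nat k) ^ j = (1 / norm (s + of_nat k)) ^ j" by (simp add: power_divide)
      also have "\<dots> \<le> (3 / (norm s + real k)) ^ j"
      proof (intro power_mono)
        have p: "0 < (norm s + real k) / 3" using s2 by simp
        have "1 / norm (s + of_nat k) \<le> 1 / ((norm s + real k) / 3)"
          using norm_sector_add_of_nat[OF s(1), of k] p by (intro divide_left_mono mult_pos_pos) auto
        thus "1 / norm (s + of_nat k) \<le> 3 / (norm s + real k)" by simp
      qed auto
      finally show ?thesis by (simp add: power_divide)
    qed
    have E: "E N \<le> 9 * C1" for N
    proof -
      have "E N \<le> (\<Sum>k<N. (9 * C1) * (1 / (norm s + real k)\<^sup>2))"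
        unfolding E_def using mult_left_mono[OF inv[of _ 2], of C1] C1
        by (intro sum_mono) (simp add: mult_ac)
      also have "\<dots> \<le> 9 * C1 * (2 / norm s)"
        unfolding sum_distrib_left[symmetric] using C1 sum_inverse_square_shift_le[OF s2, of N]
        by (intro mult_left_mono) auto
      also have "\<dots> \<le> 9 * C1 * 1" using C1 s2 by (intro mult_left_mono) (auto simp: divide_simps)
      finally show ?thesis by simp
    qed
    have F: "F N \<le> 2 * C2 * 3 ^ (M + 1) * (1 / norm s ^ M)" for N
    proof -
      have "F N \<le> (\<Sum>k<N. (C2 * 3 ^ (M + 1) / norm s ^ (M - 1)) * (1 / (norm s + real k)\<^sup>2))"
        unfolding F_def
      proof (intro sum_mono)
        fix k
        have "C2 / norm (s + of_nat k) ^ (M + 1) \<le> C2 * (3 ^ (M + 1) / (norm s + real k) ^ (M + 1))"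
          using mult_left_mono[OF inv[of k "M + 1"], of C2] C2 by simp
        also have "(norm s + real k) ^ (M + 1) = (norm s + real k) ^ (M - 1) * (norm s + real k)\<^sup>2"
          using M by (simp flip: power_add)
        also have "C2 * (3 ^ (M + 1) / ((norm s + real k) ^ (M - 1) * (norm s + real k)\<^sup>2)) \<le>
            C2 * (3 ^ (M + 1) / (norm s ^ (M - 1) * (norm s + real k)\<^sup>2))"
          using C2 s2
          by (intro mult_left_mono divide_left_mono mult_right_mono power_mono mult_pos_pos
               zero_less_power) auto
        finally show "C2 / norm (s + of_nat k) ^ (M + 1) \<le>
            (C2 * 3 ^ (M + 1) / norm s ^ (M - 1)) * (1 / (norm s + real k)\<^sup>2)"
          by simp
      qed
      also have "\<dots> \<le> (C2 * 3 ^ (M + 1) / norm s ^ (M - 1)) * (2 / norm s)"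
        unfolding sum_distrib_left[symmetric] using C2 sum_inverse_square_shift_le[OF s2, of N]
        by (intro mult_left_mono) auto
      also have "\<dots> = 2 * C2 * 3 ^ (M + 1) * (1 / (norm s ^ (M - 1) * norm s))" by simp
      also have "norm s ^ (M - 1) * norm s = norm s ^ M"
        using M by (simp flip: power_Suc2)
      finally show ?thesis .
    qed
    have bd: "norm (D s) \<le> P * (norm (D (s + of_nat N)) + 2 * C2 * 3 ^ (M + 1) * (1 / norm s ^ M))" for N
    proof -
      have "F N \<ge> 0" using C2 by (auto simp: F_def intro!: sum_nonneg)
      hence "exp (E N) * (norm (D (s + of_nat N)) + F N) \<le>
          P * (norm (D (s + of_nat N)) + 2 * C2 * 3 ^ (M + 1) * (1 / norm s ^ M))"
        unfolding P_def using E F by (intro mult_mono add_mono) auto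
      thus ?thesis using iter[of N] by linarith
    qed
    have "(\<lambda>N. P * (norm (D (s + of_nat N)) + 2 * C2 * 3 ^ (M + 1) * (1 / norm s ^ M))) \<longlonglongrightarrow>
        P * (norm L + 2 * C2 * 3 ^ (M + 1) * (1 / norm s ^ M))"
      using r[OF s(1)] s(2) by (intro tendsto_intros) auto
    hence "norm (D s) \<le> P * (norm L + 2 * C2 * 3 ^ (M + 1) * (1 / norm s ^ M))"
      using bd by (intro LIMSEQ_le_const) auto
    also have "\<dots> \<le> P * ((1 + 2 * C2 * 3 ^ (M + 1)) * norm L +
        (1 + 2 * C2 * 3 ^ (M + 1)) * (1 / norm s ^ M))"
      using C2 by (intro mult_left_mono add_mono mult_right_mono) (auto simp: P_def distrib_right)
    also have "\<dots> = K * (norm L + 1 / norm s ^ M)" by (simp add: K_def algebra_simps)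
    finally show ?thesis .
  qed
  have "\<forall>\<^sub>F s in at_sector. norm (D s) \<le> K * (norm L + 1 / norm s ^ M)"
    unfolding eventually_at_sector using main by blast
  moreover have "K \<ge> 0" using C2 by (simp add: K_def P_def)
  ultimately show ?thesis by blast
qed

section \<open>Quotients of two Gamma functions in the sector\<close>

text \<open>
  The recurrence coefficient of a Gamma quotient is a holomorphic function of \<open>u = 1/s\<close> at \<open>u = 0\<close>
  whose first-order term cancels.
\<close>

lemma critical_point_bigo_square:
  fixes f :: "complex \<Rightarrow> complex"
  assumes hol: "f holomorphic_on ball 0 r" and r: "r > 0" and d: "deriv f 0 = 0"
  shows "(\<lambda>u. f u - f 0) \<in> O[nhds 0](\<lambda>u. u ^ 2)"
proof -
  have h1: "deriv f holomorphic_on ball 0 r" and h2: "deriv (deriv f) holomorphic_on ball 0 r"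
    using hol by (auto intro!: holomorphic_deriv)
  have "continuous_on (cball 0 (r/2)) (deriv (deriv f))"
    by (rule holomorphic_on_imp_continuous_on, rule holomorphic_on_subset[OF h2]) (use r in auto)
  hence "bounded (deriv (deriv f) ` cball 0 (r/2))"
    by (intro compact_imp_bounded compact_continuous_image) auto
  then obtain B where B: "\<And>x. x \<in> cball 0 (r/2) \<Longrightarrow> norm (deriv (deriv f) x) \<le> B"
    unfolding bounded_iff by blast
  have der: "((deriv ^^ i) f has_field_derivative (deriv ^^ Suc i) f x) (at x within cball 0 (r/2))"
    if "x \<in> cball 0 (r/2)" "i \<le> 1" for x i
  proof -
    have "(deriv ^^ i) f holomorphic_on ball 0 r" using that h1 hol by (cases i) auto
    hence "((deriv ^^ i) f has_field_derivative deriv ((deriv ^^ i) f) x) (at x)"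
      using that r by (intro holomorphic_derivI[where S = "ball 0 r"]) auto
    thus ?thesis by (auto intro: has_field_derivative_at_within)
  qed
  have "norm (f u - f 0) \<le> B * norm (u ^ 2)" if "u \<in> ball 0 (r/2)" for u
    using complex_Taylor[of "cball 0 (r/2)" 1 "\<lambda>i. (deriv ^^ i) f" B 0 u] der B that r d
    by (simp add: numeral_2_eq_2 norm_mult)
  thus ?thesis
    using r by (intro bigoI[of _ B]) (auto simp: eventually_nhds intro!: exI[of _ "ball 0 (r/2)"])
qed

lemma filterlim_inverse_at_sector: "filterlim (\<lambda>s. inverse s) (nhds 0) at_sector"
  by (rule filterlim_compose[OF tendsto_inverse_0 filterlim_at_sector_at_infinity])

lemma shift_bigtheta_at_sector: "(\<lambda>s. s + c) \<in> \<Theta>[at_sector](\<lambda>s. s)"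
proof -
  have "(\<lambda>s. c) \<in> o[at_sector](\<lambda>s::complex. s)"
    by (rule smalloI_tendsto)
       (auto intro!: tendsto_divide_0[OF tendsto_const] filterlim_at_sector_at_infinity
         eventually_at_sector_nonzero[of 0, simplified])
  hence "\<Theta>[at_sector](\<lambda>s. s + c) = \<Theta>[at_sector](\<lambda>s. s)" by (rule landau_theta.plus_absorb2)
  thus ?thesis using bigtheta_refl by blast
qed

lemma sector_not_nonpos_Reals: "s \<in> sector \<Longrightarrow> s \<noteq> 0 \<Longrightarrow> s \<notin> \<real>\<^sub>\<le>\<^sub>0"
  by (auto simp: sector_def complex_nonpos_Reals_iff complex_eq_iff)

text \<open>
  Gauss's limit formula for \<open>\<Gamma>\<close>, applied once to \<open>a\<close> and once to \<open>b\<close>.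
\<close>

lemma Gamma_quotient_LIMSEQ:
  fixes a b :: complex
  assumes a: "a \<notin> \<int>\<^sub>\<le>\<^sub>0" and b: "b \<notin> \<int>\<^sub>\<le>\<^sub>0"
  shows "(\<lambda>N. Gamma (a + of_nat N) * rGamma (b + of_nat N) * exp ((b - a) * of_real (ln (real N))))
           \<longlonglongrightarrow> 1"
proof -
  have "(\<lambda>N. (Gamma a * rGamma_series a N) * (rGamma b * Gamma_series b N)) \<longlonglongrightarrow>
      (Gamma a * rGamma a) * (rGamma b * Gamma b)"
    by (intro tendsto_intros)
  also have "(Gamma a * rGamma a) * (rGamma b * Gamma b) = 1"
    using a b by (simp add: Gamma_def rGamma_eq_zero_iff)
  finally have lim: "(\<lambda>N. (Gamma a * rGamma_series a N) * (rGamma b * Gamma_series b N)) \<longlonglongrightarrow> 1" .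
  have lim2: "(\<lambda>N. (b + of_nat N) / (a + of_nat N)) \<longlonglongrightarrow> 1"
  proof -
    have "(\<lambda>N. (b / of_nat N + 1) / (a / of_nat N + 1)) \<longlonglongrightarrow> (0 + 1) / (0 + 1)"
      by (intro tendsto_intros lim_const_over_n) auto
    hence "(\<lambda>N. (b / of_nat N + 1) / (a / of_nat N + 1)) \<longlonglongrightarrow> 1" by simp
    moreover have "\<forall>\<^sub>F N in sequentially. (b / of_nat N + 1) / (a / of_nat N + 1) = (b + of_nat N) / (a + of_nat N)"
      using eventually_gt_at_top[of 0] by eventually_elim (simp add: divide_simps)
    ultimately show ?thesis by (rule Lim_transform_eventually)
  qed
  have eq: "(b + of_nat N) / (a + of_nat N) * ((Gamma a * rGamma_series a N) * (rGamma b * Gamma_series b N)) =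
      Gamma (a + of_nat N) * rGamma (b + of_nat N) * exp ((b - a) * of_real (ln (real N)))" for N
  proof -
    have nza: "a + of_nat k \<noteq> 0" for k using a by (metis add_eq_0_iff2 neg_eq_iff_add_eq_0 plus_of_nat_eq_0_imp add.commute a)
    have nzb: "b + of_nat k \<noteq> 0" for k using b by (metis plus_of_nat_eq_0_imp add.commute)
    have pa: "pochhammer a k \<noteq> 0" for k using nza by (auto simp: pochhammer_eq_0_iff add_eq_0_iff2)
    have pb: "pochhammer b k \<noteq> 0" for k using nzb by (auto simp: pochhammer_eq_0_iff add_eq_0_iff2)
    have Ga: "Gamma (a + of_nat N) = pochhammer a N * Gamma a"
      using pochhammer_Gamma[OF a, of N] a by (simp add: Gamma_eq_zero_iff)
    have Gb: "rGamma b = pochhammer b N * rGamma (b + of_nat N)" by (rule pochhammer_rGamma)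
    show ?thesis
      unfolding Ga Gb rGamma_series_def Gamma_series_def
      using nza[of N] nzb[of N] pb[of N]
      by (simp add: pochhammer_Suc left_diff_distrib exp_diff)
  qed
  show ?thesis
    using tendsto_mult[OF lim2 lim] unfolding eq by simp
qed

lemma powr_shift_LIMSEQ:
  fixes s d :: complex
  shows "(\<lambda>N. (s + of_nat N) powr d / exp (d * of_real (ln (real N)))) \<longlonglongrightarrow> 1"
proof -
  have "(\<lambda>N. s / of_nat N + 1) \<longlonglongrightarrow> 0 + 1"
    by (intro tendsto_intros lim_const_over_n)
  hence l: "(\<lambda>N. s / of_nat N + 1) \<longlonglongrightarrow> 1" by simp
  hence "(\<lambda>N. exp (d * Ln (s / of_nat N + 1))) \<longlonglongrightarrow> exp (d * Ln 1)"
    by (intro tendsto_intros) auto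
  hence "(\<lambda>N. exp (d * Ln (s / of_nat N + 1))) \<longlonglongrightarrow> 1" by simp
  moreover have "\<forall>\<^sub>F N in sequentially. exp (d * Ln (s / of_nat N + 1)) =
      (s + of_nat N) powr d / exp (d * of_real (ln (real N)))"
    using eventually_gt_at_top[of 0] order_tendstoD(1)[OF tendsto_norm[OF l], of 0, simplified]
  proof eventually_elim
    case (elim N)
    have "s + of_nat N = of_real (real N) * (s / of_nat N + 1)" using elim by (simp add: field_simps)
    moreover have "Ln (of_real (real N) * (s / of_nat N + 1)) = of_real (ln (real N)) + Ln (s / of_nat N + 1)"
      using elim Ln_times_of_real[of "real N" "s / of_nat N + 1"] by (simp add: Ln_of_real)
    ultimately have L: "Ln (s + of_nat N) = of_real (ln (real N)) + Ln (s / of_nat N + 1)" by simp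
    have "s + of_nat N \<noteq> 0"
      using \<open>s + of_nat N = _\<close> elim by auto
    thus ?case by (simp add: powr_def L distrib_left exp_add)
  qed
  ultimately show ?thesis by (rule Lim_transform_eventually)
qed

lemma Gamma_quotient_powr_LIMSEQ:
  fixes a b s :: complex
  assumes a: "s + a \<notin> \<int>\<^sub>\<le>\<^sub>0" and b: "s + b \<notin> \<int>\<^sub>\<le>\<^sub>0"
  shows "(\<lambda>N. Gamma (s + of_nat N + a) * rGamma (s + of_nat N + b) * (s + of_nat N) powr (b - a)) \<longlonglongrightarrow> 1"
  using tendsto_mult[OF Gamma_quotient_LIMSEQ[OF a b] powr_shift_LIMSEQ[of s "b - a"]]
  by (simp add: add_ac mult.assoc)

text \<open>
  Multiplied by \<open>s\<^bsup>b-a\<^esup>\<close>, the quotient satisfies a homogeneous recurrence and tends to \<open>1\<close> along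
  \<open>s + N\<close>, so it is bounded in the sector.
\<close>

lemma Gamma_quotient_bigo:
  "(\<lambda>s. Gamma (s + a) * rGamma (s + b)) \<in> O[at_sector](\<lambda>s. s powr (a - b))"
proof -
  define d where "d = b - a"
  define \<phi> where "\<phi> = (\<lambda>u. (1 + d * u / (1 + a * u)) * exp (- d * Ln (1 + u)))"
  define \<rho> where "\<rho> = (\<lambda>s. \<phi> (inverse s))"
  define D where "D = (\<lambda>s. Gamma (s + a) * rGamma (s + b) * s powr d)"
  have rho: "(\<lambda>s. \<rho> s - 1) \<in> O[at_sector](\<lambda>s. 1 / s ^ 2)"
  proof -
    define r where "r = 1 / (norm a + 1)"
    have ne: "1 + u \<notin> \<real>\<^sub>\<le>\<^sub>0 \<and> 1 + a * u \<noteq> 0" if "u \<in> ball 0 r" for u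
    proof -
      have n: "norm u * (norm a + 1) < 1"
        using that by (simp add: r_def pos_less_divide_eq add_nonneg_pos)
      have n0: "0 \<le> norm u * norm a" by simp
      have "norm u < 1" "norm (a * u) < 1"
        using n n0 norm_ge_zero[of u] by (auto simp: norm_mult algebra_simps simp del: norm_ge_zero)
      moreover have "1 + a * u \<noteq> 0"
      proof
        assume "1 + a * u = 0"
        hence "norm (a * u) = norm (-1 :: complex)" by (metis add_eq_0_iff)
        thus False using \<open>norm (a * u) < 1\<close> by simp
      qed
      ultimately show ?thesis using abs_Re_le_cmod[of u]
        by (auto simp: complex_nonpos_Reals_iff)
    qed
    have hol: "\<phi> holomorphic_on ball 0 r"
      unfolding \<phi>_def using ne by (auto intro!: holomorphic_intros)
    have "(\<phi> has_field_derivative 0) (at 0)"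
      unfolding \<phi>_def by (auto intro!: derivative_eq_intros)
    hence "deriv \<phi> 0 = 0" by (rule DERIV_imp_deriv)
    moreover have "r > 0" by (simp add: r_def add_nonneg_pos)
    ultimately have "(\<lambda>u. \<phi> u - \<phi> 0) \<in> O[nhds 0](\<lambda>u. u ^ 2)"
      using hol by (intro critical_point_bigo_square) auto
    hence "(\<lambda>s. \<phi> (inverse s) - \<phi> 0) \<in> O[at_sector](\<lambda>s. (inverse s) ^ 2)"
      by (rule landau_o.big.compose) (rule filterlim_inverse_at_sector)
    thus ?thesis by (simp add: \<rho>_def \<phi>_def inverse_eq_divide power_divide)
  qed
  have rec: "\<forall>\<^sub>F s in at_sector. D s = \<rho> s * D (s + 1) + 0"
    using eventually_at_sector_norm_ge[of 1] eventually_at_sector_nonzero[of a]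
      eventually_at_sector_nonpole[of a]
  proof eventually_elim
    case (elim s)
    have "s \<noteq> 0" using elim by auto
    with elim have s0: "s \<noteq> 0" "s \<notin> \<real>\<^sub>\<le>\<^sub>0" using sector_not_nonpos_Reals[of s] by auto
    have s1': "s + 1 \<noteq> 0" using elim norm_sector_add_of_nat[of s 1] by auto
    hence s1: "s + 1 \<noteq> 0" "s + 1 \<notin> \<real>\<^sub>\<le>\<^sub>0"
      using elim sector_add_of_nat[of s 1] sector_not_nonpos_Reals[of "s + 1"] by auto
    have L: "Ln (1 + inverse s) = Ln (s + 1) - Ln s"
    proof -
      have "Ln ((s + 1) / s) = Ln (s + 1) - Ln s"
      proof (rule Ln_unique)
        show "exp (Ln (s + 1) - Ln s) = (s + 1) / s" using s0 s1 by (simp add: exp_diff)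
        \<comment> \<open>The arguments of \<open>s\<close> and \<open>s + 1\<close> lie on the same side of \<open>0\<close>.\<close>
        have "- pi < Im (Ln (s + 1)) - Im (Ln s) \<and> Im (Ln (s + 1)) - Im (Ln s) < pi"
          using Im_Ln_pos_le[OF s0(1)] Im_Ln_pos_le[OF s1(1)] Im_Ln_less_pi[OF s0(2)]
            Im_Ln_less_pi[OF s1(2)] mpi_less_Im_Ln[OF s0(1)] mpi_less_Im_Ln[OF s1(1)]
          by (cases "Im s \<ge> 0") (simp; linarith)+
        thus "- pi < Im (Ln (s + 1) - Ln s)" "Im (Ln (s + 1) - Ln s) \<le> pi" by auto
      qed
      thus ?thesis using s0 by (simp add: field_simps)
    qed
    have G: "Gamma (s + 1 + a) = (s + a) * Gamma (s + a)"
      using Gamma_plus1[of "s + a"] elim by (simp add: add_ac)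
    have R: "rGamma (s + b) = (s + b) * rGamma (s + 1 + b)"
      using rGamma_plus1[of "s + b"] by (simp add: add_ac)
    have E: "exp (- d * (Ln (s + 1) - Ln s)) * (s + 1) powr d = s powr d"
      using s0 s1 by (simp add: powr_def algebra_simps flip: exp_add)
    have q: "1 + d * inverse s / (1 + a * inverse s) = (s + b) / (s + a)"
      using s0 elim by (simp add: d_def divide_simps add_eq_0_iff2)
    have "\<rho> s * D (s + 1) = (s + b) / (s + a) * (Gamma (s + 1 + a) * rGamma (s + 1 + b)) *
        (exp (- d * (Ln (s + 1) - Ln s)) * (s + 1) powr d)"
      unfolding \<rho>_def \<phi>_def L q D_def by simp
    also have "\<dots> = D s" unfolding E G D_def R using elim by simp
    finally show ?case by simp
  qed
  have lim: "\<forall>\<^sub>F s in at_sector. (\<lambda>N. D (s + of_nat N)) \<longlonglongrightarrow> 1"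
    using eventually_at_sector_nonpole[of a] eventually_at_sector_nonpole[of b]
    by eventually_elim (use Gamma_quotient_powr_LIMSEQ in \<open>auto simp: D_def d_def\<close>)
  obtain K where "K \<ge> 0" and K: "\<forall>\<^sub>F s in at_sector. norm (D s) \<le> K * (norm (1::complex) + 1 / norm s ^ 1)"
    using sector_recurrence_bound[OF rec rho _ _ lim, of 1] by auto
  have "\<forall>\<^sub>F s in at_sector. norm (D s) \<le> (2 * K) * norm (1::complex)"
    using K eventually_at_sector_norm_ge[of 1]
  proof (eventually_elim)
    case (elim s)
    have "1 / norm s \<le> 1" using elim by (auto simp: divide_le_eq)
    hence "K * (1 + 1 / norm s) \<le> K * 2" using \<open>K \<ge> 0\<close> by (intro mult_left_mono) auto
    thus ?case using elim by simp
  qed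
  hence "D \<in> O[at_sector](\<lambda>_. 1)" by (rule bigoI)
  hence "(\<lambda>s. D s * s powr (- d)) \<in> O[at_sector](\<lambda>s. 1 * s powr (- d))"
    by (rule landau_o.big.mult) simp
  moreover have "\<forall>\<^sub>F s in at_sector. D s * s powr (- d) = Gamma (s + a) * rGamma (s + b)"
    using eventually_at_sector_nonzero[of 0] by eventually_elim (simp add: D_def powr_minus)
  ultimately show ?thesis by (simp add: d_def landau_o.big.in_cong)
qed

section \<open>An asymptotic form of Gauss's summation theorem\<close>

text \<open>
  The partial sums of \<open>\<^sub>2F\<^sub>1(\<alpha>, \<beta>; c; 1)\<close>.
\<close>

definition gauss_partial_sum :: "nat \<Rightarrow> complex \<Rightarrow> complex \<Rightarrow> complex \<Rightarrow> complex" where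
  "gauss_partial_sum M \<alpha> \<beta> c =
     (\<Sum>i<M. pochhammer \<alpha> i * pochhammer \<beta> i / (fact i * pochhammer c i))"

text \<open>
  The quotient \<open>\<Gamma>(c) \<Gamma>(c - \<alpha> - \<beta>) / (\<Gamma>(c - \<alpha>) \<Gamma>(c - \<beta>))\<close> satisfies the contiguous relation with
  right-hand side \<open>0\<close>. For the partial sums the contributions of the summands telescope, so that only one
  term is left over.
\<close>

lemma gauss_partial_sum_contiguous:
  assumes c: "c \<notin> \<int>\<^sub>\<le>\<^sub>0"
  shows "c * (c - \<alpha> - \<beta>) * gauss_partial_sum (Suc M) \<alpha> \<beta> c -
         (c - \<alpha>) * (c - \<beta>) * gauss_partial_sum (Suc M) \<alpha> \<beta> (c + 1) =
         - (pochhammer \<alpha> (Suc M) * pochhammer \<beta> (Suc M) / (fact M * pochhammer (c + 1) M))"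
proof (induction M)
  case 0
  show ?case by (simp add: gauss_partial_sum_def algebra_simps)
next
  case (Suc M)
  let ?a = "pochhammer \<alpha> (Suc M)" and ?b = "pochhammer \<beta> (Suc M)"
  define f :: complex where "f = fact M"
  define P where "P = pochhammer (c + 1) M"
  define x :: complex where "x = of_nat (Suc M)"
  have nz: "c + of_nat k \<noteq> 0" for k using c by (metis plus_of_nat_eq_0_imp add.commute)
  have "pochhammer c k \<noteq> 0" for k
    using nz by (auto simp: pochhammer_eq_0_iff add_eq_0_iff2)
  from this[of "Suc M"] have P0: "c \<noteq> 0" "P \<noteq> 0" by (auto simp: pochhammer_rec P_def)
  have nz1: "c + x \<noteq> 0" using nz[of "Suc M"] by (simp add: x_def)
  have f0: "f \<noteq> 0" "x \<noteq> 0" using of_nat_neq_0 by (simp_all add: f_def x_def del: of_nat_Suc)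
  have p1: "pochhammer (c + 1) (Suc M) = P * (c + x)"
    by (simp add: P_def x_def pochhammer_Suc algebra_simps)
  have p0: "pochhammer c (Suc M) = c * P" by (simp add: P_def pochhammer_rec)
  have fS: "fact (Suc M) = x * f" by (simp add: f_def x_def)
  have T: "gauss_partial_sum (Suc (Suc M)) \<alpha> \<beta> z = gauss_partial_sum (Suc M) \<alpha> \<beta> z +
      ?a * ?b / (fact (Suc M) * pochhammer z (Suc M))" for z
    by (simp add: gauss_partial_sum_def)
  have "c * (c - \<alpha> - \<beta>) * gauss_partial_sum (Suc (Suc M)) \<alpha> \<beta> c -
         (c - \<alpha>) * (c - \<beta>) * gauss_partial_sum (Suc (Suc M)) \<alpha> \<beta> (c + 1) =
     - (?a * ?b / (f * P)) +
     (c * (c - \<alpha> - \<beta>) * (?a * ?b / (x * f * (c * P))) -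
      (c - \<alpha>) * (c - \<beta>) * (?a * ?b / (x * f * (P * (c + x)))))"
    using Suc.IH unfolding T p0 p1 fS f_def[symmetric] P_def[symmetric]
    by (simp add: algebra_simps)
  also have "\<dots> = - (?a * (\<alpha> + x) * (?b * (\<beta> + x)) / (x * f * (P * (c + x))))"
    using P0 f0 nz1 by (simp add: divide_simps) (simp add: algebra_simps)
  also have "?a * (\<alpha> + x) = pochhammer \<alpha> (Suc (Suc M))"
    by (simp add: x_def pochhammer_Suc)
  also have "?b * (\<beta> + x) = pochhammer \<beta> (Suc (Suc M))"
    by (simp add: x_def pochhammer_Suc)
  finally show ?case unfolding p1 fS .
qed

lemma bigo_cmult_left:
  fixes f g :: "complex \<Rightarrow> complex"
  shows "f \<in> O[F](g) \<Longrightarrow> (\<lambda>x. c * f x) \<in> O[F](g)"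
  by simp

lemma bigo_inverse_shift: "(\<lambda>s. 1 / (s + c)) \<in> O[at_sector](\<lambda>s. 1 / s)"
proof -
  have "(\<lambda>s. inverse (s + c)) \<in> \<Theta>[at_sector](\<lambda>s. inverse s)"
    by (subst landau_theta.inverse_cancel)
       (use shift_bigtheta_at_sector[of c] eventually_at_sector_nonzero[of 0]
          eventually_at_sector_nonzero[of c] in \<open>auto intro: bigtheta_sym[THEN iffD1]\<close>)
  thus ?thesis by (simp add: inverse_eq_divide bigthetaD1)
qed

lemma bigo_inverse_pochhammer_shift:
  "(\<lambda>s. 1 / pochhammer (s + c) i) \<in> O[at_sector](\<lambda>s. 1 / s ^ i)"
proof (induction i)
  case (Suc i)
  from landau_o.big.mult[OF Suc bigo_inverse_shift[of "c + of_nat i"]]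
  show ?case by (simp add: pochhammer_Suc add_ac mult_ac)
qed simp

text \<open>
  By Gauss's theorem the quotient equals the full series when the latter converges. The asymptotic
  statement holds without a convergence condition: the difference of the quotient and the partial sum solves an
  inhomogeneous recurrence and tends to \<open>0\<close> along \<open>s + N\<close>.
\<close>

lemma gauss_asymptotics:
  assumes "M \<ge> 1"
  shows "(\<lambda>s. Gamma (s + c) * Gamma (s + c - \<alpha> - \<beta>) * (rGamma (s + c - \<alpha>) * rGamma (s + c - \<beta>)) -
        gauss_partial_sum M \<alpha> \<beta> (s + c)) \<in> O[at_sector](\<lambda>s. 1 / s ^ M)"
proof -
  obtain m where Suc: "M = Suc m" using assms by (cases M) auto
  define S where "S = (\<lambda>s. Gamma (s + c) * Gamma (s + c - \<alpha> - \<beta>) * (rGamma (s + c - \<alpha>) * rGamma (s + c - \<beta>)))"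
  define D where "D = (\<lambda>s. S s - gauss_partial_sum M \<alpha> \<beta> (s + c))"
  define \<rho> where "\<rho> = (\<lambda>s. (s + c - \<alpha>) * (s + c - \<beta>) / ((s + c) * (s + c - \<alpha> - \<beta>)))"
  define e where "e = (\<lambda>s. (pochhammer \<alpha> M * pochhammer \<beta> M / fact m) *
      (1 / pochhammer (s + (c + 1)) m * (1 / (s + c) * (1 / (s + (c - \<alpha> - \<beta>))))))"
  have nz: "\<forall>\<^sub>F s in at_sector. s + c \<notin> \<int>\<^sub>\<le>\<^sub>0 \<and> s + (c - \<alpha>) \<notin> \<int>\<^sub>\<le>\<^sub>0 \<and> s + (c - \<beta>) \<notin> \<int>\<^sub>\<le>\<^sub>0 \<and>
      s + (c - \<alpha> - \<beta>) \<notin> \<int>\<^sub>\<le>\<^sub>0"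
    by (intro eventually_conj eventually_at_sector_nonpole)
  have rec: "\<forall>\<^sub>F s in at_sector. D s = \<rho> s * D (s + 1) + e s"
    using nz
  proof eventually_elim
    case (elim s)
    define z where "z = s + c"
    have np: "z \<notin> \<int>\<^sub>\<le>\<^sub>0" "z - \<alpha> \<notin> \<int>\<^sub>\<le>\<^sub>0" "z - \<beta> \<notin> \<int>\<^sub>\<le>\<^sub>0" "z - \<alpha> - \<beta> \<notin> \<int>\<^sub>\<le>\<^sub>0"
      using elim by (simp_all add: z_def algebra_simps)
    have n0: "z \<noteq> 0" "z - \<alpha> \<noteq> 0" "z - \<beta> \<noteq> 0" "z - \<alpha> - \<beta> \<noteq> 0"
      using np by (auto simp del: right_minus_eq)
    have s1: "s + 1 + c = z + 1" by (simp add: z_def)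
    have G: "Gamma (z + 1) = z * Gamma z" "Gamma (z + 1 - \<alpha> - \<beta>) = (z - \<alpha> - \<beta>) * Gamma (z - \<alpha> - \<beta>)"
      using Gamma_plus1[OF np(1)] Gamma_plus1[OF np(4)] by (simp_all add: algebra_simps)
    have R: "rGamma (z - \<alpha>) = (z - \<alpha>) * rGamma (z + 1 - \<alpha>)" "rGamma (z - \<beta>) = (z - \<beta>) * rGamma (z + 1 - \<beta>)"
      using rGamma_plus1[of "z - \<alpha>"] rGamma_plus1[of "z - \<beta>"] by (simp_all add: algebra_simps)
    have S: "S s = \<rho> s * S (s + 1)"
      unfolding S_def \<rho>_def s1 unfolding z_def[symmetric] G R using n0 by (simp add: divide_simps)
    have T: "gauss_partial_sum M \<alpha> \<beta> z = \<rho> s * gauss_partial_sum M \<alpha> \<beta> (z + 1) - e s"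
    proof -
      have e: "e s = pochhammer \<alpha> M * pochhammer \<beta> M / (fact m * pochhammer (z + 1) m) / (z * (z - \<alpha> - \<beta>))"
        by (simp add: e_def z_def add_ac diff_add_eq add_diff_eq mult.commute)
      have "z * (z - \<alpha> - \<beta>) * gauss_partial_sum M \<alpha> \<beta> z =
          (z - \<alpha>) * (z - \<beta>) * gauss_partial_sum M \<alpha> \<beta> (z + 1) - z * (z - \<alpha> - \<beta>) * e s"
      proof -
        have Q: "z * (z - \<alpha> - \<beta>) * e s =
            pochhammer \<alpha> M * pochhammer \<beta> M / (fact m * pochhammer (z + 1) m)"
          unfolding e using n0 by simp
        show ?thesis
          using gauss_partial_sum_contiguous[OF np(1), of \<alpha> \<beta> m] unfolding Suc[symmetric] Q
          by (metis diff_eq_eq diff_minus_eq_add minus_diff_eq add.commute uminus_add_conv_diff)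
      qed
      hence "z * (z - \<alpha> - \<beta>) * gauss_partial_sum M \<alpha> \<beta> z =
          z * (z - \<alpha> - \<beta>) * (\<rho> s * gauss_partial_sum M \<alpha> \<beta> (z + 1) - e s)"
      proof -
        have "z * (z - \<alpha> - \<beta>) * \<rho> s = (z - \<alpha>) * (z - \<beta>)"
          unfolding \<rho>_def z_def[symmetric] using n0 by simp
        with \<open>z * (z - \<alpha> - \<beta>) * gauss_partial_sum M \<alpha> \<beta> z = _\<close> show ?thesis
          by (metis right_diff_distrib mult.assoc)
      qed
      thus ?thesis using n0 by simp
    qed
    show ?case unfolding D_def S s1 z_def[symmetric] T by (simp add: algebra_simps)
  qed
  have rho: "(\<lambda>s. \<rho> s - 1) \<in> O[at_sector](\<lambda>s. 1 / s ^ 2)"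
  proof -
    have "(\<lambda>s. \<alpha> * \<beta> * (1 / (s + c) * (1 / (s + (c - \<alpha> - \<beta>))))) \<in> O[at_sector](\<lambda>s. 1 / s * (1 / s))"
      by (intro bigo_cmult_left landau_o.big.mult bigo_inverse_shift)
    moreover have "\<forall>\<^sub>F s in at_sector. \<alpha> * \<beta> * (1 / (s + c) * (1 / (s + (c - \<alpha> - \<beta>)))) = \<rho> s - 1"
      using nz
    proof eventually_elim
      case (elim s)
      define z where "z = s + c"
      have z: "s + (c - \<alpha> - \<beta>) = z - \<alpha> - \<beta>" by (simp add: z_def)
      have n: "z * (z - \<alpha> - \<beta>) \<noteq> 0"
        using elim unfolding z[symmetric] z_def by auto
      have "\<rho> s - 1 = ((z - \<alpha>) * (z - \<beta>) - z * (z - \<alpha> - \<beta>)) / (z * (z - \<alpha> - \<beta>))"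
        unfolding \<rho>_def z_def[symmetric] by (simp only: diff_divide_distrib divide_self[OF n])
      also have "(z - \<alpha>) * (z - \<beta>) - z * (z - \<alpha> - \<beta>) = \<alpha> * \<beta>" by (simp add: algebra_simps)
      finally show ?case unfolding z z_def[symmetric] by simp
    qed
    ultimately have "(\<lambda>s. \<rho> s - 1) \<in> O[at_sector](\<lambda>s. 1 / s * (1 / s))"
      by (simp only: landau_o.big.in_cong)
    thus ?thesis by (simp add: power2_eq_square)
  qed
  have e: "e \<in> O[at_sector](\<lambda>s. 1 / s ^ (M + 1))"
  proof -
    have "(\<lambda>s. (1 / pochhammer (s + (c + 1)) m * (1 / (s + c) * (1 / (s + (c - \<alpha> - \<beta>)))))) \<in>
        O[at_sector](\<lambda>s. 1 / s ^ m * (1 / s * (1 / s)))"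
      by (intro landau_o.big.mult bigo_inverse_shift bigo_inverse_pochhammer_shift)
    hence "e \<in> O[at_sector](\<lambda>s. 1 / s ^ m * (1 / s * (1 / s)))"
      unfolding e_def by (rule bigo_cmult_left)
    thus ?thesis by (simp add: Suc mult_ac)
  qed
  have lim: "\<forall>\<^sub>F s in at_sector. (\<lambda>N. D (s + of_nat N)) \<longlonglongrightarrow> 0"
    using nz eventually_at_sector_norm_ge[of 3]
  proof eventually_elim
    case (elim s)
    have "(\<lambda>N. (Gamma (s + of_nat N + c) * rGamma (s + of_nat N + (c - \<alpha>)) * (s + of_nat N) powr ((c - \<alpha>) - c)) *
        (Gamma (s + of_nat N + (c - \<alpha> - \<beta>)) * rGamma (s + of_nat N + (c - \<beta>)) *
          (s + of_nat N) powr ((c - \<beta>) - (c - \<alpha> - \<beta>)))) \<longlonglongrightarrow> 1 * 1"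
      by (intro tendsto_mult Gamma_quotient_powr_LIMSEQ) (use elim in auto)
    moreover have "(Gamma (s + of_nat N + c) * rGamma (s + of_nat N + (c - \<alpha>)) * (s + of_nat N) powr ((c - \<alpha>) - c)) *
        (Gamma (s + of_nat N + (c - \<alpha> - \<beta>)) * rGamma (s + of_nat N + (c - \<beta>)) *
          (s + of_nat N) powr ((c - \<beta>) - (c - \<alpha> - \<beta>))) = S (s + of_nat N)" for N
    proof -
      have "s + of_nat N \<noteq> 0" using elim norm_sector_add_of_nat[of s N] by auto
      hence p: "(s + of_nat N) powr ((c - \<alpha>) - c) * (s + of_nat N) powr ((c - \<beta>) - (c - \<alpha> - \<beta>)) = 1"
        by (simp flip: powr_add)
      have "S (s + of_nat N) = S (s + of_nat N) *
          ((s + of_nat N) powr ((c - \<alpha>) - c) * (s + of_nat N) powr ((c - \<beta>) - (c - \<alpha> - \<beta>)))"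
        unfolding p by simp
      thus ?thesis unfolding S_def by (simp add: add_diff_eq mult_ac)
    qed
    ultimately have 1: "(\<lambda>N. S (s + of_nat N)) \<longlonglongrightarrow> 1" by simp
    have inf: "filterlim (\<lambda>N. s + of_nat N + c + of_nat k) at_infinity sequentially" for k
      by (intro tendsto_add_filterlim_at_infinity'[OF _ tendsto_const]
          tendsto_add_filterlim_at_infinity[OF tendsto_const] tendsto_of_nat)
    have ip: "(\<lambda>N. 1 / pochhammer (s + of_nat N + c) (Suc i)) \<longlonglongrightarrow> 0" for i
    proof (induction i)
      case 0 show ?case using tendsto_divide_0[OF tendsto_const inf[of 0], of 1] by simp
    next
      case (Suc i)
      have "(\<lambda>N. 1 / pochhammer (s + of_nat N + c) (Suc i) * (1 / (s + of_nat N + c + of_nat (Suc i)))) \<longlonglongrightarrow> 0 * 0"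
        by (intro tendsto_mult Suc tendsto_divide_0[OF tendsto_const inf])
      thus ?case by (simp add: pochhammer_Suc[of _ "Suc i"] mult_ac)
    qed
    have "(\<lambda>N. pochhammer \<alpha> i * pochhammer \<beta> i / (fact i * pochhammer (s + of_nat N + c) i)) \<longlonglongrightarrow>
        (if i = 0 then 1 else 0)" for i
    proof (cases i)
      case (Suc j)
      have "(\<lambda>N. (pochhammer \<alpha> i * pochhammer \<beta> i / fact i) * (1 / pochhammer (s + of_nat N + c) i)) \<longlonglongrightarrow>
          (pochhammer \<alpha> i * pochhammer \<beta> i / fact i) * 0"
        unfolding Suc by (intro tendsto_mult tendsto_const ip)
      thus ?thesis using Suc by simp
    qed auto
    hence "(\<lambda>N. gauss_partial_sum M \<alpha> \<beta> (s + of_nat N + c)) \<longlonglongrightarrow> (\<Sum>i<M. if i = 0 then 1 else 0)"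
      unfolding gauss_partial_sum_def by (intro tendsto_sum)
    also have "(\<Sum>i<M. if i = 0 then 1 else 0 :: complex) = 1" by (simp add: Suc)
    finally have "(\<lambda>N. gauss_partial_sum M \<alpha> \<beta> (s + of_nat N + c)) \<longlonglongrightarrow> 1" .
    from tendsto_diff[OF 1 this] show ?case by (simp add: D_def)
  qed
  obtain K where "\<forall>\<^sub>F s in at_sector. norm (D s) \<le> K * (norm (0::complex) + 1 / norm s ^ M)"
    using sector_recurrence_bound[OF rec rho e _ lim] Suc by auto
  hence "D \<in> O[at_sector](\<lambda>s. 1 / s ^ M)"
    by (intro bigoI[of _ K]) (simp add: norm_divide norm_power)
  thus ?thesis by (simp add: D_def S_def)
qed

section \<open>Noerlund's expansion in inverse factorials\<close>

text \<open>
  An index tuple for \<open>p + 1\<close> is one for \<open>p\<close>, ending at some \<open>k \<le> j\<close>, followed by \<open>j\<close>. This turns the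
  definition of the coefficients into a recursion in \<open>p\<close>.
\<close>

lemma norlund_indices_Suc:
  assumes p: "p \<ge> 1"
  shows "norlund_indices (Suc p) j = (\<Union>k\<le>j. (\<lambda>J. J(p := j)) ` norlund_indices p k)"
proof (intro set_eqI iffI)
  fix J assume J: "J \<in> norlund_indices (Suc p) j"
  let ?J = "restrict J {0..p-1}"
  have ext: "J \<in> extensional {0..p}" and J0: "J 0 = 0" "J p = j"
    and mono: "\<And>m. m \<in> {1..p} \<Longrightarrow> J (m - 1) \<le> J m"
    using J by (auto simp: norlund_indices_def)
  have "?J(p := j) = J"
  proof
    fix x
    show "(?J(p := j)) x = J x"
      using ext J0 p by (cases "x \<le> p - 1") (auto simp: extensional_def)
  qed
  moreover have "?J \<in> norlund_indices p (J (p - 1))"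
    using p J0 mono by (auto simp: norlund_indices_def)
  moreover have "J (p - 1) \<le> j" using mono[of p] p J0 by auto
  ultimately show "J \<in> (\<Union>k\<le>j. (\<lambda>J. J(p := j)) ` norlund_indices p k)"
    by (metis (no_types, lifting) UN_iff atMost_iff image_eqI)
next
  fix J assume "J \<in> (\<Union>k\<le>j. (\<lambda>J. J(p := j)) ` norlund_indices p k)"
  then obtain k I where k: "k \<le> j" and I: "I \<in> norlund_indices p k" and J: "J = I(p := j)" by auto
  have mono: "I (m - 1) \<le> I m" if "m \<in> {1..p-1}" for m
    using I that by (auto simp: norlund_indices_def)
  have "J (m - 1) \<le> J m" if "m \<in> {1..p}" for m
  proof (cases "m = p")
    case True
    have "I (p - 1) = k" using I by (auto simp: norlund_indices_def)
    thus ?thesis using True J k p by auto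
  next
    case False
    thus ?thesis using mono[of m] that J by auto
  qed
  thus "J \<in> norlund_indices (Suc p) j"
    using I J p by (auto simp: norlund_indices_def extensional_def)
qed

lemma norlund_indices_1: "norlund_indices (Suc 0) j = (if j = 0 then {restrict (\<lambda>_. 0) {0}} else {})"
  by (auto simp: norlund_indices_def extensional_def fun_eq_iff)

lemma finite_norlund_indices: "p \<ge> 1 \<Longrightarrow> finite (norlund_indices p j)"
  by (induction p arbitrary: j rule: nat_induct_at_least) (simp_all add: norlund_indices_1 norlund_indices_Suc)

lemma norlund_coeff_1: "norlund_coeff (Suc 0) a b j = (if j = 0 then 1 else 0)"
  by (simp add: norlund_coeff_def norlund_indices_1)

lemma norlund_coeff_Suc:
  assumes p: "p \<ge> 1"
  shows "norlund_coeff (Suc p) a b j =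
    (\<Sum>k\<le>j. norlund_coeff p a b k *
       (pochhammer ((\<Sum>i=1..p. b i - a i) + of_nat k) (j - k) *
        pochhammer (b (Suc p) - a p) (j - k) / fact (j - k)))"
proof -
  define T where "T = (\<lambda>J m. pochhammer ((\<Sum>i=1..m. b i - a i) + of_nat (J (m - 1))) (J m - J (m - 1)) /
        fact (J m - J (m - 1)) * pochhammer (b (m + 1) - a m) (J m - J (m - 1)))"
  define w where "w = (\<lambda>k. pochhammer ((\<Sum>i=1..p. b i - a i) + of_nat k) (j - k) *
        pochhammer (b (Suc p) - a p) (j - k) / fact (j - k))"
  have last: "I (p - 1) = k \<and> I p = undefined" if "I \<in> norlund_indices p k" for I k
    using that p by (auto simp: norlund_indices_def extensional_def)
  have inj: "inj_on (\<lambda>J. J(p := j)) (norlund_indices p k)" for k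
    by (rule inj_onI) (metis fun_upd_triv fun_upd_upd last)
  have disj: "(\<lambda>J. J(p := j)) ` norlund_indices p k \<inter> (\<lambda>J. J(p := j)) ` norlund_indices p k' = {}"
    if "k \<noteq> k'" for k k'
  proof (rule ccontr)
    assume "\<not> ?thesis"
    then obtain I I' where I: "I \<in> norlund_indices p k" "I' \<in> norlund_indices p k'" "I(p := j) = I'(p := j)"
      by auto
    from fun_cong[OF I(3), of "p - 1"] have "I (p - 1) = I' (p - 1)"
      using p by (simp split: if_splits)
    thus False using last[OF I(1)] last[OF I(2)] that by simp
  qed
  have step: "(\<Prod>m=1..Suc p - 1. T (I(p := j)) m) = (\<Prod>m=1..p-1. T I m) * w k"
    if I: "I \<in> norlund_indices p k" for I k
  proof -
    obtain q where q: "p = Suc q" using p by (cases p) auto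
    have "(\<Prod>m=1..Suc p - 1. T (I(p := j)) m) = (\<Prod>m=1..p-1. T (I(p := j)) m) * T (I(p := j)) p"
      by (simp add: q)
    also have "(\<Prod>m=1..p-1. T (I(p := j)) m) = (\<Prod>m=1..p-1. T I m)"
      by (intro prod.cong refl) (auto simp: T_def)
    also have "T (I(p := j)) p = w k"
      using last[OF I] p by (auto simp: T_def w_def)
    finally show ?thesis .
  qed
  have "norlund_coeff (Suc p) a b j = (\<Sum>J\<in>(\<Union>k\<le>j. (\<lambda>J. J(p := j)) ` norlund_indices p k). \<Prod>m=1..Suc p - 1. T J m)"
    unfolding norlund_coeff_def norlund_indices_Suc[OF p] T_def ..
  also have "\<dots> = (\<Sum>k\<le>j. \<Sum>J\<in>(\<lambda>J. J(p := j)) ` norlund_indices p k. \<Prod>m=1..Suc p - 1. T J m)"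
    using p disj by (intro sum.UNION_disjoint) (auto simp: finite_norlund_indices)
  also have "\<dots> = (\<Sum>k\<le>j. \<Sum>I\<in>norlund_indices p k. (\<Prod>m=1..p-1. T I m) * w k)"
  proof (rule sum.cong[OF refl])
    fix k
    show "(\<Sum>J\<in>(\<lambda>J. J(p := j)) ` norlund_indices p k. \<Prod>m=1..Suc p - 1. T J m) =
        (\<Sum>I\<in>norlund_indices p k. (\<Prod>m=1..p-1. T I m) * w k)"
      unfolding sum.reindex[OF inj] o_def by (rule sum.cong[OF refl]) (rule step)
  qed
  also have "\<dots> = (\<Sum>k\<le>j. norlund_coeff p a b k * w k)"
    by (simp add: norlund_coeff_def T_def sum_distrib_right)
  finally show ?thesis by (simp add: w_def)
qed

lemma norlund_coeff_0: "p \<ge> 1 \<Longrightarrow> norlund_coeff p a b 0 = 1"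
  by (induction p rule: nat_induct_at_least) (simp_all add: norlund_coeff_1 norlund_coeff_Suc)

text \<open>
  Multiplied by \<open>\<Gamma>(s + a) / \<Gamma>(s + c)\<close>, the partial sums become inverse factorial series. In this form the
  lemma expresses a product of two Gamma quotients through single ones.
\<close>

lemma gauss_asymptotics_rGamma:
  assumes "M \<ge> 1"
  shows "(\<lambda>s. Gamma (s + (c - \<alpha> - \<beta>)) * rGamma (s + (c - \<beta>)) * (Gamma (s + a) * rGamma (s + (c - \<alpha>))) -
        (\<Sum>i<M. pochhammer \<alpha> i * pochhammer \<beta> i / fact i * (Gamma (s + a) * rGamma (s + c + of_nat i))))
     \<in> O[at_sector](\<lambda>s. s powr (a - c - of_nat M))"
proof -
  define f where "f = (\<lambda>s. (Gamma (s + c) * Gamma (s + c - \<alpha> - \<beta>) * (rGamma (s + c - \<alpha>) * rGamma (s + c - \<beta>)) -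
        gauss_partial_sum M \<alpha> \<beta> (s + c)) * (Gamma (s + a) * rGamma (s + c)))"
  have "f \<in> O[at_sector](\<lambda>s. 1 / s ^ M * s powr (a - c))"
    unfolding f_def by (intro landau_o.big.mult gauss_asymptotics[OF assms] Gamma_quotient_bigo)
  moreover have "\<forall>\<^sub>F s in at_sector. 1 / s ^ M * s powr (a - c) = s powr (a - c - of_nat M)"
    using eventually_at_sector_nonzero[of 0] by eventually_elim (simp add: powr_diff powr_nat)
  ultimately have "f \<in> O[at_sector](\<lambda>s. s powr (a - c - of_nat M))"
    by (simp only: landau_o.big.cong)
  moreover have "\<forall>\<^sub>F s in at_sector. f s =
     Gamma (s + (c - \<alpha> - \<beta>)) * rGamma (s + (c - \<beta>)) * (Gamma (s + a) * rGamma (s + (c - \<alpha>))) -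
        (\<Sum>i<M. pochhammer \<alpha> i * pochhammer \<beta> i / fact i * (Gamma (s + a) * rGamma (s + c + of_nat i)))"
    using eventually_at_sector_nonpole[of c]
  proof eventually_elim
    case (elim s)
    have 1: "Gamma (s + c) * rGamma (s + c) = 1" using elim by (simp add: Gamma_def rGamma_eq_zero_iff)
    have 2: "rGamma (s + c) / pochhammer (s + c) i = rGamma (s + c + of_nat i)" for i
    proof -
      have "rGamma (s + c) \<noteq> 0" using elim by (simp add: rGamma_eq_zero_iff)
      thus ?thesis using pochhammer_rGamma[of "s + c" i] by (auto simp: field_simps)
    qed
    have 3: "gauss_partial_sum M \<alpha> \<beta> (s + c) * (Gamma (s + a) * rGamma (s + c)) =
        (\<Sum>i<M. pochhammer \<alpha> i * pochhammer \<beta> i / fact i * (Gamma (s + a) * rGamma (s + c + of_nat i)))"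
      unfolding gauss_partial_sum_def sum_distrib_right 2[symmetric] by (simp add: mult_ac)
    have "f s = (Gamma (s + c) * rGamma (s + c)) *
        (Gamma (s + (c - \<alpha> - \<beta>)) * rGamma (s + (c - \<beta>)) * (Gamma (s + a) * rGamma (s + (c - \<alpha>)))) -
        gauss_partial_sum M \<alpha> \<beta> (s + c) * (Gamma (s + a) * rGamma (s + c))"
      unfolding f_def by (simp add: algebra_simps)
    thus ?case unfolding 1 3 by simp
  qed
  ultimately show ?thesis by (simp only: landau_o.big.in_cong)
qed

lemma sum_lessThan_triangle:
  fixes f :: "nat \<Rightarrow> nat \<Rightarrow> 'a::comm_monoid_add"
  shows "(\<Sum>j<N. \<Sum>k\<le>j. f k (j - k)) = (\<Sum>k<N. \<Sum>i<N-k. f k i)"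
proof -
  have "(\<Sum>j<N. \<Sum>k\<le>j. f k (j - k)) = (\<Sum>(k, i)\<in>{(k, i). k + i < N}. f k i)"
    by (rule sum.triangle_reindex[symmetric])
  also have "{(k, i). k + i < N} = Sigma {..<N} (\<lambda>k. {..<N-k})" by auto
  finally show ?thesis by (simp add: sum.Sigma)
qed

text \<open>
  Induction on \<open>p\<close>: each term of the expansion for \<open>p\<close> is multiplied by the next Gamma quotient and
  expanded again by \<open>gauss_asymptotics_rGamma\<close>. Collecting the terms of the same order reproduces the
  recursion of the coefficients.
\<close>

lemma norlund_expansion:
  fixes a b :: "nat \<Rightarrow> complex" and p N :: nat
  defines "\<psi> \<equiv> \<lambda>p. \<Sum>i=1..p. b i - a i"
  assumes "p \<ge> 1"
  shows "(\<lambda>s. (\<Prod>k=1..p. Gamma (s + a k) * rGamma (s + b k)) -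
            (\<Sum>j<N. norlund_coeff p a b j * (Gamma (s + a p) * rGamma (s + a p + \<psi> p + of_nat j))))
          \<in> O[at_sector](\<lambda>s. s powr (- \<psi> p - of_nat N))"
  using \<open>p \<ge> 1\<close>
proof (induction p arbitrary: N rule: nat_induct_at_least)
  case base
  show ?case
  proof (cases N)
    case 0
    thus ?thesis using Gamma_quotient_bigo[of "a 1" "b 1"] by (simp add: \<psi>_def)
  next
    case (Suc M)
    have "(\<Sum>j<Suc M. norlund_coeff 1 a b j * (Gamma (s + a 1) * rGamma (s + a 1 + \<psi> 1 + of_nat j))) =
        Gamma (s + a 1) * rGamma (s + b 1)" for s
      by (subst sum.lessThan_Suc_shift) (simp add: norlund_coeff_1 \<psi>_def)
    thus ?thesis by (simp add: Suc)
  qed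
next
  case (Suc p)
  define X where "X = (\<lambda>s j. Gamma (s + a (Suc p)) * rGamma (s + a (Suc p) + \<psi> (Suc p) + of_nat j))"
  define w where "w = (\<lambda>k i. pochhammer (\<psi> p + of_nat k) i * pochhammer (b (Suc p) - a p) i / fact i)"
  define H where "H = (\<lambda>s. Gamma (s + a (Suc p)) * rGamma (s + b (Suc p)))"
  define Y where "Y = (\<lambda>s k. Gamma (s + a p) * rGamma (s + a p + \<psi> p + of_nat k))"
  have psi: "\<psi> (Suc p) = \<psi> p + (b (Suc p) - a (Suc p))" by (simp add: \<psi>_def)
  have nz: "\<forall>\<^sub>F s in at_sector. s \<noteq> (0::complex)" using eventually_at_sector_nonzero[of 0] by simp
  have 1: "(\<lambda>s. ((\<Prod>k=1..p. Gamma (s + a k) * rGamma (s + b k)) - (\<Sum>k<N. norlund_coeff p a b k * Y s k)) * H s)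
      \<in> O[at_sector](\<lambda>s. s powr (- \<psi> (Suc p) - of_nat N))"
  proof -
    have "(\<lambda>s. ((\<Prod>k=1..p. Gamma (s + a k) * rGamma (s + b k)) - (\<Sum>k<N. norlund_coeff p a b k * Y s k)) * H s)
      \<in> O[at_sector](\<lambda>s. s powr (- \<psi> p - of_nat N) * s powr (a (Suc p) - b (Suc p)))"
      unfolding H_def Y_def by (intro landau_o.big.mult Suc.IH Gamma_quotient_bigo)
    also have "(\<lambda>s. s powr (- \<psi> p - of_nat N) * s powr (a (Suc p) - b (Suc p))) =
        (\<lambda>s. s powr (- \<psi> (Suc p) - of_nat N))"
      by (rule ext, simp add: psi flip: powr_add) (simp add: algebra_simps)
    finally show ?thesis .
  qed
  have 2: "(\<lambda>s. \<Sum>k<N. norlund_coeff p a b k * (Y s k * H s - (\<Sum>i<N-k. w k i * X s (k + i))))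
      \<in> O[at_sector](\<lambda>s. s powr (- \<psi> (Suc p) - of_nat N))"
  proof (rule big_sum_in_bigo)
    fix k assume "k \<in> {..<N}"
    hence k: "k < N" by simp
    \<comment> \<open>With this choice \<open>c - \<alpha> - \<beta>\<close>, \<open>c - \<beta>\<close> and \<open>c - \<alpha>\<close> are parameters of the two
       quotients that are multiplied.\<close>
    define c where "c = a (Suc p) + \<psi> (Suc p) + of_nat k"
    define \<alpha> where "\<alpha> = \<psi> p + of_nat k"
    define \<beta> where "\<beta> = b (Suc p) - a p"
    have e: "c - \<alpha> - \<beta> = a p" "c - \<beta> = a p + \<psi> p + of_nat k" "c - \<alpha> = b (Suc p)"
      by (simp_all add: c_def \<alpha>_def \<beta>_def psi)
    have e2: "a (Suc p) - c - of_nat (N - k) = - \<psi> (Suc p) - of_nat N"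
      using k by (simp add: c_def of_nat_diff)
    have "(\<lambda>s. Y s k * H s - (\<Sum>i<N-k. w k i * X s (k + i)))
        \<in> O[at_sector](\<lambda>s. s powr (- \<psi> (Suc p) - of_nat N))"
      using gauss_asymptotics_rGamma[of "N - k" c \<alpha> \<beta> "a (Suc p)"] k
      unfolding e e2 unfolding Y_def H_def w_def X_def \<alpha>_def \<beta>_def c_def by (simp add: add_ac)
    thus "(\<lambda>s. norlund_coeff p a b k * (Y s k * H s - (\<Sum>i<N-k. w k i * X s (k + i))))
        \<in> O[at_sector](\<lambda>s. s powr (- \<psi> (Suc p) - of_nat N))"
      by simp
  qed
  have sum: "(\<Sum>j<N. norlund_coeff (Suc p) a b j * X s j) =
      (\<Sum>k<N. norlund_coeff p a b k * (\<Sum>i<N-k. w k i * X s (k + i)))" for s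
  proof -
    have "(\<Sum>j<N. norlund_coeff (Suc p) a b j * X s j) =
        (\<Sum>j<N. \<Sum>k\<le>j. norlund_coeff p a b k * w k (j - k) * X s (k + (j - k)))"
      unfolding norlund_coeff_Suc[OF \<open>1 \<le> p\<close>] w_def \<psi>_def sum_distrib_right
      by (intro sum.cong refl) auto
    also have "\<dots> = (\<Sum>k<N. \<Sum>i<N-k. norlund_coeff p a b k * w k i * X s (k + i))"
      by (rule sum_lessThan_triangle)
    finally show ?thesis by (simp add: sum_distrib_left mult_ac)
  qed
  have eq: "(\<Prod>k=1..Suc p. Gamma (s + a k) * rGamma (s + b k)) - (\<Sum>j<N. norlund_coeff (Suc p) a b j * X s j) =
     ((\<Prod>k=1..p. Gamma (s + a k) * rGamma (s + b k)) - (\<Sum>k<N. norlund_coeff p a b k * Y s k)) * H s +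
     (\<Sum>k<N. norlund_coeff p a b k * (Y s k * H s - (\<Sum>i<N-k. w k i * X s (k + i))))" for s
    unfolding sum by (simp add: H_def left_diff_distrib right_diff_distrib sum_subtractf sum_distrib_right mult.assoc)
  from sum_in_bigo(1)[OF 1 2] show ?case unfolding eq[symmetric] unfolding X_def .
qed

section \<open>Polynomial bounds in the left half-plane\<close>

text \<open>
  For \<open>t < 1\<close> the factor \<open>t\<^bsup>-s\<^esup>\<close> is exponentially small for \<open>Re s \<rightarrow> -\<infinity>\<close>, so there a polynomial bound of
  unspecified degree is enough.
\<close>

definition poly_bounded_on :: "complex set \<Rightarrow> (complex \<Rightarrow> complex) \<Rightarrow> bool" where
  "poly_bounded_on S f \<longleftrightarrow> (\<exists>k::nat. f \<in> O[inf at_infinity (principal S)](\<lambda>s. s ^ k))"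

lemma eventually_within_norm_ge:
  "\<forall>\<^sub>F s in inf at_infinity (principal S). s \<in> S \<and> r \<le> norm s"
  unfolding eventually_inf_principal eventually_at_infinity by blast

lemma poly_bounded_onE:
  assumes "poly_bounded_on S f"
  obtains k :: nat and C r where "C > 0" "r \<ge> 1" "\<And>s. s \<in> S \<Longrightarrow> r \<le> norm s \<Longrightarrow> norm (f s) \<le> C * norm s ^ k"
proof -
  obtain k where k: "f \<in> O[inf at_infinity (principal S)](\<lambda>s. s ^ k)"
    using assms by (auto simp: poly_bounded_on_def)
  obtain C where C: "C > 0" "\<forall>\<^sub>F s in inf at_infinity (principal S). norm (f s) \<le> C * norm (s ^ k)"
    using k by (elim landau_o.bigE)
  then obtain r where r: "\<And>s. r \<le> norm s \<Longrightarrow> s \<in> S \<Longrightarrow> norm (f s) \<le> C * norm (s ^ k)"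
    unfolding eventually_inf_principal eventually_at_infinity by blast
  show ?thesis
    by (rule that[of C "max r 1" k]) (use C r in \<open>auto simp: norm_power\<close>)
qed

lemma power_bigo_power:
  "k \<le> l \<Longrightarrow> (\<lambda>s. s ^ k) \<in> O[inf at_infinity (principal S)](\<lambda>s::complex. s ^ l)"
  by (rule bigoI[of _ 1], rule eventually_mono[OF eventually_within_norm_ge[of S 1]])
     (auto simp: norm_power intro: power_increasing)

lemma poly_bounded_on_mult:
  assumes "poly_bounded_on S f" "poly_bounded_on S g"
  shows "poly_bounded_on S (\<lambda>s. f s * g s)"
proof -
  obtain k l where kl: "f \<in> O[inf at_infinity (principal S)](\<lambda>s. s ^ k)"
    "g \<in> O[inf at_infinity (principal S)](\<lambda>s. s ^ l)"
    using assms by (auto simp: poly_bounded_on_def)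
  from landau_o.big.mult[OF this] show ?thesis
    unfolding poly_bounded_on_def by (auto simp flip: power_add)
qed

lemma poly_bounded_on_add:
  assumes "poly_bounded_on S f" "poly_bounded_on S g"
  shows "poly_bounded_on S (\<lambda>s. f s + g s)"
proof -
  obtain k l where kl: "f \<in> O[inf at_infinity (principal S)](\<lambda>s. s ^ k)"
    "g \<in> O[inf at_infinity (principal S)](\<lambda>s. s ^ l)"
    using assms by (auto simp: poly_bounded_on_def)
  have "f \<in> O[inf at_infinity (principal S)](\<lambda>s. s ^ (k + l))"
    "g \<in> O[inf at_infinity (principal S)](\<lambda>s. s ^ (k + l))"
    using landau_o.big_trans[OF kl(1) power_bigo_power[of k "k + l"]]
      landau_o.big_trans[OF kl(2) power_bigo_power[of l "k + l"]] by simp_all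
  from sum_in_bigo(1)[OF this] show ?thesis unfolding poly_bounded_on_def by blast
qed

lemma poly_bounded_on_const: "poly_bounded_on S (\<lambda>s. c)"
  unfolding poly_bounded_on_def by (rule exI[of _ 0]) simp

lemma poly_bounded_on_ident: "poly_bounded_on S (\<lambda>s. s)"
  unfolding poly_bounded_on_def by (rule exI[of _ 1]) simp

lemma poly_bounded_on_diff:
  "poly_bounded_on S f \<Longrightarrow> poly_bounded_on S g \<Longrightarrow> poly_bounded_on S (\<lambda>s. f s - g s)"
  using poly_bounded_on_add[of S f "\<lambda>s. (-1) * g s"] poly_bounded_on_mult[OF poly_bounded_on_const[of S "-1"]]
  by simp

lemma poly_bounded_on_sum:
  "(\<And>i. i \<in> I \<Longrightarrow> poly_bounded_on S (f i)) \<Longrightarrow> poly_bounded_on S (\<lambda>s. \<Sum>i\<in>I. f i s)"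
  by (induction I rule: infinite_finite_induct)
     (auto intro: poly_bounded_on_const poly_bounded_on_add)

lemma poly_bounded_on_prod:
  "(\<And>i. i \<in> I \<Longrightarrow> poly_bounded_on S (f i)) \<Longrightarrow> poly_bounded_on S (\<lambda>s. \<Prod>i\<in>I. f i s)"
  by (induction I rule: infinite_finite_induct)
     (auto intro: poly_bounded_on_const poly_bounded_on_mult)

lemma poly_bounded_on_poly: "poly_bounded_on S (\<lambda>s. poly q (s + c))"
  by (induction q)
     (auto intro!: poly_bounded_on_const poly_bounded_on_add poly_bounded_on_mult poly_bounded_on_ident)

lemma poly_bounded_on_pochhammer: "poly_bounded_on S (\<lambda>s. pochhammer (s + c) n)"
  by (induction n)
     (auto simp: pochhammer_Suc intro!: poly_bounded_on_const poly_bounded_on_add poly_bounded_on_mult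
        poly_bounded_on_ident)

lemma poly_bounded_on_inverse_pochhammer: "poly_bounded_on S (\<lambda>s. 1 / pochhammer s n)"
proof -
  have "poly_bounded_on S (\<lambda>s. 1 / (s + of_nat k))" for k
    unfolding poly_bounded_on_def
  proof (intro exI[of _ 0] bigoI[of _ 1] eventually_mono[OF eventually_within_norm_ge[of S "real k + 1"]])
    fix s :: complex assume s: "s \<in> S \<and> real k + 1 \<le> norm s"
    have "norm s \<le> norm (s + of_nat k) + real k"
      using norm_triangle_ineq4[of "s + of_nat k" "of_nat k"] by simp
    hence "1 \<le> norm (s + of_nat k)" using s by linarith
    thus "norm (1 / (s + of_nat k)) \<le> 1 * norm (s ^ 0)" by (auto simp: norm_divide divide_le_eq)
  qed
  hence "poly_bounded_on S (\<lambda>s. \<Prod>k<n. 1 / (s + of_nat k))" by (intro poly_bounded_on_prod)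
  also have "(\<lambda>s::complex. \<Prod>k<n. 1 / (s + of_nat k)) = (\<lambda>s. 1 / pochhammer s n)"
    by (simp add: pochhammer_prod prod_dividef lessThan_atLeast0)
  finally show ?thesis .
qed

lemma poly_bounded_on_cong:
  assumes "\<forall>\<^sub>F s in inf at_infinity (principal S). f s = g s" "poly_bounded_on S g"
  shows "poly_bounded_on S f"
proof -
  from assms(2) obtain k where k: "g \<in> O[inf at_infinity (principal S)](\<lambda>s. s ^ k)"
    by (auto simp: poly_bounded_on_def)
  have "f \<in> O[inf at_infinity (principal S)](\<lambda>s. s ^ k)"
    using landau_o.big.in_cong[OF assms(1)] k by blast
  thus ?thesis by (auto simp: poly_bounded_on_def)
qed

text \<open>
  The norm of \<open>s powr z\<close> is \<open>|s|\<^bsup>Re z\<^esup> exp(- Im z Arg s)\<close>, and the argument is at most \<open>\<pi>\<close> in modulus.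
\<close>

lemma norm_powr_sector_le: "norm (s powr z) \<le> exp (\<bar>Im z\<bar> * pi) * norm s powr Re z"
proof -
  have "- Im z * Arg s \<le> \<bar>Im z\<bar> * pi"
  proof -
    have "- Im z * Arg s \<le> \<bar>Im z\<bar> * \<bar>Arg s\<bar>" by (simp add: abs_ge_minus_self flip: abs_mult)
    also have "\<dots> \<le> \<bar>Im z\<bar> * pi" using Arg_bounded[of s] by (intro mult_left_mono) auto
    finally show ?thesis .
  qed
  hence "norm s powr Re z * exp (- Im z * Arg s) \<le> norm s powr Re z * exp (\<bar>Im z\<bar> * pi)"
    by (intro mult_left_mono) auto
  thus ?thesis by (simp add: norm_powr_complex mult.commute)
qed

lemma powr_bigo_power_at_sector:
  assumes "Re z \<le> real k"
  shows "(\<lambda>s. s powr z) \<in> O[at_sector](\<lambda>s. s ^ k)"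
proof (rule bigoI[of _ "exp (\<bar>Im z\<bar> * pi)"], rule eventually_mono[OF eventually_at_sector_norm_ge[of 1]])
  fix s :: complex assume s: "s \<in> sector \<and> 1 \<le> norm s"
  have "norm s powr Re z \<le> norm s powr real k" using assms s by (intro powr_mono) auto
  also have "\<dots> = norm s ^ k" using s by (intro powr_realpow) auto
  finally have *: "exp (\<bar>Im z\<bar> * pi) * norm s powr Re z \<le> exp (\<bar>Im z\<bar> * pi) * norm s ^ k"
    by (intro mult_left_mono) auto
  show "norm (s powr z) \<le> exp (\<bar>Im z\<bar> * pi) * norm (s ^ k)"
    unfolding norm_power by (rule order_trans[OF norm_powr_sector_le *])
qed

lemma norm_sin_ge_sinh: "sinh \<bar>Im z\<bar> \<le> norm (sin z)"
proof (rule power2_le_imp_le)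
  have "(sinh \<bar>Im z\<bar>)^2 = (exp (2 * Im z) + inverse (exp (2 * Im z)) - 2) / 4"
  proof -
    have "(sinh t)^2 = (exp (2 * t) + exp (- (2 * t)) - 2) / 4" for t :: real
      by (simp add: sinh_field_def power2_eq_square algebra_simps flip: exp_add)
    thus ?thesis by (cases "Im z \<ge> 0") (auto simp: exp_minus)
  qed
  also have "\<dots> \<le> (exp (2 * Im z) + inverse (exp (2 * Im z)) - 2 * cos (2 * Re z)) / 4"
    by simp
  also have "\<dots> = norm (sin z) ^ 2" by (rule norm_sin_squared[symmetric])
  finally show "(sinh \<bar>Im z\<bar>)^2 \<le> norm (sin z) ^ 2" .
qed simp

lemma norm_sin_ge_strip:
  assumes "\<eta> > 0" "\<eta> \<le> \<bar>Im z\<bar>"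
  shows "(1 - exp (- 2 * pi * \<eta>)) / 2 * exp (pi * \<bar>Im z\<bar>) \<le> norm (sin (of_real pi * z))"
proof -
  define y where "y = \<bar>Im z\<bar>"
  have "exp (- 2 * pi * y) \<le> exp (- 2 * pi * \<eta>)" using assms by (simp add: y_def)
  hence "(1 - exp (- 2 * pi * \<eta>)) / 2 * exp (pi * y) \<le> (1 - exp (- 2 * pi * y)) / 2 * exp (pi * y)"
    by (intro mult_right_mono) auto
  also have "\<dots> = sinh (pi * y)"
    by (simp add: sinh_field_def field_simps flip: exp_add)
  also have "pi * y = \<bar>Im (of_real pi * z)\<bar>" by (simp add: y_def abs_mult)
  also have "sinh \<bar>Im (of_real pi * z)\<bar> \<le> norm (sin (of_real pi * z))" by (rule norm_sin_ge_sinh)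
  finally show ?thesis by (simp add: y_def abs_mult)
qed

text \<open>
  Vertical lines half-way between two poles of \<open>\<Gamma>\<close>.
\<close>

lemma norm_sin_ge_half_integer:
  assumes "Re z = - real N - 1 / 2"
  shows "1 / 2 * exp (pi * \<bar>Im z\<bar>) \<le> norm (sin (of_real pi * z))"
proof (rule power2_le_imp_le)
  have "cos (2 * (pi * Re z)) = cos (2 * pi * real N + pi)"
    unfolding assms by (subst cos_minus[symmetric]) (simp add: algebra_simps)
  also have "\<dots> = -1" using cos_2npi[of N] by (simp add: mult_ac)
  finally have c: "cos (2 * Re (of_real pi * z)) = -1" by simp
  have "(1 / 2 * exp (pi * \<bar>Im z\<bar>))^2 = exp (2 * (pi * \<bar>Im z\<bar>)) / 4"
    by (simp add: power2_eq_square exp_double)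
  also have "\<dots> \<le> (exp (2 * Im (of_real pi * z)) + inverse (exp (2 * Im (of_real pi * z))) + 2) / 4"
    by (cases "Im z \<ge> 0") (auto simp flip: exp_minus)
  also have "\<dots> = norm (sin (of_real pi * z)) ^ 2" unfolding norm_sin_squared c by simp
  finally show "(1 / 2 * exp (pi * \<bar>Im z\<bar>))^2 \<le> norm (sin (of_real pi * z)) ^ 2" .
qed simp

lemma filterlim_uminus_at_sector:
  assumes "\<And>s. s \<in> S \<Longrightarrow> Re s \<le> 0"
  shows "filterlim (\<lambda>s. - s) at_sector (inf at_infinity (principal S))"
  unfolding filterlim_iff
proof (intro allI impI)
  fix P assume "eventually P at_sector"
  then obtain r where r: "\<And>s. s \<in> sector \<Longrightarrow> r \<le> norm s \<Longrightarrow> P s" unfolding eventually_at_sector by blast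
  show "\<forall>\<^sub>F s in inf at_infinity (principal S). P (- s)"
    by (rule eventually_mono[OF eventually_within_norm_ge[of S r]])
       (use assms r in \<open>force simp: sector_def\<close>)
qed

text \<open>
  The reflection formula turns the quotient at \<open>s\<close> into one at \<open>-s\<close>, which lies in the sector, times a
  quotient of two sines. The numerator grows at most like \<open>exp(\<pi> |Im s|)\<close>, and the hypothesis keeps \<open>s\<close> so
  far from the poles that the denominator grows at least at this rate.
\<close>

lemma poly_bounded_on_Gamma_quotient:
  assumes S: "\<And>s. s \<in> S \<Longrightarrow> Re s \<le> 0" and \<kappa>: "\<kappa> > 0"
    and sin: "\<And>s. s \<in> S \<Longrightarrow> \<kappa> * exp (pi * \<bar>Im (s + a)\<bar>) \<le> norm (sin (of_real pi * (s + a)))"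
  shows "poly_bounded_on S (\<lambda>s. Gamma (s + a) * rGamma (s + b))"
proof -
  let ?F = "inf at_infinity (principal S)"
  define q where "q = (\<lambda>s. sin (of_real pi * (s + b)) / sin (of_real pi * (s + a)))"
  have q: "poly_bounded_on S q"
    unfolding poly_bounded_on_def
  proof (intro exI[of _ 0] bigoI[of _ "exp (pi * \<bar>Im (b - a)\<bar>) / \<kappa>"] eventually_mono[OF eventually_within_norm_ge[of S 0]])
    fix s :: complex assume s: "s \<in> S \<and> 0 \<le> norm s"
    define E where "E = exp (pi * \<bar>Im (s + a)\<bar>)"
    have E: "E > 0" "\<kappa> * E \<le> norm (sin (of_real pi * (s + a)))" using sin s by (auto simp: E_def)
    have "norm (sin (of_real pi * (s + b))) \<le> exp \<bar>Im (of_real pi * (s + b))\<bar>"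
      using cmod_sin_le_exp[of 1 "of_real pi * (s + b)"] by simp
    also have "\<dots> = exp (pi * \<bar>Im (s + a) + Im (b - a)\<bar>)" by (simp add: abs_mult)
    also have "\<dots> \<le> exp (pi * (\<bar>Im (s + a)\<bar> + \<bar>Im (b - a)\<bar>))"
      using abs_triangle_ineq[of "Im (s + a)" "Im (b - a)"] by (auto intro: mult_left_mono)
    also have "\<dots> = E * exp (pi * \<bar>Im (b - a)\<bar>)" by (simp add: E_def distrib_left exp_add)
    finally have "norm (q s) \<le> E * exp (pi * \<bar>Im (b - a)\<bar>) / (\<kappa> * E)"
      unfolding q_def norm_divide using E \<kappa> by (intro frac_le) auto
    thus "norm (q s) \<le> exp (pi * \<bar>Im (b - a)\<bar>) / \<kappa> * norm (s ^ 0)" using E by simp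
  qed
  have g: "poly_bounded_on S (\<lambda>s. Gamma (- s + (1 - b)) * rGamma (- s + (1 - a)))"
  proof -
    obtain k :: nat where k: "Re ((1 - b) - (1 - a)) \<le> real k" using real_arch_simple by blast
    have "(\<lambda>s. Gamma (s + (1 - b)) * rGamma (s + (1 - a))) \<in> O[at_sector](\<lambda>s. s ^ k)"
      using Gamma_quotient_bigo powr_bigo_power_at_sector[OF k] by (rule landau_o.big_trans)
    hence "(\<lambda>s. Gamma (- s + (1 - b)) * rGamma (- s + (1 - a))) \<in> O[?F](\<lambda>s. (- s) ^ k)"
      by (rule landau_o.big.compose) (rule filterlim_uminus_at_sector[OF S])
    also have "(\<lambda>s. (- s) ^ k) \<in> O[?F](\<lambda>s::complex. s ^ k)"
      by (intro bigoI[of _ 1]) (simp add: norm_power)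
    finally show ?thesis unfolding poly_bounded_on_def by blast
  qed
  have np: "\<forall>\<^sub>F s in ?F. - s + (1 - b) \<notin> \<int>\<^sub>\<le>\<^sub>0"
    using filterlim_uminus_at_sector[of S] S eventually_at_sector_nonpole[of "1 - b"]
    unfolding filterlim_iff by blast
  show ?thesis
  proof (rule poly_bounded_on_cong[OF _ poly_bounded_on_mult[OF q g]])
    show "\<forall>\<^sub>F s in ?F. Gamma (s + a) * rGamma (s + b) =
        q s * (Gamma (- s + (1 - b)) * rGamma (- s + (1 - a)))"
      using np eventually_within_norm_ge[of S 0]
    proof eventually_elim
      case (elim s)
      have sn: "sin (of_real pi * (s + a)) \<noteq> 0"
      proof
        assume "sin (of_real pi * (s + a)) = 0"
        hence "\<kappa> * exp (pi * \<bar>Im (s + a)\<bar>) \<le> 0" using sin[of s] elim by simp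
        thus False using \<kappa> by (simp add: mult_le_0_iff)
      qed
      have refl: "Gamma (s + a) * Gamma (1 - (s + a)) = of_real pi / sin (of_real pi * (s + a))"
        by (rule Gamma_reflection_complex)
      hence "Gamma (1 - (s + a)) \<noteq> 0" using sn by auto
      hence "Gamma (1 - (s + a)) * rGamma (1 - (s + a)) = 1" by (simp add: Gamma_def)
      hence "Gamma (s + a) = Gamma (s + a) * Gamma (1 - (s + a)) * rGamma (1 - (s + a))"
        by (simp add: mult.assoc)
      hence 1: "Gamma (s + a) = of_real pi / sin (of_real pi * (s + a)) * rGamma (1 - (s + a))"
        unfolding refl .
      have "rGamma (s + b) * rGamma (1 - (s + b)) = sin (of_real pi * (s + b)) / of_real pi"
        by (rule rGamma_reflection_complex)
      moreover have "rGamma (1 - (s + b)) \<noteq> 0"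
        using elim by (simp add: rGamma_eq_zero_iff algebra_simps)
      ultimately have 2: "rGamma (s + b) = sin (of_real pi * (s + b)) / of_real pi * Gamma (1 - (s + b))"
        by (simp add: Gamma_def field_simps)
      have e: "1 - (s + a) = - s + (1 - a)" "1 - (s + b) = - s + (1 - b)" by simp_all
      show ?case unfolding 1 2 q_def e by simp
    qed
  qed
qed

section \<open>Left loops and their winding numbers\<close>

lemma horizontal_segment_iff:
  assumes "R \<ge> 0"
  shows "w \<in> closed_segment (z - of_real R) z \<longleftrightarrow> Im w = Im z \<and> Re z - R \<le> Re w \<and> Re w \<le> Re z"
  using assms by (subst closed_segment_same_Im) (auto simp: closed_segment_eq_real_ivl)

lemma path_image_truncated_loop:
  "path_image (truncated_loop \<gamma> R) =
     closed_segment (pathstart \<gamma> - of_real R) (pathstart \<gamma>) \<union> path_image \<gamma> \<union>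
     closed_segment (pathfinish \<gamma> - of_real R) (pathfinish \<gamma>)"
  unfolding truncated_loop_def by (simp add: path_image_join closed_segment_commute Un_assoc)

lemma path_image_closed_loop:
  "path_image (closed_loop \<gamma> R) = path_image (truncated_loop \<gamma> R) \<union>
     closed_segment (pathfinish \<gamma> - of_real R) (pathstart \<gamma> - of_real R)"
proof -
  have "pathfinish (truncated_loop \<gamma> R) = pathfinish \<gamma> - of_real R"
    by (simp add: truncated_loop_def)
  thus ?thesis unfolding closed_loop_def by (simp add: path_image_join)
qed

lemma truncated_loop_ends [simp]:
  "pathstart (truncated_loop \<gamma> R) = pathstart \<gamma> - of_real R"
  "pathfinish (truncated_loop \<gamma> R) = pathfinish \<gamma> - of_real R"
  by (simp_all add: truncated_loop_def)

lemma path_image_truncated_loop_mono: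
  assumes "0 \<le> R" "R \<le> R'"
  shows "path_image (truncated_loop \<gamma> R) \<subseteq> path_image (truncated_loop \<gamma> R')"
  unfolding path_image_truncated_loop using assms horizontal_segment_iff by fastforce

lemma on_side_of_loop_avoids:
  assumes "on_left_of_loop \<gamma> z \<or> on_right_of_loop \<gamma> z" "0 \<le> R"
  shows "z \<notin> path_image (truncated_loop \<gamma> R)"
proof -
  have "\<forall>\<^sub>F R in at_top. z \<notin> path_image (closed_loop \<gamma> R)"
    using assms(1) unfolding on_left_of_loop_def on_right_of_loop_def
    by (auto elim: eventually_mono)
  from eventually_happens[OF eventually_conj[OF eventually_ge_at_top[of R] this]]
  obtain R' where "R' \<ge> R" "z \<notin> path_image (closed_loop \<gamma> R')"
    by auto
  thus ?thesis using path_image_truncated_loop_mono[OF assms(2), of R' \<gamma>]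
    by (auto simp: path_image_closed_loop)
qed

text \<open>
  The rectangle with corners \<open>- R \<plusminus> R \<i>\<close> and \<open>c \<plusminus> R \<i>\<close> without its left side, run through like the loop
  from the lower left to the upper left. For \<open>R \<rightarrow> \<infinity>\<close> it becomes the line \<open>Re s = c\<close>.
\<close>

definition three_sides :: "real \<Rightarrow> real \<Rightarrow> real \<Rightarrow> complex" where
  "three_sides c R = linepath (Complex (- R) (- R)) (Complex c (- R)) +++
     linepath (Complex c (- R)) (Complex c R) +++ linepath (Complex c R) (Complex (- R) R)"

lemma three_sides_ends [simp]:
  "pathstart (three_sides c R) = Complex (- R) (- R)" "pathfinish (three_sides c R) = Complex (- R) R"
  by (simp_all add: three_sides_def)

lemma valid_path_three_sides [simp]: "valid_path (three_sides c R)"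
  by (simp add: three_sides_def)

lemma path_three_sides [simp]: "path (three_sides c R)"
  by (simp add: valid_path_imp_path)

lemma path_image_three_sides:
  "path_image (three_sides c R) = closed_segment (Complex (- R) (- R)) (Complex c (- R)) \<union>
     closed_segment (Complex c (- R)) (Complex c R) \<union> closed_segment (Complex c R) (Complex (- R) R)"
  unfolding three_sides_def by (simp add: path_image_join Un_assoc)

lemma three_sides_cases:
  assumes "w \<in> path_image (three_sides c R)" "0 \<le> R" "- R \<le> c"
  shows "(\<bar>Im w\<bar> = R \<and> - R \<le> Re w \<and> Re w \<le> c) \<or> (Re w = c \<and> \<bar>Im w\<bar> \<le> R)"
  using assms unfolding path_image_three_sides
  by (auto simp: closed_segment_same_Im closed_segment_same_Re closed_segment_eq_real_ivl
      split: if_splits)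

text \<open>
  The closed path between the truncated loop and the three sides of the rectangle. The left side of
  \<^const>\<open>closed_loop\<close> crosses the strip that contains the poles on the left and meets some of them for certain
  \<open>R\<close>; the two segments that close this path stay outside the strip.
\<close>

definition outer_loop :: "(real \<Rightarrow> complex) \<Rightarrow> real \<Rightarrow> real \<Rightarrow> real \<Rightarrow> complex" where
  "outer_loop \<gamma> c R = truncated_loop \<gamma> R +++ linepath (pathfinish \<gamma> - of_real R) (Complex (- R) R) +++
     reversepath (three_sides c R) +++ linepath (Complex (- R) (- R)) (pathstart \<gamma> - of_real R)"

lemma path_image_outer_loop:
  "path_image (outer_loop \<gamma> c R) = path_image (truncated_loop \<gamma> R) \<union>
     closed_segment (pathfinish \<gamma> - of_real R) (Complex (- R) R) \<union> path_image (three_sides c R) \<union>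
     closed_segment (Complex (- R) (- R)) (pathstart \<gamma> - of_real R)"
  unfolding outer_loop_def by (simp add: path_image_join Un_assoc)

lemma outer_loop_ends [simp]:
  "pathstart (outer_loop \<gamma> c R) = pathstart \<gamma> - of_real R"
  "pathfinish (outer_loop \<gamma> c R) = pathstart \<gamma> - of_real R"
  by (simp_all add: outer_loop_def)

text \<open>
  \<open>P\<close> stands for the poles on the left and \<open>n\<close> for the number of those on the right. In the application, \<open>P\<close>
  is a union of finitely many sequences that move to the left in unit steps.
\<close>

locale separating_loop =
  fixes \<gamma> :: "real \<Rightarrow> complex" and P :: "complex set" and n :: nat
  assumes loop: "left_loop \<gamma>"
    and closed_P: "closed P" and countable_P: "countable P"
    and down: "z \<in> P \<Longrightarrow> z - 1 \<in> P"
    and finite_P: "finite {z \<in> P. x \<le> Re z}"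
    and left: "z \<in> P \<Longrightarrow> on_left_of_loop \<gamma> z"
    and right: "k < n \<Longrightarrow> on_right_of_loop \<gamma> (- of_nat k)"
begin

abbreviation "Q \<equiv> (\<lambda>k. - of_nat k :: complex) ` {..<n}"

lemma valid_loop: "valid_path \<gamma>" and ends_less: "Im (pathstart \<gamma>) < Im (pathfinish \<gamma>)"
  using loop by (auto simp: left_loop_def)

lemma path_loop: "path \<gamma>"
  using valid_loop by (rule valid_path_imp_path)

lemma valid_truncated_loop: "valid_path (truncated_loop \<gamma> R)"
  unfolding truncated_loop_def using valid_loop by (intro valid_path_join) auto

lemma valid_outer_loop: "valid_path (outer_loop \<gamma> c R)"
  unfolding outer_loop_def using valid_truncated_loop by (intro valid_path_join) auto

lemma path_truncated_loop: "path (truncated_loop \<gamma> R)"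
  and path_outer_loop: "path (outer_loop \<gamma> c R)"
  using valid_truncated_loop valid_outer_loop by (auto intro: valid_path_imp_path)

lemma path_closed_loop: "path (closed_loop \<gamma> R)"
  and closed_loop_closed: "pathfinish (closed_loop \<gamma> R) = pathstart (closed_loop \<gamma> R)"
  unfolding closed_loop_def using path_truncated_loop by auto

definition rad :: real where
  "rad = (SOME M. 0 < M \<and> path_image \<gamma> \<subseteq> ball 0 M)"

lemma rad_pos: "0 < rad" and path_image_rad: "path_image \<gamma> \<subseteq> ball 0 rad"
proof -
  have "\<exists>M. 0 < M \<and> path_image \<gamma> \<subseteq> ball 0 M"
    using bounded_subset_ballD[OF bounded_path_image[OF path_loop], of 0] by blast
  hence "0 < rad \<and> path_image \<gamma> \<subseteq> ball 0 rad" unfolding rad_def by (rule someI_ex)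
  thus "0 < rad" "path_image \<gamma> \<subseteq> ball 0 rad" by auto
qed

lemma norm_less_rad: "w \<in> path_image \<gamma> \<Longrightarrow> norm w < rad"
  using path_image_rad by auto

lemma ends_rad:
  "norm (pathstart \<gamma>) < rad" "norm (pathfinish \<gamma>) < rad"
  "\<bar>Re (pathstart \<gamma>)\<bar> < rad" "\<bar>Im (pathstart \<gamma>)\<bar> < rad"
  "\<bar>Re (pathfinish \<gamma>)\<bar> < rad" "\<bar>Im (pathfinish \<gamma>)\<bar> < rad"
proof -
  show 1: "norm (pathstart \<gamma>) < rad" "norm (pathfinish \<gamma>) < rad"
    by (intro norm_less_rad pathstart_in_path_image pathfinish_in_path_image)+
  thus "\<bar>Re (pathstart \<gamma>)\<bar> < rad" "\<bar>Im (pathstart \<gamma>)\<bar> < rad"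
    "\<bar>Re (pathfinish \<gamma>)\<bar> < rad" "\<bar>Im (pathfinish \<gamma>)\<bar> < rad"
    using abs_Re_le_cmod[of "pathstart \<gamma>"] abs_Im_le_cmod[of "pathstart \<gamma>"]
      abs_Re_le_cmod[of "pathfinish \<gamma>"] abs_Im_le_cmod[of "pathfinish \<gamma>"] by linarith+
qed

lemma down_of_nat: "z \<in> P \<Longrightarrow> z - of_nat l \<in> P"
proof (induction l)
  case (Suc l)
  from down[OF Suc.IH[OF Suc.prems]] show ?case by (simp add: diff_diff_eq add.commute)
qed simp

lemma winding_number_zero_on_unbounded:
  assumes "path g" "pathfinish g = pathstart g" "w \<in> T" "connected T" "T \<inter> path_image g = {}"
    and far: "\<And>B::real. \<exists>u\<in>T. B \<le> norm u"
  shows "winding_number g w = 0"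
proof -
  obtain B where B: "\<And>z. B \<le> norm z \<Longrightarrow> winding_number g z = 0"
    using winding_number_zero_at_infinity[OF assms(1,2)] by blast
  obtain u where u: "u \<in> T" "B \<le> norm u" using far by blast
  have "winding_number g w = winding_number g u"
    by (rule winding_number_eq[OF assms(1,2,3) u(1) assms(4,5)])
  thus ?thesis using B u by simp
qed

text \<open>
  A pole outside the open strip between the two rays could be moved to the left, by \<open>down\<close>, past all of \<open>\<gamma>\<close>.
  There the vertical half-line away from the strip joins it to infinity without meeting the closed
  loop, which would therefore not encircle it.
\<close>

lemma strip:
  assumes "z \<in> P"
  shows "Im (pathstart \<gamma>) < Im z" "Im z < Im (pathfinish \<gamma>)"
proof -
  obtain l :: nat where l: "Re z + rad < real l" using reals_Archimedean2 by blast
  define w where "w = z - of_nat l"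
  have w: "w \<in> P" "Im w = Im z" "Re w < - rad"
    using down_of_nat[OF assms] l by (auto simp: w_def)
  obtain R where R: "R \<ge> 0" "w \<notin> path_image (closed_loop \<gamma> R)" "winding_number (closed_loop \<gamma> R) w = 1"
    using eventually_happens[OF eventually_conj[OF eventually_ge_at_top[of "0::real"]
        left[OF w(1), unfolded on_left_of_loop_def]]] by auto
  have up: "Im x \<le> Im (pathfinish \<gamma>)" and lo: "Im (pathstart \<gamma>) \<le> Im x"
    if x: "x \<in> path_image (closed_loop \<gamma> R)" "Re x < - rad" for x
  proof -
    have "closed_segment (pathfinish \<gamma> - of_real R) (pathstart \<gamma> - of_real R) \<subseteq> {x. Im x \<le> Im (pathfinish \<gamma>)}"
      using ends_less by (intro closed_segment_subset convex_halfspace_Im_le) auto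
    moreover have "closed_segment (pathfinish \<gamma> - of_real R) (pathstart \<gamma> - of_real R) \<subseteq> {x. Im (pathstart \<gamma>) \<le> Im x}"
      using ends_less by (intro closed_segment_subset convex_halfspace_Im_ge) auto
    moreover have "x \<notin> path_image \<gamma>"
      using norm_less_rad[of x] x(2) abs_Re_le_cmod[of x] by auto
    ultimately show "Im x \<le> Im (pathfinish \<gamma>)" "Im (pathstart \<gamma>) \<le> Im x"
      using x(1) ends_less R(1)
      by (auto simp: path_image_closed_loop path_image_truncated_loop horizontal_segment_iff)
  qed
  have False if "Im (pathfinish \<gamma>) \<le> Im z \<or> Im z \<le> Im (pathstart \<gamma>)"
  proof -
    \<comment> \<open>Upwards if the pole lies above the strip, downwards if it lies below.\<close>
    define \<sigma> :: real where "\<sigma> = (if Im (pathfinish \<gamma>) \<le> Im z then 1 else -1)"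
    define T where "T = (\<lambda>v. w + of_real (\<sigma> * v) * \<i>) ` {0..}"
    have "connected T" unfolding T_def
      by (intro connected_continuous_image continuous_intros convex_connected) auto
    moreover have "T \<inter> path_image (closed_loop \<gamma> R) = {}"
    proof (rule ccontr)
      assume "T \<inter> path_image (closed_loop \<gamma> R) \<noteq> {}"
      then obtain v where v: "v \<ge> 0" "w + of_real (\<sigma> * v) * \<i> \<in> path_image (closed_loop \<gamma> R)"
        by (auto simp: T_def)
      have "Im (pathstart \<gamma>) \<le> Im w + \<sigma> * v \<and> Im w + \<sigma> * v \<le> Im (pathfinish \<gamma>)"
        using up[OF v(2)] lo[OF v(2)] w(3) by simp
      hence "v = 0" using that v(1) w(2) ends_less by (auto simp: \<sigma>_def split: if_splits)
      thus False using v(2) R(2) by simp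
    qed
    moreover have "\<exists>u\<in>T. B \<le> norm u" for B
    proof -
      define v where "v = \<bar>B\<bar> + norm w"
      have "v - norm w \<le> norm (w + of_real (\<sigma> * v) * \<i>)"
      proof -
        have "norm (of_real (\<sigma> * v) * \<i>) = v"
          by (simp only: norm_mult norm_of_real norm_ii abs_mult) (auto simp: \<sigma>_def v_def)
        thus ?thesis using norm_triangle_ineq2[of "of_real (\<sigma> * v) * \<i>" "- w"]
          by (simp add: add.commute)
      qed
      hence "B \<le> norm (w + of_real (\<sigma> * v) * \<i>)" by (simp add: v_def)
      moreover have "w + of_real (\<sigma> * v) * \<i> \<in> T" unfolding T_def by (rule imageI) (simp add: v_def)
      ultimately show ?thesis by blast
    qed
    moreover have "w \<in> T" unfolding T_def by (rule image_eqI[of _ _ 0]) auto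
    ultimately have "winding_number (closed_loop \<gamma> R) w = 0"
      using winding_number_zero_on_unbounded[OF path_closed_loop closed_loop_closed] by blast
    thus False using R by simp
  qed
  thus "Im (pathstart \<gamma>) < Im z" "Im z < Im (pathfinish \<gamma>)" by force+
qed

lemma far_segments:
  assumes "R \<ge> rad"
  shows "closed_segment (pathfinish \<gamma> - of_real R) (Complex (- R) R) \<subseteq>
           {w. Im (pathfinish \<gamma>) \<le> Im w \<and> Re w \<le> rad - R \<and> norm w \<le> 3 * R}"
    and "closed_segment (Complex (- R) (- R)) (pathstart \<gamma> - of_real R) \<subseteq>
           {w. Im w \<le> Im (pathstart \<gamma>) \<and> Re w \<le> rad - R \<and> norm w \<le> 3 * R}"
proof -
  have cball: "convex {w :: complex. norm w \<le> 3 * R}"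
    using convex_cball[of "0::complex" "3 * R"] by (simp add: cball_def)
  have n: "norm (Complex (- R) (\<sigma> * R)) \<le> 3 * R" if "\<bar>\<sigma>\<bar> = 1" for \<sigma>
    using cmod_le[of "Complex (- R) (\<sigma> * R)"] assms rad_pos that by (simp add: abs_mult)
  have e: "norm (z - of_real R) \<le> 3 * R" if "norm z < rad" for z :: complex
    using norm_triangle_ineq4[of z "of_real R"] assms rad_pos that by simp
  show "closed_segment (pathfinish \<gamma> - of_real R) (Complex (- R) R) \<subseteq>
           {w. Im (pathfinish \<gamma>) \<le> Im w \<and> Re w \<le> rad - R \<and> norm w \<le> 3 * R}"
    using assms ends_rad n[of 1] e
    by (intro closed_segment_subset)
       (auto simp: Collect_conj_eq cball convex_halfspace_Im_ge convex_halfspace_Re_le convex_Int)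
  show "closed_segment (Complex (- R) (- R)) (pathstart \<gamma> - of_real R) \<subseteq>
           {w. Im w \<le> Im (pathstart \<gamma>) \<and> Re w \<le> rad - R \<and> norm w \<le> 3 * R}"
    using assms ends_rad n[of "-1"] e
    by (intro closed_segment_subset)
       (auto simp: Collect_conj_eq cball convex_halfspace_Im_le convex_halfspace_Re_le convex_Int)
qed

text \<open>
  The outer loop arises from the closed loop and the reversed rectangle; their left sides and the two
  connecting segments form a quadrilateral, which lies too far to the left to encircle \<open>z\<close>.
\<close>

lemma winding_number_outer_loop:
  assumes R: "R \<ge> rad" "- R < c" and z: "rad - R < Re z" "\<bar>Im z\<bar> < R" "Re z < c"
    and cl: "z \<notin> path_image (closed_loop \<gamma> R)"
  shows "z \<notin> path_image (outer_loop \<gamma> c R)"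
    and "winding_number (outer_loop \<gamma> c R) z = winding_number (closed_loop \<gamma> R) z - 1"
proof -
  let ?f = "pathfinish \<gamma> - of_real R" and ?s = "pathstart \<gamma> - of_real R"
  let ?a = "Complex (- R) (- R)" and ?d = "Complex (- R) R"
  have R0: "R > 0" using R rad_pos by simp
  have seg: "closed_segment u v \<subseteq> {w. Re w \<le> rad - R}"
    if "Re u \<le> rad - R" "Re v \<le> rad - R" for u v
    using that by (intro closed_segment_subset convex_halfspace_Re_le) auto
  hence far: "z \<notin> closed_segment u v" if "Re u \<le> rad - R" "Re v \<le> rad - R" for u v
    using that z by (metis (mono_tags, lifting) linorder_not_less mem_Collect_eq subsetD)
  have re: "Re ?f \<le> rad - R" "Re ?s \<le> rad - R" "Re ?a \<le> rad - R" "Re ?d \<le> rad - R"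
    using ends_rad rad_pos by auto
  have tr: "z \<notin> path_image (truncated_loop \<gamma> R)" using cl by (simp add: path_image_closed_loop)
  have ts: "z \<notin> path_image (three_sides c R)"
    using three_sides_cases[of z c R] R0 R z by auto
  show out: "z \<notin> path_image (outer_loop \<gamma> c R)"
    unfolding path_image_outer_loop using tr ts far re by auto
  let ?w = "\<lambda>u v. winding_number (linepath u v) z"
  have 1: "winding_number (outer_loop \<gamma> c R) z =
      winding_number (truncated_loop \<gamma> R) z + (?w ?f ?d + (- winding_number (three_sides c R) z + ?w ?a ?s))"
    unfolding outer_loop_def using tr ts far[OF re(1,4)] far[OF re(3,2)]
    by (simp add: winding_number_join winding_number_reversepath path_image_join path_truncated_loop)
  have 2: "winding_number (closed_loop \<gamma> R) z = winding_number (truncated_loop \<gamma> R) z + ?w ?f ?s"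
    unfolding closed_loop_def using tr far[OF re(1,2)]
    by (simp add: winding_number_join path_truncated_loop)
  have 3: "winding_number (three_sides c R) z + ?w ?d ?a = 1"
  proof -
    have nz: "z \<notin> closed_segment ?a (Complex c (- R))" "z \<notin> closed_segment (Complex c (- R)) (Complex c R)"
      "z \<notin> closed_segment (Complex c R) ?d" using ts unfolding path_image_three_sides by auto
    have "winding_number (rectpath ?a (Complex c R)) z = 1"
      using z R rad_pos by (intro winding_number_rectpath) (auto simp: in_box_complex_iff)
    moreover have "winding_number (rectpath ?a (Complex c R)) z =
        winding_number (three_sides c R) z + ?w ?d ?a"
      unfolding rectpath_def three_sides_def Let_def using nz far[OF re(4,3)]
      by (simp add: winding_number_join path_image_join)
    ultimately show ?thesis by simp
  qed
  have 4: "?w ?f ?d + (?w ?d ?a + (?w ?a ?s + ?w ?s ?f)) = 0"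
  proof -
    have "winding_number (linepath ?f ?d +++ linepath ?d ?a +++ linepath ?a ?s +++ linepath ?s ?f) z = 0"
    proof (rule winding_number_zero_outside[OF _ convex_halfspace_Re_le])
      show "path_image (linepath ?f ?d +++ linepath ?d ?a +++ linepath ?a ?s +++ linepath ?s ?f)
          \<subseteq> {w. Re w \<le> rad - R}"
        by (intro subset_path_image_join; unfold path_image_linepath; rule seg; rule re)
    qed (use z in \<open>auto simp: convex_halfspace_Re_le\<close>)
    thus ?thesis using far[OF re(1,4)] far[OF re(4,3)] far[OF re(3,2)] far[OF re(2,1)]
      by (simp add: winding_number_join path_image_join)
  qed
  have 5: "?w ?s ?f = - ?w ?f ?s"
    using winding_number_reversepath[of "linepath ?f ?s" z] far[OF re(1,2)] by simp
  have 6: "winding_number (three_sides c R) z = 1 - ?w ?d ?a" using 3 by (simp add: eq_diff_eq)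
  have 7: "?w ?f ?s = ?w ?f ?d + (?w ?d ?a + ?w ?a ?s)"
    using 4 unfolding 5 by (simp add: add.assoc[symmetric] add_eq_0_iff2)
  show "winding_number (outer_loop \<gamma> c R) z = winding_number (closed_loop \<gamma> R) z - 1"
    unfolding 1 2 6 7 by simp
qed

end

section \<open>Convergence along horizontal rays and far to the left\<close>

lemma contour_integral_ray:
  fixes g :: "complex \<Rightarrow> complex"
  assumes R: "R > 0" and cont: "continuous_on {z - of_real u |u. 0 \<le> u} g"
  shows "contour_integral (linepath (z - of_real R) z) g = integral {0..R} (\<lambda>u. g (z - of_real u))"
proof -
  define f where "f = (\<lambda>u. g (z - of_real u))"
  have "continuous_on {0..R} f"
    unfolding f_def by (rule continuous_on_compose2[OF cont]) (auto intro!: continuous_intros)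
  hence "(f has_integral integral {0..R} f) (cbox 0 R)"
    using integrable_continuous_interval by (auto simp: has_integral_integral)
  from has_integral_affinity[OF this, of "- R" R]
  have "((\<lambda>x. f (- R * x + R)) has_integral (integral {0..R} f /\<^sub>R R)) ((\<lambda>x. (- 1 / R) * x + 1) ` {0..R})"
    using R by (simp add: divide_inverse)
  also have "(\<lambda>x. (- 1 / R) * x + 1) ` {0..R} = {0..1}"
    using R by (subst image_affinity_atLeastAtMost) auto
  finally have "((\<lambda>x. f (- R * x + R) * of_real R) has_integral (integral {0..R} f /\<^sub>R R) * of_real R) {0..1}"
    by (rule has_integral_mult_left)
  hence "((\<lambda>x. f (- R * x + R) * of_real R) has_integral integral {0..R} f) {0..1}"
  proof -
    have "(integral {0..R} f /\<^sub>R R) * of_real R = integral {0..R} f"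
      using R by (simp add: scaleR_conv_of_real)
    thus ?thesis using \<open>(_ has_integral (integral {0..R} f /\<^sub>R R) * of_real R) _\<close> by simp
  qed
  moreover have "f (- R * x + R) = g (linepath (z - of_real R) z x)" for x
    unfolding f_def linepath_def by (rule arg_cong[of _ _ g]) (simp add: scaleR_conv_of_real algebra_simps)
  ultimately have "(g has_contour_integral integral {0..R} f) (linepath (z - of_real R) z)"
    by (simp add: has_contour_integral_linepath)
  thus ?thesis unfolding f_def by (rule contour_integral_unique)
qed

lemma ray_integral_convergent:
  fixes g :: "complex \<Rightarrow> complex"
  assumes cont: "continuous_on {z - of_real u |u. 0 \<le> u} g"
    and \<kappa>: "\<kappa> > 0" and bound: "\<And>u. u0 \<le> u \<Longrightarrow> 0 \<le> u \<Longrightarrow> norm (g (z - of_real u)) \<le> C * exp (- \<kappa> * u)"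
  shows "\<exists>L. ((\<lambda>R. contour_integral (linepath (z - of_real R) z) g) \<longlongrightarrow> L) at_top"
proof -
  define f where "f = (\<lambda>u. g (z - of_real u))"
  have cf: "continuous_on {0..} f"
    unfolding f_def by (rule continuous_on_compose2[OF cont]) (auto intro!: continuous_intros)
  define v where "v = max 0 u0"
  have "bounded (f ` {0..v})"
    by (intro compact_imp_bounded compact_continuous_image continuous_on_subset[OF cf]) auto
  then obtain B where B: "\<And>u. u \<in> {0..v} \<Longrightarrow> norm (f u) \<le> B" unfolding bounded_iff by blast
  define C' where "C' = \<bar>C\<bar> + \<bar>B\<bar> * exp (\<kappa> * v)"
  have bd: "norm (f u) \<le> C' * exp (- \<kappa> * u)" if "0 \<le> u" for u
  proof (cases "u \<le> v")
    case True
    have "1 \<le> exp (\<kappa> * v) * exp (- \<kappa> * u)"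
      using True \<kappa> by (simp add: mult_left_mono flip: exp_add)
    hence "\<bar>B\<bar> * 1 \<le> \<bar>B\<bar> * (exp (\<kappa> * v) * exp (- \<kappa> * u))" by (intro mult_left_mono) auto
    hence "\<bar>B\<bar> \<le> \<bar>B\<bar> * exp (\<kappa> * v) * exp (- \<kappa> * u)" by simp
    moreover have "norm (f u) \<le> \<bar>B\<bar>" using B[of u] True that by auto
    moreover have "0 \<le> \<bar>C\<bar> * exp (- \<kappa> * u)" by simp
    ultimately show ?thesis unfolding C'_def distrib_right by linarith
  next
    case False
    hence "norm (f u) \<le> C * exp (- \<kappa> * u)" unfolding f_def using that by (intro bound) (auto simp: v_def)
    also have "\<dots> \<le> C' * exp (- \<kappa> * u)" 
    proof (intro mult_right_mono)
      have "0 \<le> \<bar>B\<bar> * exp (\<kappa> * v)" by simp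
      thus "C \<le> C'" unfolding C'_def using abs_ge_self[of C] by linarith
    qed auto
    finally show ?thesis .
  qed
  have "set_integrable lborel {0..} f"
  proof (rule set_integrable_bound[where f = "\<lambda>u. C' * exp (- \<kappa> * u)"])
    have "(\<lambda>u. exp (- \<kappa> * u)) absolutely_integrable_on {0..}"
      by (rule nonnegative_absolutely_integrable_1[OF integrable_on_exp_minus_to_infinity[OF \<kappa>]]) auto
    hence "set_integrable lborel {0..} (\<lambda>u. exp (- \<kappa> * u))"
      unfolding set_integrable_def
      by (subst (asm) integrable_completion) auto
    thus "set_integrable lborel {0..} (\<lambda>u. C' * exp (- \<kappa> * u))" by simp
    show "set_borel_measurable lborel {0..} f"
      using borel_measurable_continuous_on_indicator[OF _ cf] by (simp add: set_borel_measurable_def)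
    show "AE x in lborel. x \<in> {0..} \<longrightarrow> norm (f x) \<le> norm (C' * exp (- \<kappa> * x))"
    proof (intro AE_I2 impI)
      fix x :: real assume "x \<in> {0..}"
      hence "norm (f x) \<le> C' * exp (- \<kappa> * x)" by (intro bd) auto
      also have "\<dots> \<le> norm (C' * exp (- \<kappa> * x))" by simp
      finally show "norm (f x) \<le> norm (C' * exp (- \<kappa> * x))" .
    qed
  qed
  hence lim: "((\<lambda>R. set_lebesgue_integral lborel {0..R} f) \<longlongrightarrow> set_lebesgue_integral lborel {0..} f) at_top"
    by (intro tendsto_set_lebesgue_integral_at_top) auto
  moreover have "\<forall>\<^sub>F R in at_top. set_lebesgue_integral lborel {0..R} f =
      contour_integral (linepath (z - of_real R) z) g"
    using eventually_gt_at_top[of 0]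
  proof eventually_elim
    case (elim R)
    have "set_integrable lborel {0..R} f"
      by (rule borel_integrable_atLeastAtMost'[OF continuous_on_subset[OF cf]]) auto
    thus ?case unfolding contour_integral_ray[OF elim cont] f_def
      by (rule set_borel_integral_eq_integral(2))
  qed
  ultimately have "((\<lambda>R. contour_integral (linepath (z - of_real R) z) g) \<longlongrightarrow>
      set_lebesgue_integral lborel {0..} f) at_top"
    by (rule Lim_transform_eventually)
  thus ?thesis ..
qed

text \<open>
  Half of the exponential rate absorbs the polynomial.
\<close>

lemma power_exp_bound:
  fixes \<kappa> :: real
  assumes "\<kappa> > 0"
  shows "\<exists>u0\<ge>0. \<forall>u\<ge>u0. (a + b * u) ^ k * exp (- (2 * \<kappa>) * u) \<le> exp (- \<kappa> * u)"
proof -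
  define c where "c = \<bar>a\<bar> + \<bar>b\<bar> + 1"
  have "((\<lambda>u. (\<kappa> * u) ^ k / exp (\<kappa> * u)) \<longlongrightarrow> 0) at_top"
    by (rule filterlim_compose[OF tendsto_power_div_exp_0])
       (use assms in \<open>auto intro: filterlim_tendsto_pos_mult_at_top[OF tendsto_const _ filterlim_ident]\<close>)
  from tendsto_mult[OF tendsto_const[of "(c / \<kappa>) ^ k"] this]
  have "((\<lambda>u. (c / \<kappa>) ^ k * ((\<kappa> * u) ^ k / exp (\<kappa> * u))) \<longlongrightarrow> 0) at_top" by simp
  hence "\<forall>\<^sub>F u in at_top. (c / \<kappa>) ^ k * ((\<kappa> * u) ^ k / exp (\<kappa> * u)) < 1"
    by (rule order_tendstoD) simp
  then obtain u1 where u1: "\<And>u. u \<ge> u1 \<Longrightarrow> (c / \<kappa>) ^ k * ((\<kappa> * u) ^ k / exp (\<kappa> * u)) < 1"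
    by (auto simp: eventually_at_top_linorder)
  have "(a + b * u) ^ k * exp (- (2 * \<kappa>) * u) \<le> exp (- \<kappa> * u)" if u: "max u1 1 \<le> u" for u
  proof -
    have ab: "\<bar>a + b * u\<bar> \<le> (\<bar>a\<bar> + \<bar>b\<bar>) * u"
    proof -
      have "\<bar>a + b * u\<bar> \<le> \<bar>a\<bar> * 1 + \<bar>b\<bar> * u" using u by (simp add: abs_mult order_trans[OF abs_triangle_ineq])
      also have "\<dots> \<le> \<bar>a\<bar> * u + \<bar>b\<bar> * u" using u by (intro add_mono mult_left_mono) auto
      finally show ?thesis by (simp add: distrib_right)
    qed
    have "(a + b * u) ^ k \<le> \<bar>a + b * u\<bar> ^ k" by (simp flip: power_abs)
    also have "\<dots> \<le> (c * u) ^ k"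
      using u by (intro power_mono order_trans[OF ab] mult_right_mono) (auto simp: c_def)
    finally have "(a + b * u) ^ k * exp (- \<kappa> * u) \<le> (c * u) ^ k * exp (- \<kappa> * u)"
      by (intro mult_right_mono) auto
    also have "\<dots> = (c / \<kappa>) ^ k * ((\<kappa> * u) ^ k / exp (\<kappa> * u))"
    proof -
      have "(c / \<kappa>) ^ k * (\<kappa> * u) ^ k = (c * u) ^ k" using assms by (simp flip: power_mult_distrib)
      thus ?thesis by (simp add: exp_minus divide_inverse mult.assoc[symmetric])
    qed
    also have "\<dots> \<le> 1" using u1[of u] u by simp
    finally have "(a + b * u) ^ k * exp (- \<kappa> * u) * exp (- \<kappa> * u) \<le> 1 * exp (- \<kappa> * u)"
      by (intro mult_right_mono) auto
    thus ?thesis by (simp add: mult.assoc flip: exp_add)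
  qed
  thus ?thesis by (intro exI[of _ "max u1 1"]) auto
qed

lemma norm_of_real_powr_minus:
  assumes "0 < t"
  shows "norm (of_real t powr (- s)) = exp (Re s * ln (1 / t))"
  using assms by (simp add: norm_powr_real_powr powr_def ln_div)

lemma far_left_integral_tendsto_0:
  fixes E :: "complex \<Rightarrow> complex" and R :: "'i \<Rightarrow> real" and u v :: "'i \<Rightarrow> complex"
  assumes t: "0 < t" "t < 1"
    and pb: "poly_bounded_on S E"
    and R: "filterlim R at_top F"
    and seg: "\<forall>\<^sub>F i in F. closed_segment (u i) (v i) \<subseteq> {s \<in> S. Re s \<le> M - R i \<and> norm s \<le> 3 * R i}"
    and int: "\<forall>\<^sub>F i in F. (\<lambda>s. E s * of_real t powr (- s)) contour_integrable_on linepath (u i) (v i)"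
  shows "((\<lambda>i. contour_integral (linepath (u i) (v i)) (\<lambda>s. E s * of_real t powr (- s))) \<longlongrightarrow> 0) F"
proof -
  obtain k :: nat and C r where E: "C > 0" "r \<ge> 1" "\<And>s. s \<in> S \<Longrightarrow> r \<le> norm s \<Longrightarrow> norm (E s) \<le> C * norm s ^ k"
    using poly_bounded_onE[OF pb] by metis
  define L where "L = ln (1 / t)"
  have L: "L > 0" using t by (simp add: L_def)
  have lim: "((\<lambda>i. C * exp (M * L) * (6 * 3 ^ k / L ^ (k + 1)) * ((L * R i) ^ (k + 1) / exp (L * R i))) \<longlongrightarrow>
      C * exp (M * L) * (6 * 3 ^ k / L ^ (k + 1)) * 0) F"
    by (intro tendsto_mult tendsto_const filterlim_compose[OF tendsto_power_div_exp_0]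
          filterlim_tendsto_pos_mult_at_top[OF tendsto_const L R])
  show ?thesis
  proof (rule Lim_null_comparison)
    show "((\<lambda>i. C * exp (M * L) * (6 * 3 ^ k / L ^ (k + 1)) * ((L * R i) ^ (k + 1) / exp (L * R i))) \<longlongrightarrow> 0) F"
      using lim by simp
    have "\<forall>\<^sub>F i in F. R i \<ge> \<bar>M\<bar> + r"
      using R by (auto simp: filterlim_at_top)
    thus "\<forall>\<^sub>F i in F. norm (contour_integral (linepath (u i) (v i)) (\<lambda>s. E s * of_real t powr (- s))) \<le>
        C * exp (M * L) * (6 * 3 ^ k / L ^ (k + 1)) * ((L * R i) ^ (k + 1) / exp (L * R i))"
      using seg int
    proof eventually_elim
      case (elim i)
      have R0: "R i > 0" using elim E by linarith
      have "norm (contour_integral (linepath (u i) (v i)) (\<lambda>s. E s * of_real t powr (- s))) \<le>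
          (C * (3 * R i) ^ k * exp ((M - R i) * L)) * norm (v i - u i)"
      proof (rule contour_integral_bound_linepath[OF elim(3)])
        fix s assume s: "s \<in> closed_segment (u i) (v i)"
        hence s': "s \<in> S" "Re s \<le> M - R i" "norm s \<le> 3 * R i" using elim by auto
        have "r \<le> norm s" using s'(2) elim(1) abs_Re_le_cmod[of s] by linarith
        hence "norm (E s) \<le> C * norm s ^ k" using E s' by blast
        also have "\<dots> \<le> C * (3 * R i) ^ k" using s' E by (intro mult_left_mono power_mono) auto
        finally have "norm (E s) \<le> C * (3 * R i) ^ k" .
        moreover have "norm (of_real t powr (- s)) \<le> exp ((M - R i) * L)"
          unfolding norm_of_real_powr_minus[OF t(1)] using s' L by (simp add: L_def)
        ultimately show "norm (E s * of_real t powr (- s)) \<le> C * (3 * R i) ^ k * exp ((M - R i) * L)"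
          unfolding norm_mult using E R0 by (intro mult_mono) auto
      qed (use E R0 in auto)
      also have "\<dots> \<le> (C * (3 * R i) ^ k * exp ((M - R i) * L)) * (6 * R i)"
      proof (intro mult_left_mono)
        have "norm (u i) \<le> 3 * R i" "norm (v i) \<le> 3 * R i" using elim by auto
        thus "norm (v i - u i) \<le> 6 * R i" using norm_triangle_ineq4[of "v i" "u i"] by linarith
      qed (use E R0 in auto)
      also have "\<dots> = C * exp (M * L) * (6 * 3 ^ k / L ^ (k + 1)) * ((L * R i) ^ (k + 1) / exp (L * R i))"
      proof -
        have "exp ((M - R i) * L) = exp (M * L) / exp (L * R i)"
          by (simp add: algebra_simps flip: exp_diff)
        thus ?thesis using L by (simp add: power_mult_distrib mult_ac)
      qed
      finally show ?case .
    qed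
  qed
qed

context separating_loop
begin

text \<open>
  The hypotheses on the loop speak of one pole at a time. They are needed for the finitely many poles
  on the left that are not to the left of all of \<open>\<gamma>\<close>, and for those on the right. Any other pole in \<open>P\<close> can
  escape to infinity along the strip, through the opening of the outer loop, for every large \<open>R\<close>.
\<close>

lemma eventually_outer_loop:
  assumes c: "0 < c" "\<And>z. z \<in> P \<Longrightarrow> Re z < c"
  shows "\<forall>\<^sub>F R in at_top. (\<forall>z\<in>P. z \<notin> path_image (outer_loop \<gamma> c R) \<and> winding_number (outer_loop \<gamma> c R) z = 0) \<and>
     (\<forall>q\<in>Q. q \<notin> path_image (outer_loop \<gamma> c R) \<and> winding_number (outer_loop \<gamma> c R) q = - 1)"
proof -
  define Z where "Z = {z \<in> P. - rad \<le> Re z}"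
  have Zev: "\<forall>\<^sub>F R in at_top. \<forall>z\<in>Z. z \<notin> path_image (closed_loop \<gamma> R) \<and> winding_number (closed_loop \<gamma> R) z = 1"
    using finite_P[of "- rad"] left unfolding Z_def[symmetric]
    by (subst eventually_ball_finite_distrib) (auto simp: Z_def on_left_of_loop_def)
  have Qev: "\<forall>\<^sub>F R in at_top. \<forall>q\<in>Q. q \<notin> path_image (closed_loop \<gamma> R) \<and> winding_number (closed_loop \<gamma> R) q = 0"
    using right by (subst eventually_ball_finite_distrib) (auto simp: on_right_of_loop_def)
  show ?thesis
    using Zev Qev eventually_gt_at_top[of "2 * rad + real n"]
  proof eventually_elim
    case (elim R)
    have R: "rad \<le> R" "- R < c" "0 < R" using elim(3) rad_pos c by linarith+
    have "q \<notin> path_image (outer_loop \<gamma> c R) \<and> winding_number (outer_loop \<gamma> c R) q = - 1" if q: "q \<in> Q" for q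
    proof -
      obtain k where k: "k < n" "q = - of_nat k" using q by auto
      have "rad - R < Re q" "\<bar>Im q\<bar> < R" "Re q < c" using k elim(3) R c rad_pos by simp_all
      from winding_number_outer_loop[OF R(1,2) this] elim(2) q show ?thesis by auto
    qed
    moreover have "z \<notin> path_image (outer_loop \<gamma> c R) \<and> winding_number (outer_loop \<gamma> c R) z = 0" if z: "z \<in> P" for z
    proof (cases "- rad \<le> Re z")
      case True
      have "\<bar>Im z\<bar> < R" using strip[OF z] ends_rad R by linarith
      with True winding_number_outer_loop[OF R(1,2), of z] elim(1,3) z c(2)[OF z] show ?thesis
        by (auto simp: Z_def)
    next
      case False
      define T where "T = (\<lambda>v. z - of_real v) ` {0..}"
      have "connected T" unfolding T_def
        by (intro connected_continuous_image continuous_intros convex_connected) auto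
      moreover have dis: "T \<inter> path_image (outer_loop \<gamma> c R) = {}"
      proof (rule ccontr)
        assume "T \<inter> path_image (outer_loop \<gamma> c R) \<noteq> {}"
        obtain w where w: "Im w = Im z" "Re w \<le> Re z" "w \<in> path_image (outer_loop \<gamma> c R)"
        proof -
          obtain v where "0 \<le> v" "z - of_real v \<in> path_image (outer_loop \<gamma> c R)"
            using \<open>T \<inter> _ \<noteq> {}\<close> by (auto simp: T_def)
          thus ?thesis using that[of "z - of_real v"] by simp
        qed
        have im: "Im (pathstart \<gamma>) < Im w" "Im w < Im (pathfinish \<gamma>)" using strip[OF z] w by simp_all
        have "w \<notin> path_image \<gamma>" using norm_less_rad[of w] w False abs_Re_le_cmod[of w] by auto
        hence "w \<notin> path_image (truncated_loop \<gamma> R)"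
          using im R by (auto simp: path_image_truncated_loop horizontal_segment_iff)
        moreover have "w \<notin> path_image (three_sides c R)"
          using three_sides_cases[of w c R] R im w ends_rad c(2)[OF z] by auto
        ultimately show False using w(3) im far_segments[OF R(1)] by (auto simp: path_image_outer_loop)
      qed
      moreover have zT: "z \<in> T" unfolding T_def by (rule image_eqI[of _ _ 0]) auto
      moreover have "\<exists>u\<in>T. B \<le> norm u" for B
      proof -
        define v where "v = \<bar>B\<bar> + norm z"
        have "B \<le> norm (z - of_real v)"
          using norm_triangle_ineq2[of "of_real v" z] by (simp add: v_def norm_minus_commute del: of_real_add)
        moreover have "z - of_real v \<in> T" unfolding T_def by (rule imageI) (simp add: v_def)
        ultimately show ?thesis by blast
      qed
      ultimately have "winding_number (outer_loop \<gamma> c R) z = 0"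
        using winding_number_zero_on_unbounded[OF path_outer_loop] by simp
      thus ?thesis using dis zT by auto
    qed
    ultimately show ?case by blast
  qed
qed

end

section \<open>Residues at the poles on the right\<close>

text \<open>
  The residue of \<open>1 / (s)\<^sub>n\<close> at \<open>- k\<close>, for \<open>k < n\<close>.
\<close>

definition pole_residue :: "nat \<Rightarrow> nat \<Rightarrow> complex" where
  "pole_residue n k = (- 1) ^ k / (fact k * fact (n - 1 - k))"

lemma pochhammer_split_at:
  assumes "k < n"
  shows "pochhammer s n = (s + of_nat k) * (\<Prod>i\<in>{..<n} - {k}. s + of_nat i)"
  using assms by (simp add: pochhammer_prod lessThan_atLeast0 prod.remove[of _ k])

lemma prod_differences:
  assumes "k < n"
  shows "(\<Prod>i\<in>{..<n} - {k}. (of_nat i - of_nat k :: complex)) = (- 1) ^ k * fact k * fact (n - 1 - k)"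
proof -
  have eq: "{..<n} - {k} = {..<k} \<union> {k<..<n}" using assms by auto
  have "(\<Prod>i\<in>{..<n} - {k}. (of_nat i - of_nat k :: complex)) =
      (\<Prod>i<k. of_nat i - of_nat k) * (\<Prod>i\<in>{k<..<n}. of_nat i - of_nat k)"
    unfolding eq by (rule prod.union_disjoint) auto
  also have "(\<Prod>i<k. (of_nat i - of_nat k :: complex)) = (\<Prod>i<k. - of_nat (Suc i))"
    by (rule prod.reindex_bij_witness[of _ "\<lambda>i. k - Suc i" "\<lambda>i. k - Suc i"])
       (auto simp: of_nat_diff Suc_diff_Suc)
  also have "\<dots> = (- 1) ^ k * fact k"
    unfolding prod_uminus by (simp add: fact_prod_Suc lessThan_atLeast0)
  also have "(\<Prod>i\<in>{k<..<n}. (of_nat i - of_nat k :: complex)) = (\<Prod>i<n - 1 - k. of_nat (Suc i))"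
    by (rule prod.reindex_bij_witness[of _ "\<lambda>i. i + Suc k" "\<lambda>i. i - Suc k"])
       (auto simp: of_nat_diff)
  also have "\<dots> = fact (n - 1 - k)"
    by (simp add: fact_prod_Suc lessThan_atLeast0)
  finally show ?thesis .
qed

lemma residue_over_pochhammer:
  assumes "open S" "- of_nat k \<in> S" "h holomorphic_on S" "k < n"
  shows "residue (\<lambda>s. h s / pochhammer s n) (- of_nat k) = pole_residue n k * h (- of_nat k)"
proof -
  define U where "U = S - (\<lambda>i. - of_nat i :: complex) ` ({..<n} - {k})"
  define f where "f = (\<lambda>s. h s / (\<Prod>i\<in>{..<n} - {k}. s + of_nat i))"
  have U: "open U" "- of_nat k \<in> U"
    using assms by (auto simp: U_def intro!: open_Diff finite_imp_closed)
  have "f holomorphic_on U"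
    unfolding f_def
  proof (intro holomorphic_intros)
    show "h holomorphic_on U" by (rule holomorphic_on_subset[OF assms(3)]) (auto simp: U_def)
    show "(\<Prod>i\<in>{..<n} - {k}. s + of_nat i) \<noteq> 0" if "s \<in> U" for s
      using that by (auto simp: U_def add_eq_0_iff2)
  qed
  hence "residue (\<lambda>w. f w / (w - - of_nat k)) (- of_nat k) = f (- of_nat k)"
    by (rule residue_simple[OF U])
  also have "(\<lambda>w. f w / (w - - of_nat k)) = (\<lambda>s. h s / pochhammer s n)"
    unfolding f_def pochhammer_split_at[OF assms(4)] by (simp add: mult.commute add.commute)
  also have "f (- of_nat k) = pole_residue n k * h (- of_nat k)"
    using prod_differences[OF assms(4)] unfolding f_def pole_residue_def
    by (simp add: power_minus1_odd divide_inverse mult_ac flip: power_inverse)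
  finally show ?thesis .
qed

lemma residue_loop_integrand:
  assumes "open S" "- of_nat k \<in> S" "\<Phi> holomorphic_on S" "k < n" "0 < t"
  shows "residue (\<lambda>s. \<Phi> s / pochhammer s n * of_real t powr (- s)) (- of_nat k) =
     pole_residue n k * \<Phi> (- of_nat k) * of_real t ^ k"
proof -
  have "residue (\<lambda>s. (\<Phi> s * of_real t powr (- s)) / pochhammer s n) (- of_nat k) =
      pole_residue n k * (\<Phi> (- of_nat k) * of_real t powr (- (- of_nat k)))"
    using assms by (intro residue_over_pochhammer[of S] holomorphic_intros) auto
  also have "(of_real t :: complex) powr (- (- of_nat k)) = of_real t ^ k"
    using assms by (simp add: powr_nat)
  finally show ?thesis by (simp add: mult_ac)
qed

context separating_loop
begin

definition outside_strip :: "complex set" where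
  "outside_strip = {s. Re s \<le> 0 \<and> (Im s \<le> Im (pathstart \<gamma>) \<or> Im (pathfinish \<gamma>) \<le> Im s)}"

abbreviation loop_mellin :: "(complex \<Rightarrow> complex) \<Rightarrow> real \<Rightarrow> complex" where
  "loop_mellin E t \<equiv> loop_integral \<gamma> (\<lambda>s. E s * of_real t powr (- s))"

lemma P_Q_disjoint: "P \<inter> Q = {}"
proof (rule ccontr)
  assume "P \<inter> Q \<noteq> {}"
  then obtain k where "k < n" "- of_nat k \<in> P" by auto
  from eventually_happens[OF eventually_conj[OF left[OF this(2), unfolded on_left_of_loop_def]
      right[OF this(1), unfolded on_right_of_loop_def]]]
  show False by auto
qed

lemma truncated_loop_avoids: "0 \<le> R \<Longrightarrow> path_image (truncated_loop \<gamma> R) \<inter> (P \<union> Q) = {}"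
  using on_side_of_loop_avoids left right by blast

lemma ray_avoids:
  assumes "z \<in> {pathstart \<gamma>, pathfinish \<gamma>}"
  shows "{z - of_real u |u. 0 \<le> u} \<inter> (P \<union> Q) = {}"
proof (rule ccontr)
  assume "\<not> ?thesis"
  then obtain u where u: "0 \<le> u" "z - of_real u \<in> P \<union> Q" by auto
  have "z - of_real u \<in> closed_segment (z - of_real u) z" by simp
  hence "z - of_real u \<in> path_image (truncated_loop \<gamma> u)"
    using assms by (auto simp: path_image_truncated_loop)
  thus False using truncated_loop_avoids[OF u(1)] u(2) by blast
qed

lemma right_bound_exists: "\<exists>c>0. \<forall>z\<in>P. Re z < c"
proof -
  have fin: "finite (Re ` {z \<in> P. 0 \<le> Re z})" using finite_P[of 0] by blast
  obtain m where m: "\<And>x. x \<in> Re ` {z \<in> P. 0 \<le> Re z} \<Longrightarrow> x \<le> m"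
    using finite_imp_bounded[OF fin] unfolding bounded_iff by (metis real_norm_def abs_le_D1)
  have "Re z < max 1 (m + 1)" if "z \<in> P" for z
    using m[of "Re z"] that by (cases "0 \<le> Re z") force+
  thus ?thesis by (intro exI[of _ "max 1 (m + 1)"]) auto
qed

lemma open_regular: "open (- P - Q)"
  using closed_P by (intro open_Diff finite_imp_closed) auto

lemma loop_integrand_holomorphic:
  assumes "\<Phi> holomorphic_on - P"
  shows "(\<lambda>s. \<Phi> s / pochhammer s n * of_real t powr (- s)) holomorphic_on - P - Q"
  by (intro holomorphic_intros holomorphic_on_subset[OF assms])
     (auto simp: pochhammer_eq_0_iff)

end

section \<open>Moving the loop to a vertical line\<close>

context separating_loop
begin

lemma truncated_integral_split:
  assumes g: "g holomorphic_on - P - Q" and R: "0 \<le> R"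
  shows "contour_integral (truncated_loop \<gamma> R) g =
     contour_integral (linepath (pathstart \<gamma> - of_real R) (pathstart \<gamma>)) g + contour_integral \<gamma> g -
     contour_integral (linepath (pathfinish \<gamma> - of_real R) (pathfinish \<gamma>)) g"
    and "g contour_integrable_on truncated_loop \<gamma> R"
proof -
  have sub: "path_image (truncated_loop \<gamma> R) \<subseteq> - P - Q" using truncated_loop_avoids[OF R] by blast
  have 1: "g contour_integrable_on \<gamma>"
    using sub valid_loop by (intro contour_integrable_holomorphic_simple[OF g open_regular])
      (auto simp: path_image_truncated_loop)
  have 2: "g contour_integrable_on linepath (z - of_real R) z" if "z \<in> {pathstart \<gamma>, pathfinish \<gamma>}" for z
    using sub that by (intro contour_integrable_holomorphic_simple[OF g open_regular])
      (auto simp: path_image_truncated_loop)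
  have c: "continuous_on (closed_segment (pathfinish \<gamma>) (pathfinish \<gamma> - of_real R)) g"
    using sub by (intro holomorphic_on_imp_continuous_on holomorphic_on_subset[OF g])
      (auto simp: path_image_truncated_loop closed_segment_commute)
  have 3: "g contour_integrable_on linepath (pathfinish \<gamma>) (pathfinish \<gamma> - of_real R)"
    using c by (rule contour_integrable_continuous_linepath)
  show "contour_integral (truncated_loop \<gamma> R) g =
     contour_integral (linepath (pathstart \<gamma> - of_real R) (pathstart \<gamma>)) g + contour_integral \<gamma> g -
     contour_integral (linepath (pathfinish \<gamma> - of_real R) (pathfinish \<gamma>)) g"
    unfolding truncated_loop_def using 1 2 3 valid_loop contour_integral_reverse_linepath[OF c] by simp
  show "g contour_integrable_on truncated_loop \<gamma> R"
    unfolding truncated_loop_def using 1 2 3 valid_loop by simp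
qed

text \<open>
  Both rays of the loop run outside the strip, so the integrand decays exponentially on them.
\<close>

lemma loop_integral_tendsto:
  assumes hol: "E holomorphic_on - P - Q" and pb: "poly_bounded_on outside_strip E"
    and t: "0 < t" "t < 1"
  shows "((\<lambda>R. contour_integral (truncated_loop \<gamma> R) (\<lambda>s. E s * of_real t powr (- s))) \<longlongrightarrow>
           loop_mellin E t) at_top"
proof -
  define g where "g = (\<lambda>s. E s * of_real t powr (- s))"
  define L where "L = ln (1 / t)"
  have L: "L > 0" using t by (simp add: L_def)
  have g: "g holomorphic_on - P - Q" unfolding g_def by (intro holomorphic_intros hol)
  obtain k :: nat and C r where E: "C > 0" "r \<ge> 1"
    "\<And>s. s \<in> outside_strip \<Longrightarrow> r \<le> norm s \<Longrightarrow> norm (E s) \<le> C * norm s ^ k"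
    using poly_bounded_onE[OF pb] by metis
  obtain u1 where u1: "\<And>u. u1 \<le> u \<Longrightarrow> (rad + 1 * u) ^ k * exp (- (2 * (L / 2)) * u) \<le> exp (- (L / 2) * u)"
    using power_exp_bound[of "L / 2" rad 1 k] L by auto
  have conv: "\<exists>l. ((\<lambda>R. contour_integral (linepath (z - of_real R) z) g) \<longlongrightarrow> l) at_top"
    if z: "z \<in> {pathstart \<gamma>, pathfinish \<gamma>}" for z
  proof (rule ray_integral_convergent)
    show "continuous_on {z - of_real u |u. 0 \<le> u} g"
      using ray_avoids[OF z] by (intro holomorphic_on_imp_continuous_on holomorphic_on_subset[OF g]) blast
    show "L / 2 > 0" using L by simp
    fix u assume u: "max u1 (r + rad) \<le> u" "0 \<le> u"
    let ?s = "z - of_real u"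
    have zr: "norm z < rad" "\<bar>Re z\<bar> < rad" using z ends_rad by auto
    have "?s \<in> outside_strip" using z zr u E by (auto simp: outside_strip_def)
    moreover have "r \<le> norm ?s" using abs_Re_le_cmod[of ?s] zr u E by (simp; linarith)
    ultimately have "norm (E ?s) \<le> C * norm ?s ^ k" using E by blast
    also have "\<dots> \<le> C * (rad + 1 * u) ^ k"
      using E norm_triangle_ineq4[of z "of_real u"] zr u by (intro mult_left_mono power_mono) auto
    finally have "norm (E ?s) \<le> C * (rad + 1 * u) ^ k" .
    hence "norm (g ?s) \<le> C * (rad + 1 * u) ^ k * exp ((Re z - u) * L)"
      unfolding g_def norm_mult norm_of_real_powr_minus[OF t(1)] L_def
      by (intro mult_mono) (auto intro: order_trans[OF norm_ge_zero])
    also have "\<dots> = (C * exp (Re z * L)) * ((rad + 1 * u) ^ k * exp (- (2 * (L / 2)) * u))"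
    proof -
      have "exp ((Re z - u) * L) = exp (Re z * L) * exp (- (2 * (L / 2)) * u)"
        by (simp add: algebra_simps flip: exp_add)
      thus ?thesis by (simp only: mult_ac)
    qed
    also have "\<dots> \<le> (C * exp (Re z * L)) * exp (- (L / 2) * u)"
      using u u1[of u] E by (intro mult_left_mono) auto
    finally show "norm (g ?s) \<le> (C * exp (Re z * L)) * exp (- (L / 2) * u)" .
  qed
  obtain l1 l2 where l: "((\<lambda>R. contour_integral (linepath (pathstart \<gamma> - of_real R) (pathstart \<gamma>)) g) \<longlongrightarrow> l1) at_top"
    "((\<lambda>R. contour_integral (linepath (pathfinish \<gamma> - of_real R) (pathfinish \<gamma>)) g) \<longlongrightarrow> l2) at_top"
    using conv by (metis insertCI)
  have "((\<lambda>R. contour_integral (linepath (pathstart \<gamma> - of_real R) (pathstart \<gamma>)) g + contour_integral \<gamma> g -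
     contour_integral (linepath (pathfinish \<gamma> - of_real R) (pathfinish \<gamma>)) g) \<longlongrightarrow> l1 + contour_integral \<gamma> g - l2) at_top"
    by (intro tendsto_intros l)
  moreover have "\<forall>\<^sub>F R in at_top. contour_integral (linepath (pathstart \<gamma> - of_real R) (pathstart \<gamma>)) g + contour_integral \<gamma> g -
     contour_integral (linepath (pathfinish \<gamma> - of_real R) (pathfinish \<gamma>)) g = contour_integral (truncated_loop \<gamma> R) g"
    using eventually_ge_at_top[of 0] by eventually_elim (simp add: truncated_integral_split[OF g])
  ultimately have lim: "((\<lambda>R. contour_integral (truncated_loop \<gamma> R) g) \<longlongrightarrow> l1 + contour_integral \<gamma> g - l2) at_top"
    by (rule Lim_transform_eventually)
  hence "loop_integral \<gamma> g = l1 + contour_integral \<gamma> g - l2"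
    unfolding loop_integral_def by (intro tendsto_Lim) auto
  thus ?thesis using lim unfolding g_def by simp
qed

text \<open>
  The residue theorem for the outer loop. It encircles no pole on the left, and each pole on the right
  once in the negative sense; the two segments that close it are far to the left.
\<close>

lemma deform_to_three_sides:
  assumes \<Phi>: "\<Phi> holomorphic_on - P" and pb: "poly_bounded_on outside_strip (\<lambda>s. \<Phi> s / pochhammer s n)"
    and t: "0 < t" "t < 1" and c: "0 < c" "\<And>z. z \<in> P \<Longrightarrow> Re z < c"
  shows "((\<lambda>R. contour_integral (truncated_loop \<gamma> R) (\<lambda>s. \<Phi> s / pochhammer s n * of_real t powr (- s)) -
             contour_integral (three_sides c R) (\<lambda>s. \<Phi> s / pochhammer s n * of_real t powr (- s))) \<longlongrightarrow>
          - (2 * of_real pi * \<i>) * (\<Sum>k<n. pole_residue n k * \<Phi> (- of_nat k) * of_real t ^ k)) at_top"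
proof -
  define g where "g = (\<lambda>s. \<Phi> s / pochhammer s n * of_real t powr (- s))"
  have g: "g holomorphic_on - P - Q" unfolding g_def by (rule loop_integrand_holomorphic[OF \<Phi>])
  define \<rho> where "\<rho> = - (2 * of_real pi * \<i>) * (\<Sum>k<n. pole_residue n k * \<Phi> (- of_nat k) * of_real t ^ k)"
  let ?U = "\<lambda>R. linepath (pathfinish \<gamma> - of_real R) (Complex (- R) R)"
  let ?D = "\<lambda>R. linepath (Complex (- R) (- R)) (pathstart \<gamma> - of_real R)"
  have res: "residue g (- of_nat k) = pole_residue n k * \<Phi> (- of_nat k) * of_real t ^ k" if "k < n" for k
    unfolding g_def using that P_Q_disjoint closed_P t
    by (intro residue_loop_integrand[of "- P"] \<Phi>) auto
  have ev: "\<forall>\<^sub>F R in at_top.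
     (\<forall>z\<in>P. z \<notin> path_image (outer_loop \<gamma> c R) \<and> winding_number (outer_loop \<gamma> c R) z = 0) \<and>
     (\<forall>q\<in>Q. q \<notin> path_image (outer_loop \<gamma> c R) \<and> winding_number (outer_loop \<gamma> c R) q = - 1)"
    using c by (rule eventually_outer_loop)
  have avoid: "\<forall>\<^sub>F R in at_top. path_image (outer_loop \<gamma> c R) \<subseteq> - P - Q"
    using ev by eventually_elim blast
  have int: "\<forall>\<^sub>F R in at_top. g contour_integrable_on ?U R \<and> g contour_integrable_on ?D R \<and>
      g contour_integrable_on three_sides c R"
    using avoid
  proof eventually_elim
    case (elim R)
    thus ?case unfolding path_image_outer_loop
      by (intro conjI contour_integrable_holomorphic_simple[OF g open_regular]) auto
  qed
  have conn: "connected (- P)"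
    using connected_open_diff_countable[of UNIV P] countable_P by (simp add: Compl_eq_Diff_UNIV connected_UNIV)
  have outer: "\<forall>\<^sub>F R in at_top. contour_integral (outer_loop \<gamma> c R) g = \<rho>"
    using ev avoid
  proof eventually_elim
    case (elim R)
    have "contour_integral (outer_loop \<gamma> c R) g =
        2 * pi * \<i> * (\<Sum>q\<in>Q. winding_number (outer_loop \<gamma> c R) q * residue g q)"
      by (rule Residue_theorem[of "- P"])
         (use elim g valid_outer_loop conn closed_P in auto)
    also have "(\<Sum>q\<in>Q. winding_number (outer_loop \<gamma> c R) q * residue g q) = (\<Sum>q\<in>Q. - residue g q)"
      using elim by (intro sum.cong) auto
    also have "\<dots> = (\<Sum>k<n. - residue g (- of_nat k))"
      by (subst sum.reindex) (auto simp: inj_on_def)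
    also have "\<dots> = - (\<Sum>k<n. pole_residue n k * \<Phi> (- of_nat k) * of_real t ^ k)"
      by (simp add: res sum_negf)
    finally show ?case by (simp add: \<rho>_def)
  qed
  have split: "\<forall>\<^sub>F R in at_top. \<rho> - contour_integral (?U R) g - contour_integral (?D R) g =
      contour_integral (truncated_loop \<gamma> R) g - contour_integral (three_sides c R) g"
    using outer int eventually_ge_at_top[of 0]
  proof eventually_elim
    case (elim R)
    have "contour_integral (outer_loop \<gamma> c R) g = contour_integral (truncated_loop \<gamma> R) g +
        (contour_integral (?U R) g + (- contour_integral (three_sides c R) g + contour_integral (?D R) g))"
      unfolding outer_loop_def using elim truncated_integral_split(2)[OF g, of R] valid_truncated_loop
      by (simp add: contour_integral_reversepath contour_integrable_reversepath)
    thus ?case using elim by (simp add: algebra_simps)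
  qed
  have far: "\<forall>\<^sub>F R in at_top. closed_segment (pathfinish \<gamma> - of_real R) (Complex (- R) R) \<subseteq>
        {s \<in> outside_strip. Re s \<le> rad - R \<and> norm s \<le> 3 * R} \<and>
      closed_segment (Complex (- R) (- R)) (pathstart \<gamma> - of_real R) \<subseteq>
        {s \<in> outside_strip. Re s \<le> rad - R \<and> norm s \<le> 3 * R}"
    using eventually_ge_at_top[of rad]
    by eventually_elim (use far_segments in \<open>fastforce simp: outside_strip_def\<close>)
  have "((\<lambda>R. contour_integral (?U R) g) \<longlongrightarrow> 0) at_top"
    unfolding g_def
    by (rule far_left_integral_tendsto_0[OF t pb filterlim_ident, where M = rad])
       (use far int in \<open>auto elim: eventually_mono simp: g_def\<close>)
  moreover have "((\<lambda>R. contour_integral (?D R) g) \<longlongrightarrow> 0) at_top"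
    unfolding g_def
    by (rule far_left_integral_tendsto_0[OF t pb filterlim_ident, where M = rad])
       (use far int in \<open>auto elim: eventually_mono simp: g_def\<close>)
  ultimately have "((\<lambda>R. \<rho> - contour_integral (?U R) g - contour_integral (?D R) g) \<longlongrightarrow> \<rho> - 0 - 0) at_top"
    by (intro tendsto_intros)
  from Lim_transform_eventually[OF this split] show ?thesis by (simp add: g_def \<rho>_def)
qed

end

lemma integral_vertical_line_bound:
  fixes c R \<epsilon> :: real
  assumes c: "c > 0" and R: "R \<ge> 0" and \<epsilon>: "\<epsilon> > 0"
  shows "\<exists>I. ((\<lambda>x. (c + \<bar>x\<bar>) powr (- 1 - \<epsilon>)) has_integral I) {- R..R} \<and> I \<le> 2 * c powr (- \<epsilon>) / \<epsilon>"
proof -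
  define F where "F = (\<lambda>x. - ((c + x) powr (- \<epsilon>)) / \<epsilon>)"
  have "((\<lambda>x. (c + x) powr (- 1 - \<epsilon>)) has_integral (F R - F 0)) {0..R}"
  proof (rule fundamental_theorem_of_calculus[OF R])
    fix x assume x: "x \<in> {0..R}"
    have "(F has_real_derivative (c + x) powr (- \<epsilon> - 1)) (at x within {0..R})"
      unfolding F_def using c x \<epsilon> by (auto intro!: derivative_eq_intros simp: field_simps)
    moreover have "- \<epsilon> - 1 = - 1 - \<epsilon>" by simp
    ultimately show "(F has_vector_derivative (c + x) powr (- 1 - \<epsilon>)) (at x within {0..R})"
      by (simp only: has_real_derivative_iff_has_vector_derivative)
  qed
  hence 1: "((\<lambda>x. (c + \<bar>x\<bar>) powr (- 1 - \<epsilon>)) has_integral (F R - F 0)) {0..R}"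
    by (rule has_integral_eq[rotated]) auto
  hence 2: "((\<lambda>x. (c + \<bar>x\<bar>) powr (- 1 - \<epsilon>)) has_integral (F R - F 0)) {- R..0}"
    using has_integral_reflect_real[of "\<lambda>x. (c + \<bar>x\<bar>) powr (- 1 - \<epsilon>)" "F R - F 0" R 0] by simp
  have "((\<lambda>x. (c + \<bar>x\<bar>) powr (- 1 - \<epsilon>)) has_integral (F R - F 0 + (F R - F 0))) {- R..R}"
    by (rule has_integral_combine[OF _ _ 2 1]) (use R in auto)
  moreover have "F R \<le> 0" using \<epsilon> by (simp add: F_def)
  moreover have "F 0 = - (c powr (- \<epsilon>)) / \<epsilon>" by (simp add: F_def)
  ultimately show ?thesis by (intro exI[of _ "F R - F 0 + (F R - F 0)"]) (auto simp: field_simps)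
qed

text \<open>
  On the horizontal sides \<open>|s| \<ge> R\<close> and the length is at most \<open>2R\<close>; on the right side
  \<open>|s| \<ge> (c + |Im s|) / 2\<close>, which makes the integral there \<open>O(c\<^bsup>-\<epsilon>\<^esup>)\<close> uniformly in \<open>R\<close>.
\<close>

lemma three_sides_integral_bound:
  fixes g :: "complex \<Rightarrow> complex"
  assumes B: "0 \<le> B" and \<epsilon>: "\<epsilon> > 0" and c: "0 < c" "r \<le> c" and R: "c \<le> R"
    and cont: "continuous_on (path_image (three_sides c R)) g"
    and bd: "\<And>s. s \<in> sector \<Longrightarrow> r \<le> norm s \<Longrightarrow> Re s \<le> c \<Longrightarrow> norm (g s) \<le> B * norm s powr (- 1 - \<epsilon>)"
  shows "norm (contour_integral (three_sides c R) g) \<le>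
     4 * B * R powr (- \<epsilon>) + B * 2 powr (1 + \<epsilon>) * (2 * c powr (- \<epsilon>) / \<epsilon>)"
proof -
  let ?a = "Complex (- R) (- R)" and ?b = "Complex c (- R)" and ?d = "Complex c R" and ?e = "Complex (- R) R"
  have R0: "R > 0" using c R by simp
  have cs: "continuous_on (closed_segment ?a ?b) g" "continuous_on (closed_segment ?b ?d) g"
    "continuous_on (closed_segment ?d ?e) g"
    using cont by (auto simp: path_image_three_sides intro: continuous_on_subset)
  have hor: "norm (contour_integral (linepath u v) g) \<le> 2 * B * R powr (- \<epsilon>)"
    if uv: "Im u = Im v" "\<bar>Im u\<bar> = R" "- R \<le> Re u" "- R \<le> Re v" "Re u \<le> c" "Re v \<le> c"
      and cuv: "continuous_on (closed_segment u v) g" for u v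
  proof -
    have "norm (contour_integral (linepath u v) g) \<le> B * R powr (- 1 - \<epsilon>) * norm (v - u)"
    proof (rule contour_integral_bound_linepath)
      show "g contour_integrable_on linepath u v" by (rule contour_integrable_continuous_linepath[OF cuv])
      fix s assume "s \<in> closed_segment u v"
      hence s: "\<bar>Im s\<bar> = R" "- R \<le> Re s" "Re s \<le> c"
        using uv by (auto simp: closed_segment_same_Im closed_segment_eq_real_ivl split: if_splits)
      have "R \<le> norm s" using s abs_Im_le_cmod[of s] by simp
      hence "norm (g s) \<le> B * norm s powr (- 1 - \<epsilon>)" using s c R by (intro bd) (auto simp: sector_def)
      also have "\<dots> \<le> B * R powr (- 1 - \<epsilon>)"
        using B R0 \<open>R \<le> norm s\<close> \<epsilon> by (intro mult_left_mono powr_mono2') auto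
      finally show "norm (g s) \<le> B * R powr (- 1 - \<epsilon>)" .
    qed (use B in auto)
    also have "\<dots> \<le> B * R powr (- 1 - \<epsilon>) * (2 * R)"
    proof (intro mult_left_mono)
      have "norm (v - u) \<le> \<bar>Re (v - u)\<bar> + \<bar>Im (v - u)\<bar>" by (rule cmod_le)
      thus "norm (v - u) \<le> 2 * R" using uv c R by simp
    qed (use B in auto)
    also have "\<dots> = 2 * B * (R powr (- 1 - \<epsilon>) * R)" by simp
    also have "R powr (- 1 - \<epsilon>) * R = R powr (- \<epsilon>)"
      using powr_add[of R "- 1 - \<epsilon>" 1] R0 by simp
    finally show ?thesis .
  qed
  have ver: "norm (contour_integral (linepath ?b ?d) g) \<le> B * 2 powr (1 + \<epsilon>) * (2 * c powr (- \<epsilon>) / \<epsilon>)"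
  proof -
    obtain I where I: "((\<lambda>x. (c + \<bar>x\<bar>) powr (- 1 - \<epsilon>)) has_integral I) {- R..R}" "I \<le> 2 * c powr (- \<epsilon>) / \<epsilon>"
      using integral_vertical_line_bound[OF c(1) less_imp_le[OF R0] \<epsilon>] by blast
    have "continuous_on {- R..R} (\<lambda>x. g (Complex c x))"
      by (rule continuous_on_compose2[OF cs(2)])
         (auto intro!: continuous_intros simp: closed_segment_same_Re closed_segment_eq_real_ivl Complex_eq)
    hence int: "(\<lambda>x. g (Complex c x)) integrable_on {- R..R}" by (rule integrable_continuous_interval)
    have "norm (integral {- R..R} (\<lambda>x. g (Complex c x))) \<le>
        integral {- R..R} (\<lambda>x. (B * 2 powr (1 + \<epsilon>)) * (c + \<bar>x\<bar>) powr (- 1 - \<epsilon>))"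
    proof (rule integral_norm_bound_integral[OF int])
      show "(\<lambda>x. (B * 2 powr (1 + \<epsilon>)) * (c + \<bar>x\<bar>) powr (- 1 - \<epsilon>)) integrable_on {- R..R}"
        using has_integral_mult_right[OF I(1)] by blast
      fix x assume "x \<in> {- R..R}"
      have cx: "c \<le> norm (Complex c x)" using abs_Re_le_cmod[of "Complex c x"] c by simp
      have "\<bar>x\<bar> \<le> norm (Complex c x)" using abs_Im_le_cmod[of "Complex c x"] by simp
      with cx have "c + \<bar>x\<bar> \<le> norm (Complex c x) + norm (Complex c x)" by (rule add_mono)
      moreover have "r \<le> norm (Complex c x)" using cx c(2) by (rule order_trans[rotated])
      ultimately have n: "(c + \<bar>x\<bar>) / 2 \<le> norm (Complex c x) \<and> r \<le> norm (Complex c x)"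
        by simp
      have "norm (g (Complex c x)) \<le> B * norm (Complex c x) powr (- 1 - \<epsilon>)"
        using n c by (intro bd) (auto simp: sector_def)
      also have "\<dots> \<le> B * ((c + \<bar>x\<bar>) / 2) powr (- 1 - \<epsilon>)"
        using n c B \<epsilon> by (intro mult_left_mono powr_mono2') auto
      also have "((c + \<bar>x\<bar>) / 2) powr (- 1 - \<epsilon>) = (c + \<bar>x\<bar>) powr (- 1 - \<epsilon>) * 2 powr (1 + \<epsilon>)"
      proof -
        have "- 1 - \<epsilon> = - (1 + \<epsilon>)" by simp
        thus ?thesis using c by (simp only: powr_divide powr_minus) (simp add: divide_inverse)
      qed
      finally show "norm (g (Complex c x)) \<le> (B * 2 powr (1 + \<epsilon>)) * (c + \<bar>x\<bar>) powr (- 1 - \<epsilon>)"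
        by (simp add: mult_ac)
    qed
    also have "\<dots> = B * 2 powr (1 + \<epsilon>) * I"
      using has_integral_mult_right[OF I(1)] by (rule integral_unique)
    also have "\<dots> \<le> B * 2 powr (1 + \<epsilon>) * (2 * c powr (- \<epsilon>) / \<epsilon>)"
      using I B by (intro mult_left_mono) auto
    finally show ?thesis
      using R0 by (subst contour_integral_linepath_same_Re[of _ c _ "- R" R]) (auto simp: norm_mult)
  qed
  define I1 I2 I3 where "I1 = contour_integral (linepath ?a ?b) g"
    and "I2 = contour_integral (linepath ?b ?d) g" and "I3 = contour_integral (linepath ?d ?e) g"
  define K V where "K = 2 * B * R powr (- \<epsilon>)" and "V = B * 2 powr (1 + \<epsilon>) * (2 * c powr (- \<epsilon>) / \<epsilon>)"
  have "contour_integral (three_sides c R) g = I1 + (I2 + I3)"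
    unfolding three_sides_def I1_def I2_def I3_def
    using cs by (simp add: contour_integrable_continuous_linepath)
  moreover have "norm I1 \<le> K" unfolding I1_def K_def by (rule hor) (use R R0 c cs in auto)
  moreover have "norm I3 \<le> K" unfolding I3_def K_def by (rule hor) (use R R0 c cs in auto)
  moreover have "norm I2 \<le> V" unfolding I2_def V_def by (rule ver)
  ultimately have "norm (contour_integral (three_sides c R) g) \<le> 2 * K + V"
    using norm_triangle_ineq[of I1 "I2 + I3"] norm_triangle_ineq[of I2 I3] by simp
  thus ?thesis by (simp add: K_def V_def)
qed

section \<open>The limit of the loop integral\<close>

context separating_loop
begin

text \<open>
  The line \<open>Re s = c\<close> may depend on \<open>t\<close>. The bound for the integral over it is \<open>O(t\<^bsup>-c\<^esup> c\<^bsup>-\<epsilon>\<^esup>)\<close>, and moving the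
  line to the right with \<open>c = 1 / (1 - t)\<close> keeps the first factor below \<open>exp 2\<close> while the second one tends to \<open>0\<close>.
\<close>

theorem loop_integral_tendsto_residue_sum:
  assumes \<Phi>: "\<Phi> holomorphic_on - P"
    and pb: "poly_bounded_on outside_strip (\<lambda>s. \<Phi> s / pochhammer s n)"
    and \<epsilon>: "Re w < - 1"
    and decay: "(\<lambda>s. \<Phi> s / pochhammer s n) \<in> O[at_sector](\<lambda>s. s powr w)"
  shows "((\<lambda>t. loop_mellin (\<lambda>s. \<Phi> s / pochhammer s n) t) \<longlongrightarrow>
          - (2 * of_real pi * \<i>) * (\<Sum>k<n. pole_residue n k * \<Phi> (- of_nat k))) (at_left 1)"
proof -
  define E where "E = (\<lambda>s. \<Phi> s / pochhammer s n)"
  define I where "I = (\<lambda>t. loop_mellin E t)"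
  define \<rho> where "\<rho> = (\<lambda>t. - (2 * of_real pi * \<i>) * (\<Sum>k<n. pole_residue n k * \<Phi> (- of_nat k) * of_real t ^ k))"
  define \<epsilon> where "\<epsilon> = - 1 - Re w"
  have \<epsilon>: "\<epsilon> > 0" "Re w = - 1 - \<epsilon>" using \<epsilon> by (simp_all add: \<epsilon>_def)
  have Ehol: "E holomorphic_on - P - Q"
    unfolding E_def by (intro holomorphic_intros holomorphic_on_subset[OF \<Phi>]) (auto simp: pochhammer_eq_0_iff)
  obtain C where C: "C > 0" "\<forall>\<^sub>F s in at_sector. norm (E s) \<le> C * norm (s powr w)"
    using decay unfolding E_def by (elim landau_o.bigE)
  then obtain r where r: "\<And>s. s \<in> sector \<Longrightarrow> r \<le> norm s \<Longrightarrow> norm (E s) \<le> C * norm (s powr w)"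
    unfolding eventually_at_sector by blast
  define B where "B = C * exp (\<bar>Im w\<bar> * pi)"
  have B: "B > 0" using C by (simp add: B_def)
  have bd: "norm (E s) \<le> B * norm s powr (- 1 - \<epsilon>)" if "s \<in> sector" "r \<le> norm s" for s
  proof -
    have "norm (E s) \<le> C * norm (s powr w)" using r that by blast
    also have "\<dots> \<le> C * (exp (\<bar>Im w\<bar> * pi) * norm s powr Re w)"
      using C by (intro mult_left_mono norm_powr_sector_le) auto
    finally show ?thesis by (simp add: B_def \<epsilon>(2))
  qed
  obtain c0 where c0: "c0 \<ge> 1" "c0 \<ge> r" "\<And>z. z \<in> P \<Longrightarrow> Re z < c0"
  proof -
    obtain m where "\<And>z. z \<in> P \<Longrightarrow> Re z < m" using right_bound_exists by blast
    thus ?thesis by (intro that[of "max (max 1 r) m"]) force+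
  qed
  define K where "K = 2 powr (1 + \<epsilon>) * (2 / \<epsilon>)"
  have main: "norm (I t - \<rho> t) \<le> exp (c * ln (1 / t)) * B * K * c powr (- \<epsilon>)"
    if t: "0 < t" "t < 1" and c: "c0 \<le> c" for t c
  proof -
    define g where "g = (\<lambda>s. E s * of_real t powr (- s))"
    define L where "L = ln (1 / t)"
    have L: "L > 0" using t by (simp add: L_def)
    have c': "0 < c" "\<And>z. z \<in> P \<Longrightarrow> Re z < c" "r \<le> c" using c c0 by force+
    have ghol: "g holomorphic_on - P - Q" unfolding g_def by (intro holomorphic_intros Ehol)
    have "((\<lambda>R. contour_integral (truncated_loop \<gamma> R) g -
        (contour_integral (truncated_loop \<gamma> R) g - contour_integral (three_sides c R) g)) \<longlongrightarrow> I t - \<rho> t) at_top"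
      unfolding I_def \<rho>_def g_def E_def
      by (intro tendsto_diff loop_integral_tendsto deform_to_three_sides \<Phi> pb t c' Ehol[unfolded E_def])
    hence lim: "((\<lambda>R. contour_integral (three_sides c R) g) \<longlongrightarrow> I t - \<rho> t) at_top" by simp
    have avoid: "\<forall>\<^sub>F R in at_top. path_image (three_sides c R) \<subseteq> - P - Q"
      using eventually_ge_at_top[of "max c (rad + real n)"] 
    proof eventually_elim
      case (elim R)
      have "s \<notin> P \<and> s \<notin> Q" if s: "s \<in> path_image (three_sides c R)" for s
      proof -
        have R: "0 \<le> R" "- R \<le> c" "rad + real n \<le> R" using elim c' by auto
        show ?thesis
          using three_sides_cases[OF s R(1,2)] c'(2)[of s] strip[of s] ends_rad R rad_pos c'(1)
          by auto
      qed
      thus ?case by blast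
    qed
    have "\<forall>\<^sub>F R in at_top. norm (contour_integral (three_sides c R) g) \<le>
        4 * (B * exp (c * L)) * R powr (- \<epsilon>) + (B * exp (c * L)) * 2 powr (1 + \<epsilon>) * (2 * c powr (- \<epsilon>) / \<epsilon>)"
      using avoid eventually_ge_at_top[of c]
    proof eventually_elim
      case (elim R)
      show ?case
      proof (rule three_sides_integral_bound[OF _ \<epsilon>(1) c'(1,3) elim(2)])
        show "continuous_on (path_image (three_sides c R)) g"
          by (intro holomorphic_on_imp_continuous_on holomorphic_on_subset[OF ghol] elim)
        fix s assume s: "s \<in> sector" "r \<le> norm s" "Re s \<le> c"
        have "norm (g s) \<le> (B * norm s powr (- 1 - \<epsilon>)) * exp (c * L)"
          unfolding g_def norm_mult norm_of_real_powr_minus[OF t(1)] L_def[symmetric]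
          using bd[OF s(1,2)] s L B by (intro mult_mono) auto
        thus "norm (g s) \<le> B * exp (c * L) * norm s powr (- 1 - \<epsilon>)" by (simp add: mult_ac)
      qed (use B in auto)
    qed
    moreover have "((\<lambda>R. 4 * (B * exp (c * L)) * R powr (- \<epsilon>) +
        (B * exp (c * L)) * 2 powr (1 + \<epsilon>) * (2 * c powr (- \<epsilon>) / \<epsilon>)) \<longlongrightarrow>
        4 * (B * exp (c * L)) * 0 + (B * exp (c * L)) * 2 powr (1 + \<epsilon>) * (2 * c powr (- \<epsilon>) / \<epsilon>)) at_top"
      using \<epsilon> by (intro tendsto_intros tendsto_neg_powr filterlim_ident) auto
    ultimately have "norm (I t - \<rho> t) \<le>
        4 * (B * exp (c * L)) * 0 + (B * exp (c * L)) * 2 powr (1 + \<epsilon>) * (2 * c powr (- \<epsilon>) / \<epsilon>)"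
      using tendsto_norm[OF lim] by (intro tendsto_le[of at_top]) auto
    thus ?thesis by (simp add: K_def L_def mult_ac)
  qed
  have "((\<lambda>t. I t - \<rho> t) \<longlongrightarrow> 0) (at_left 1)"
  proof (rule Lim_null_comparison)
    have "\<forall>\<^sub>F t in at_left (1::real). t \<in> {max (1/2) (1 - 1 / c0)<..<1}"
      using c0 by (intro eventually_at_leftI[of "max (1/2) (1 - 1 / c0)"]) auto
    thus "\<forall>\<^sub>F t in at_left 1. norm (I t - \<rho> t) \<le> exp 2 * B * K * (1 - t) powr \<epsilon>"
    proof eventually_elim
      case (elim t)
      define c where "c = 1 / (1 - t)"
      have t: "0 < t" "t < 1" "1 / 2 < t" using elim by auto
      have "1 - t \<le> 1 / c0" using elim by simp
      hence cc: "c0 \<le> c" unfolding c_def using t c0 by (simp add: field_simps)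
      have "c * ln (1 / t) \<le> c * (1 / t - 1)"
        using t ln_le_minus_one[of "1 / t"] by (intro mult_left_mono) (auto simp: c_def)
      also have "\<dots> = 1 / t" using t by (simp add: c_def field_simps)
      also have "\<dots> \<le> 2" using t by (simp add: field_simps)
      finally have "exp (c * ln (1 / t)) \<le> exp 2" by simp
      moreover have cp: "c powr (- \<epsilon>) = (1 - t) powr \<epsilon>"
        using t by (simp add: c_def powr_minus powr_divide field_simps)
      moreover have "0 \<le> K" using \<epsilon> by (simp add: K_def)
      ultimately have "exp (c * ln (1 / t)) * B * K * c powr (- \<epsilon>) \<le> exp 2 * B * K * (1 - t) powr \<epsilon>"
        unfolding cp using B by (intro mult_right_mono) auto
      with main[OF t(1,2) cc] show ?case by linarith
    qed
    have "((\<lambda>t::real. 1 - t) \<longlongrightarrow> 1 - 1) (at_left 1)" by (intro tendsto_intros)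
    hence "((\<lambda>t::real. (1 - t) powr \<epsilon>) \<longlongrightarrow> 0) (at_left 1)"
      using \<epsilon> by (intro tendsto_zero_powrI[where b = \<epsilon>])
        (auto intro!: tendsto_intros eventually_at_leftI[of 0])
    from tendsto_mult[OF tendsto_const this]
    show "((\<lambda>t. exp 2 * B * K * (1 - t) powr \<epsilon>) \<longlongrightarrow> 0) (at_left 1)" by simp
  qed
  moreover have "(\<rho> \<longlongrightarrow> \<rho> 1) (at_left 1)"
    unfolding \<rho>_def by (intro tendsto_intros)
  ultimately have "((\<lambda>t. I t - \<rho> t + \<rho> t) \<longlongrightarrow> 0 + \<rho> 1) (at_left 1)" by (rule tendsto_add)
  thus ?thesis by (simp add: I_def \<rho>_def E_def)
qed

end

section \<open>Residues on the left\<close>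

lemma rectangle_residues:
  fixes a b :: complex
  assumes g: "g holomorphic_on - X" and X: "closed X" "countable X"
    and fin: "finite (X \<inter> box a b)" and bd: "X \<inter> path_image (rectpath a b) = {}"
    and ab: "Re a < Re b" "Im a < Im b"
  shows "contour_integral (rectpath a b) g = 2 * of_real pi * \<i> * (\<Sum>p\<in>X \<inter> box a b. residue g p)"
proof -
  define S where "S = - (X - box a b)"
  have out: "winding_number (rectpath a b) z = 0" if "z \<notin> S" for z
  proof -
    have "z \<notin> cbox a b"
      using that bd path_image_rectpath_cbox_minus_box[of a b] ab by (auto simp: S_def)
    thus ?thesis using ab by (intro winding_number_rectpath_outside) auto
  qed
  have "open S" unfolding S_def using X by (auto intro!: open_Un open_box)
  moreover have "connected S"
    using connected_open_diff_countable[of UNIV "X - box a b"] X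
    by (simp add: S_def Compl_eq_Diff_UNIV connected_UNIV countable_Diff)
  moreover have "path_image (rectpath a b) \<subseteq> S - (X \<inter> box a b)" using bd by (auto simp: S_def)
  moreover have "g holomorphic_on S - (X \<inter> box a b)"
    by (rule holomorphic_on_subset[OF g]) (auto simp: S_def)
  ultimately have "contour_integral (rectpath a b) g =
      2 * pi * \<i> * (\<Sum>p\<in>X \<inter> box a b. winding_number (rectpath a b) p * residue g p)"
    using out fin by (intro Residue_theorem) auto
  also have "(\<Sum>p\<in>X \<inter> box a b. winding_number (rectpath a b) p * residue g p) = (\<Sum>p\<in>X \<inter> box a b. residue g p)"
    by (intro sum.cong) (auto simp: winding_number_rectpath)
  finally show ?thesis by simp
qed

lemma contour_integral_rectpath_three_sides:
  assumes "continuous_on (path_image (rectpath (Complex (- R) (- R)) (Complex c R))) g"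
  shows "contour_integral (rectpath (Complex (- R) (- R)) (Complex c R)) g =
     contour_integral (three_sides c R) g +
     contour_integral (linepath (Complex (- R) R) (Complex (- R) (- R))) g"
proof -
  have "continuous_on (closed_segment (Complex (- R) (- R)) (Complex c (- R))) g"
    "continuous_on (closed_segment (Complex c (- R)) (Complex c R)) g"
    "continuous_on (closed_segment (Complex c R) (Complex (- R) R)) g"
    "continuous_on (closed_segment (Complex (- R) R) (Complex (- R) (- R))) g"
    using assms unfolding rectpath_def Let_def
    by (auto simp: path_image_join intro: continuous_on_subset)
  thus ?thesis unfolding rectpath_def Let_def three_sides_def
    by (simp add: contour_integrable_continuous_linepath)
qed

text \<open>
  Closing the rectangle on the left by a side that avoids the poles and moves to \<open>-\<infinity>\<close>. The set \<open>S\<close>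
  contains these sides, and on it the integrand without \<open>t\<^bsup>-s\<^esup>\<close> is polynomially bounded.
\<close>

lemma three_sides_tendsto_left_residues:
  fixes E :: "complex \<Rightarrow> complex" and R :: "nat \<Rightarrow> real"
  assumes E: "E holomorphic_on - X" and X: "closed X" "countable X"
    and t: "0 < t" "t < 1" and c: "c > 0" "\<And>z. z \<in> X \<Longrightarrow> Re z < c"
    and im: "\<And>z. z \<in> X \<Longrightarrow> \<bar>Im z\<bar> \<le> h"
    and fin: "\<And>x. finite {z \<in> X. x \<le> Re z}"
    and R: "filterlim R at_top sequentially"
    and S: "\<And>N s. Re s = - R N \<Longrightarrow> 0 < R N \<Longrightarrow> s \<in> S" "S \<inter> X = {}" and pb: "poly_bounded_on S E"
  shows "(\<lambda>N. contour_integral (three_sides c (R N)) (\<lambda>s. E s * of_real t powr (- s)) -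
      2 * of_real pi * \<i> * (\<Sum>p | p \<in> X \<and> - R N < Re p. residue (\<lambda>s. E s * of_real t powr (- s)) p)) \<longlonglongrightarrow> 0"
proof -
  define g where "g = (\<lambda>s. E s * of_real t powr (- s))"
  have g: "g holomorphic_on - X" unfolding g_def by (intro holomorphic_intros E)
  let ?left = "\<lambda>N. linepath (Complex (- R N) (R N)) (Complex (- R N) (- R N))"
  have big: "\<forall>\<^sub>F N in sequentially. R N > \<bar>h\<bar> + c"
    using R by (auto simp: filterlim_at_top_dense)
  have left_sub: "closed_segment (Complex (- R N) (R N)) (Complex (- R N) (- R N)) \<subseteq>
      {s. Re s = - R N \<and> \<bar>Im s\<bar> \<le> R N}" if "R N > 0" for N
    using that by (auto simp: closed_segment_same_Re closed_segment_eq_real_ivl split: if_splits)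
  have rect: "\<forall>\<^sub>F N in sequentially. - contour_integral (?left N) g = contour_integral (three_sides c (R N)) g -
      2 * of_real pi * \<i> * (\<Sum>p | p \<in> X \<and> - R N < Re p. residue g p)"
    using big
  proof eventually_elim
    case (elim N)
    have RN: "R N > 0" "- R N \<le> c" using elim c by auto
    let ?a = "Complex (- R N) (- R N)" and ?b = "Complex c (R N)"
    have img: "path_image (rectpath ?a ?b) = path_image (three_sides c (R N)) \<union>
        closed_segment (Complex (- R N) (R N)) ?a"
      by (simp add: rectpath_def Let_def path_image_join path_image_three_sides Un_assoc)
    have "z \<notin> path_image (rectpath ?a ?b)" if z: "z \<in> X" for z
    proof -
      have "z \<notin> path_image (three_sides c (R N))"
        using three_sides_cases[of z c "R N"] RN c(2)[OF z] im[OF z] elim c(1) by auto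
      moreover have "Re z \<noteq> - R N" using S(1)[of z N] S(2) z RN by auto
      ultimately show ?thesis using left_sub[OF RN(1)] unfolding img by auto
    qed
    hence bd: "X \<inter> path_image (rectpath ?a ?b) = {}" by blast
    have box: "X \<inter> box ?a ?b = {p. p \<in> X \<and> - R N < Re p}"
      using c(2) im elim c(1) by (force simp: in_box_complex_iff)
    have "finite {p. p \<in> X \<and> - R N < Re p}"
      by (rule finite_subset[OF _ fin[of "- R N"]]) auto
    hence "contour_integral (rectpath ?a ?b) g =
        2 * of_real pi * \<i> * (\<Sum>p\<in>X \<inter> box ?a ?b. residue g p)"
      using RN c bd box by (intro rectangle_residues[OF g X]) auto
    moreover have "contour_integral (rectpath ?a ?b) g = contour_integral (three_sides c (R N)) g +
        contour_integral (?left N) g"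
      using bd by (intro contour_integral_rectpath_three_sides holomorphic_on_imp_continuous_on
          holomorphic_on_subset[OF g]) auto
    ultimately show ?case unfolding box by (simp add: algebra_simps)
  qed
  have "(\<lambda>N. contour_integral (?left N) g) \<longlonglongrightarrow> 0"
    unfolding g_def
  proof (rule far_left_integral_tendsto_0[OF t pb R, where M = 0])
    show "\<forall>\<^sub>F N in sequentially. closed_segment (Complex (- R N) (R N)) (Complex (- R N) (- R N)) \<subseteq>
        {s \<in> S. Re s \<le> 0 - R N \<and> norm s \<le> 3 * R N}"
      using big
    proof eventually_elim
      case (elim N)
      have RN: "R N > 0" using elim c by auto
      show ?case
      proof
        fix s assume "s \<in> closed_segment (Complex (- R N) (R N)) (Complex (- R N) (- R N))"
        hence s: "Re s = - R N" "\<bar>Im s\<bar> \<le> R N" using left_sub[OF RN] by auto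
        moreover have "norm s \<le> 3 * R N" using cmod_le[of s] s RN by simp
        ultimately show "s \<in> {s \<in> S. Re s \<le> 0 - R N \<and> norm s \<le> 3 * R N}" using S(1)[of s N] RN by simp
      qed
    qed
    show "\<forall>\<^sub>F N in sequentially. (\<lambda>s. E s * of_real t powr (- s)) contour_integrable_on ?left N"
      using big
    proof eventually_elim
      case (elim N)
      have RN: "R N > 0" using elim c by auto
      have "closed_segment (Complex (- R N) (R N)) (Complex (- R N) (- R N)) \<subseteq> - X"
        using left_sub[OF RN] S RN by blast
      thus ?case unfolding g_def[symmetric]
        by (intro contour_integrable_continuous_linepath holomorphic_on_imp_continuous_on
            holomorphic_on_subset[OF g])
    qed
  qed
  from tendsto_minus[OF this] have "(\<lambda>N. - contour_integral (?left N) g) \<longlonglongrightarrow> 0" by simp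
  from Lim_transform_eventually[OF this rect] show ?thesis unfolding g_def .
qed

definition gamma_poles :: "complex \<Rightarrow> complex set" where
  "gamma_poles \<alpha> = (\<lambda>l::nat. - \<alpha> - of_nat l) ` UNIV"

lemma gamma_poles_iff: "z \<in> gamma_poles \<alpha> \<longleftrightarrow> z + \<alpha> \<in> \<int>\<^sub>\<le>\<^sub>0"
proof
  assume "z + \<alpha> \<in> \<int>\<^sub>\<le>\<^sub>0"
  then obtain l where "z + \<alpha> = - of_nat l" by (elim nonpos_Ints_cases')
  hence "z = - of_nat l - \<alpha>" by (simp add: eq_diff_eq)
  hence "z = - \<alpha> - of_nat l" by simp
  thus "z \<in> gamma_poles \<alpha>" by (auto simp: gamma_poles_def)
qed (auto simp: gamma_poles_def)

lemma closed_gamma_poles: "closed (gamma_poles \<alpha>)"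
proof -
  have "gamma_poles \<alpha> = (+) (- \<alpha>) ` \<int>\<^sub>\<le>\<^sub>0"
    by (auto simp: gamma_poles_iff image_iff intro!: bexI[of _ "_ + \<alpha>"])
  thus ?thesis by (simp only: closed_nonpos_Ints closed_translation)
qed

lemma countable_gamma_poles: "countable (gamma_poles \<alpha>)"
  by (simp add: gamma_poles_def)

lemma finite_gamma_poles: "finite {z \<in> gamma_poles \<alpha>. x \<le> Re z}"
proof -
  obtain N :: nat where N: "- Re \<alpha> - x < real N" using reals_Archimedean2 by blast
  have "{z \<in> gamma_poles \<alpha>. x \<le> Re z} \<subseteq> (\<lambda>l::nat. - \<alpha> - of_nat l) ` {..N}"
    using N by (auto simp: gamma_poles_def)
  thus ?thesis by (rule finite_subset) auto
qed

lemma Gamma_quotient_holomorphic: "(\<lambda>s. Gamma (s + a) * rGamma (s + b)) holomorphic_on - gamma_poles a"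
  by (auto intro!: holomorphic_intros simp: gamma_poles_iff)

text \<open>
  The reciprocal Gamma factor at the pole is \<open>1 / \<Gamma>(\<delta> - l)\<close>, which produces the binomial coefficient.
\<close>

lemma residue_Gamma_quotient:
  assumes t: "0 < t"
  shows "residue (\<lambda>s. Gamma (s + \<alpha>) * rGamma (s + (\<alpha> + \<delta>)) * of_real t powr (- s)) (- \<alpha> - of_nat l) =
     of_real t powr \<alpha> * rGamma \<delta> * (((\<delta> - 1) gchoose l) * (- of_real t) ^ l)"
proof -
  let ?z = "- \<alpha> - of_nat l :: complex"
  define h where "h = (\<lambda>s. rGamma (s + (\<alpha> + \<delta>)) * of_real t powr (- s))"
  have "residue (\<lambda>s. Gamma (s + \<alpha>) * rGamma (s + (\<alpha> + \<delta>)) * of_real t powr (- s)) ?z =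
      ((- 1) ^ l / fact l) * h ?z"
  proof (rule residue_simple'[of "- (gamma_poles \<alpha> - {?z})"])
    have "closed (gamma_poles \<alpha> - {?z})"
    proof -
      have "gamma_poles \<alpha> - {?z} = gamma_poles \<alpha> - ball ?z 1"
      proof -
        have "norm (of_nat i - of_nat j :: complex) = \<bar>real i - real j\<bar>" for i j :: nat
          by (metis norm_of_real of_real_diff of_real_of_nat_eq)
        thus ?thesis by (auto simp: gamma_poles_def dist_norm)
      qed
      thus ?thesis by (simp add: closed_Diff closed_gamma_poles)
    qed
    thus "open (- (gamma_poles \<alpha> - {?z}))" by (rule open_Compl)
    show "(\<lambda>s. Gamma (s + \<alpha>) * rGamma (s + (\<alpha> + \<delta>)) * of_real t powr (- s)) holomorphic_on
        - (gamma_poles \<alpha> - {?z}) - {?z}"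
      by (rule holomorphic_on_subset[of _ "- gamma_poles \<alpha>"])
         (auto intro!: holomorphic_intros simp: gamma_poles_iff)
    have "isCont h ?z" unfolding h_def using t by (intro continuous_intros) auto
    hence h: "h \<midarrow>?z\<rightarrow> h ?z" by (simp add: isCont_def)
    have "(\<lambda>z. Gamma (z + \<alpha>) * (z + \<alpha> + of_nat l)) \<midarrow> (- of_nat l - \<alpha>) \<rightarrow> ((- 1) ^ l / fact l :: complex)"
      by (rule LIM_offset[OF Gamma_residues])
    from tendsto_mult[OF this[unfolded minus_diff_commute[of "of_nat l"]] h]
    show "(\<lambda>w. Gamma (w + \<alpha>) * rGamma (w + (\<alpha> + \<delta>)) * of_real t powr (- w) * (w - ?z)) \<midarrow>?z\<rightarrow>
        (- 1) ^ l / fact l * h ?z"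
      by (simp add: h_def algebra_simps)
  qed auto
  also have "h ?z = pochhammer (\<delta> - of_nat l) l * rGamma \<delta> * (of_real t powr \<alpha> * of_real t ^ l)"
  proof -
    have "rGamma (\<delta> - of_nat l) = pochhammer (\<delta> - of_nat l) l * rGamma \<delta>"
      using pochhammer_rGamma[of "\<delta> - of_nat l" l] by simp
    moreover have "of_real t powr (- ?z) = of_real t powr \<alpha> * (of_real t ^ l :: complex)"
      using t by (simp add: powr_add powr_nat)
    ultimately show ?thesis unfolding h_def by simp
  qed
  also have "pochhammer (\<delta> - of_nat l) l = fact l * ((\<delta> - 1) gchoose l)"
    by (simp add: gbinomial_pochhammer')
  finally show ?thesis by (simp add: power_mult_distrib[of "-1", simplified] mult_ac power_minus[of "of_real t"])
qed

section \<open>Loop integrals in closed form\<close>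

context separating_loop
begin

lemma Gamma_quotient_poly_bounded_outside_strip:
  assumes "gamma_poles \<alpha> \<subseteq> P"
  shows "poly_bounded_on outside_strip (\<lambda>s. Gamma (s + \<alpha>) * rGamma (s + \<beta>))"
proof -
  have "- \<alpha> \<in> P" using assms by (auto simp: gamma_poles_iff)
  note st = strip[OF this]
  define \<eta> where "\<eta> = min (Im (pathfinish \<gamma>) + Im \<alpha>) (- Im \<alpha> - Im (pathstart \<gamma>))"
  have \<eta>: "\<eta> > 0" using st by (simp add: \<eta>_def)
  show ?thesis
  proof (rule poly_bounded_on_Gamma_quotient[where \<kappa> = "(1 - exp (- 2 * pi * \<eta>)) / 2"])
    show "Re s \<le> 0" if "s \<in> outside_strip" for s using that by (simp add: outside_strip_def)
    show "0 < (1 - exp (- 2 * pi * \<eta>)) / 2" using \<eta> by simp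
    show "(1 - exp (- 2 * pi * \<eta>)) / 2 * exp (pi * \<bar>Im (s + \<alpha>)\<bar>) \<le> norm (sin (of_real pi * (s + \<alpha>)))"
      if "s \<in> outside_strip" for s
    proof (rule norm_sin_ge_strip[OF \<eta>])
      show "\<eta> \<le> \<bar>Im (s + \<alpha>)\<bar>" using that by (auto simp: outside_strip_def \<eta>_def)
    qed
  qed
qed

text \<open>
  All poles are on the left, so the loop integral is the sum of the residues there, and that is the
  binomial series of \<open>(1 - t)\<^bsup>\<delta>-1\<^esup>\<close>.
\<close>

lemma loop_integral_Gamma_quotient:
  assumes \<alpha>: "gamma_poles \<alpha> \<subseteq> P" and t: "0 < t" "t < 1"
  shows "loop_mellin (\<lambda>s. Gamma (s + \<alpha>) * rGamma (s + (\<alpha> + \<delta>))) t =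
     2 * of_real pi * \<i> * (of_real t powr \<alpha> * rGamma \<delta> * of_real (1 - t) powr (\<delta> - 1))"
proof -
  define E where "E = (\<lambda>s. Gamma (s + \<alpha>) * rGamma (s + (\<alpha> + \<delta>)))"
  define g where "g = (\<lambda>s. E s * of_real t powr (- s))"
  \<comment> \<open>This integrand has no poles on the right.\<close>
  interpret entire: separating_loop \<gamma> P 0
    by unfold_locales (use loop closed_P countable_P down finite_P left in auto)
  obtain c where c: "c > 0" "\<And>z. z \<in> P \<Longrightarrow> Re z < c" using right_bound_exists by blast
  have hol: "E holomorphic_on - gamma_poles \<alpha>" unfolding E_def by (rule Gamma_quotient_holomorphic)
  hence holP: "E holomorphic_on - P" by (rule holomorphic_on_subset) (use \<alpha> in auto)
  have pb: "poly_bounded_on outside_strip E"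
    unfolding E_def by (rule Gamma_quotient_poly_bounded_outside_strip[OF \<alpha>])
  \<comment> \<open>The left side \<open>Re s = - R N\<close> runs half-way between two consecutive poles.\<close>
  define R where "R = (\<lambda>N::nat. (1 / 2 + Re \<alpha>) + real N)"
  have R: "filterlim R at_top sequentially"
    unfolding R_def by (rule filterlim_tendsto_add_at_top[OF tendsto_const filterlim_real_sequentially])
  have "((\<lambda>R. contour_integral (truncated_loop \<gamma> R) g - contour_integral (three_sides c R) g) \<longlongrightarrow> 0) at_top"
    using entire.deform_to_three_sides[of E t c] holP pb t c unfolding g_def by simp
  from filterlim_compose[OF this R]
  have 1: "(\<lambda>N. contour_integral (truncated_loop \<gamma> (R N)) g - contour_integral (three_sides c (R N)) g) \<longlonglongrightarrow> 0" .
  define S where "S = {s. Re s \<le> 0 \<and> (\<exists>N::nat. Re (s + \<alpha>) = - real N - 1 / 2)}"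
  have im: "\<bar>Im z\<bar> \<le> \<bar>Im \<alpha>\<bar>" if "z \<in> gamma_poles \<alpha>" for z using that by (auto simp: gamma_poles_def)
  have SX: "S \<inter> gamma_poles \<alpha> = {}"
  proof (rule ccontr)
    assume "S \<inter> gamma_poles \<alpha> \<noteq> {}"
    then obtain N l :: nat where "- real l = - real N - 1 / 2" by (auto simp: S_def gamma_poles_def)
    hence "real (2 * l) = real (2 * N + 1)" by simp
    hence "2 * l = 2 * N + 1" by (simp only: of_nat_eq_iff)
    thus False by presburger
  qed
  have S1: "s \<in> S" if "Re s = - R N" "0 < R N" for N s
  proof -
    have "Re (s + \<alpha>) = - real N - 1 / 2" using that(1) by (simp add: R_def)
    thus ?thesis using that by (auto simp: S_def)
  qed
  have pbS: "poly_bounded_on S E"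
    unfolding E_def
  proof (rule poly_bounded_on_Gamma_quotient[where \<kappa> = "1 / 2"])
    show "1 / 2 * exp (pi * \<bar>Im (s + \<alpha>)\<bar>) \<le> norm (sin (of_real pi * (s + \<alpha>)))" if "s \<in> S" for s
      using that norm_sin_ge_half_integer unfolding S_def by blast
  qed (auto simp: S_def)
  have 2: "(\<lambda>N. contour_integral (three_sides c (R N)) g -
      2 * of_real pi * \<i> * (\<Sum>p | p \<in> gamma_poles \<alpha> \<and> - R N < Re p. residue g p)) \<longlonglongrightarrow> 0"
    unfolding g_def
    by (rule three_sides_tendsto_left_residues[OF hol closed_gamma_poles countable_gamma_poles t c(1) _ im
          finite_gamma_poles R S1 SX pbS])
       (use c \<alpha> in auto)
  have sum: "(\<Sum>p | p \<in> gamma_poles \<alpha> \<and> - R N < Re p. residue g p) =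
      of_real t powr \<alpha> * rGamma \<delta> * (\<Sum>l\<le>N. ((\<delta> - 1) gchoose l) * (- of_real t) ^ l)" for N
  proof -
    have "{p. p \<in> gamma_poles \<alpha> \<and> - R N < Re p} = (\<lambda>l::nat. - \<alpha> - of_nat l) ` {..N}"
      by (auto simp: gamma_poles_def R_def)
    moreover have "inj_on (\<lambda>l::nat. - \<alpha> - of_nat l) {..N}" by (auto simp: inj_on_def)
    ultimately have "(\<Sum>p | p \<in> gamma_poles \<alpha> \<and> - R N < Re p. residue g p) =
        (\<Sum>l\<le>N. residue g (- \<alpha> - of_nat l))" by (simp add: sum.reindex)
    thus ?thesis unfolding g_def E_def residue_Gamma_quotient[OF t(1)] by (simp add: sum_distrib_left)
  qed
  have "(\<lambda>l. ((\<delta> - 1) gchoose l) * (- of_real t) ^ l) sums (1 + - of_real t) powr (\<delta> - 1)"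
    using t by (intro gen_binomial_complex) auto
  hence "(\<lambda>N. \<Sum>l\<le>N. ((\<delta> - 1) gchoose l) * (- of_real t) ^ l) \<longlonglongrightarrow> of_real (1 - t) powr (\<delta> - 1)"
    by (simp add: sums_def_le)
  hence 3: "(\<lambda>N. 2 * of_real pi * \<i> * (\<Sum>p | p \<in> gamma_poles \<alpha> \<and> - R N < Re p. residue g p)) \<longlonglongrightarrow>
     2 * of_real pi * \<i> * (of_real t powr \<alpha> * rGamma \<delta> * of_real (1 - t) powr (\<delta> - 1))"
    unfolding sum by (intro tendsto_mult tendsto_const)
  have "(\<lambda>N. contour_integral (truncated_loop \<gamma> (R N)) g) \<longlonglongrightarrow>
     2 * of_real pi * \<i> * (of_real t powr \<alpha> * rGamma \<delta> * of_real (1 - t) powr (\<delta> - 1))"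
    using tendsto_add[OF tendsto_add[OF 1 2] 3] by simp
  moreover have "(\<lambda>N. contour_integral (truncated_loop \<gamma> (R N)) g) \<longlonglongrightarrow> loop_integral \<gamma> g"
    unfolding g_def
    by (rule filterlim_compose[OF loop_integral_tendsto[OF _ pb t] R])
       (rule holomorphic_on_subset[OF holP], auto)
  ultimately have "loop_integral \<gamma> g =
     2 * of_real pi * \<i> * (of_real t powr \<alpha> * rGamma \<delta> * of_real (1 - t) powr (\<delta> - 1))"
    using LIMSEQ_unique by blast
  thus ?thesis by (simp add: g_def E_def)
qed

text \<open>
  All poles are on the right. Opening the loop passes over them, and closing the rectangle on the left
  collects them again.
\<close>

lemma loop_integral_rational_eq_0:
  assumes t: "0 < t" "t < 1"
  shows "loop_mellin (\<lambda>s. poly q (s + d) / pochhammer s n) t = 0"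
proof -
  define \<Phi> where "\<Phi> = (\<lambda>s. poly q (s + d))"
  define E where "E = (\<lambda>s. \<Phi> s / pochhammer s n)"
  define g where "g = (\<lambda>s. E s * of_real t powr (- s))"
  obtain c where c: "c > 0" "\<And>z. z \<in> P \<Longrightarrow> Re z < c" using right_bound_exists by blast
  have pol: "\<Phi> holomorphic_on A" for A unfolding \<Phi>_def by (intro holomorphic_intros)
  have hol: "E holomorphic_on - Q"
    unfolding E_def by (intro holomorphic_intros pol) (auto simp: pochhammer_eq_0_iff)
  have pb: "poly_bounded_on S E" for S
    using poly_bounded_on_mult[OF poly_bounded_on_poly[of S q d] poly_bounded_on_inverse_pochhammer[of S n]]
    by (simp add: E_def \<Phi>_def)
  define \<rho> where "\<rho> = (\<Sum>k<n. pole_residue n k * \<Phi> (- of_nat k) * of_real t ^ k)"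
  define R where "R = (\<lambda>N::nat. real n + real N)"
  have R: "filterlim R at_top sequentially"
    unfolding R_def by (rule filterlim_tendsto_add_at_top[OF tendsto_const filterlim_real_sequentially])
  have "((\<lambda>R. contour_integral (truncated_loop \<gamma> R) g - contour_integral (three_sides c R) g) \<longlongrightarrow>
      - (2 * of_real pi * \<i>) * \<rho>) at_top"
    unfolding g_def E_def \<rho>_def by (intro deform_to_three_sides pol pb[unfolded E_def] t c)
  from filterlim_compose[OF this R]
  have 1: "(\<lambda>N. contour_integral (truncated_loop \<gamma> (R N)) g - contour_integral (three_sides c (R N)) g) \<longlonglongrightarrow>
      - (2 * of_real pi * \<i>) * \<rho>" .
  have 2: "(\<lambda>N. contour_integral (three_sides c (R N)) g -
      2 * of_real pi * \<i> * (\<Sum>p | p \<in> Q \<and> - R N < Re p. residue g p)) \<longlonglongrightarrow> 0"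
    unfolding g_def
  proof (rule three_sides_tendsto_left_residues[OF hol _ _ t c(1) _ _ _ R _ _ pb])
    show "s \<in> {s. Re s \<le> - real n \<and> s \<notin> Q}" if "Re s = - R N" "0 < R N" for N s
      using that by (auto simp: R_def)
    show "\<bar>Im z\<bar> \<le> 0" if "z \<in> Q" for z using that by auto
  qed (use c(1) in \<open>auto intro: finite_imp_closed countable_finite\<close>)
  have sum: "(\<Sum>p | p \<in> Q \<and> - R N < Re p. residue g p) = \<rho>" for N
  proof -
    have "{p. p \<in> Q \<and> - R N < Re p} = Q" by (auto simp: R_def)
    hence "(\<Sum>p | p \<in> Q \<and> - R N < Re p. residue g p) = (\<Sum>k<n. residue g (- of_nat k))"
      by (simp add: sum.reindex inj_on_def)
    also have "\<dots> = \<rho>"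
      unfolding \<rho>_def
    proof (rule sum.cong[OF refl])
      fix k assume k: "k \<in> {..<n}"
      show "residue g (- of_nat k) = pole_residue n k * \<Phi> (- of_nat k) * of_real t ^ k"
        unfolding g_def E_def using k t by (intro residue_loop_integrand[of UNIV] pol) auto
    qed
    finally show ?thesis .
  qed
  have "(\<lambda>N. contour_integral (truncated_loop \<gamma> (R N)) g) \<longlonglongrightarrow> 0"
    using tendsto_add[OF tendsto_add[OF 1 2] tendsto_const[of "2 * of_real pi * \<i> * \<rho>"]]
    unfolding sum by simp
  moreover have "(\<lambda>N. contour_integral (truncated_loop \<gamma> (R N)) g) \<longlonglongrightarrow> loop_integral \<gamma> g"
    unfolding g_def
    by (rule filterlim_compose[OF loop_integral_tendsto[OF _ pb t] R])
       (rule holomorphic_on_subset[OF hol], auto)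
  ultimately show ?thesis unfolding g_def E_def \<Phi>_def using LIMSEQ_unique by blast
qed

end

section \<open>Linearity, the polynomial q and the residue sum\<close>

context separating_loop
begin

lemma loop_integral_cong:
  assumes "\<And>s. s \<in> - P - Q \<Longrightarrow> f s = g s"
  shows "loop_integral \<gamma> f = loop_integral \<gamma> g"
  unfolding loop_integral_def
proof (rule Lim_cong[OF _ refl], use eventually_ge_at_top[of 0] in eventually_elim)
  case (elim R)
  thus ?case using truncated_loop_avoids[OF elim] by (intro contour_integral_eq assms) blast
qed

lemma loop_integral_sum:
  fixes f :: "'i \<Rightarrow> complex \<Rightarrow> complex" and c :: "'i \<Rightarrow> complex"
  assumes f: "\<And>i. i \<in> I \<Longrightarrow> f i holomorphic_on - P - Q" "\<And>i. i \<in> I \<Longrightarrow> poly_bounded_on outside_strip (f i)"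
    and fin: "finite I" and t: "0 < t" "t < 1"
  shows "loop_mellin (\<lambda>s. (\<Sum>i\<in>I. c i * f i s)) t =
     (\<Sum>i\<in>I. c i * loop_mellin (f i) t)"
proof -
  have "((\<lambda>R. \<Sum>i\<in>I. c i * contour_integral (truncated_loop \<gamma> R) (\<lambda>s. f i s * of_real t powr (- s))) \<longlongrightarrow>
     (\<Sum>i\<in>I. c i * loop_mellin (f i) t)) at_top"
    by (intro tendsto_sum tendsto_mult tendsto_const loop_integral_tendsto f t)
  moreover have "\<forall>\<^sub>F R in at_top. (\<Sum>i\<in>I. c i * contour_integral (truncated_loop \<gamma> R) (\<lambda>s. f i s * of_real t powr (- s))) =
     contour_integral (truncated_loop \<gamma> R) (\<lambda>s. (\<Sum>i\<in>I. c i * f i s) * of_real t powr (- s))"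
    using eventually_ge_at_top[of 0]
  proof eventually_elim
    case (elim R)
    have int: "(\<lambda>s. f i s * of_real t powr (- s)) contour_integrable_on truncated_loop \<gamma> R" if "i \<in> I" for i
      by (rule truncated_integral_split(2)[OF _ elim]) (intro holomorphic_intros f that)
    have "contour_integral (truncated_loop \<gamma> R) (\<lambda>s. (\<Sum>i\<in>I. c i * f i s) * of_real t powr (- s)) =
        contour_integral (truncated_loop \<gamma> R) (\<lambda>s. \<Sum>i\<in>I. c i * (f i s * of_real t powr (- s)))"
      by (simp add: sum_distrib_right mult.assoc)
    also have "\<dots> = (\<Sum>i\<in>I. contour_integral (truncated_loop \<gamma> R) (\<lambda>s. c i * (f i s * of_real t powr (- s))))"
      by (intro contour_integral_sum fin contour_integrable_lmul int)
    also have "\<dots> = (\<Sum>i\<in>I. c i * contour_integral (truncated_loop \<gamma> R) (\<lambda>s. f i s * of_real t powr (- s)))"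
      by (intro sum.cong refl contour_integral_lmul int)
    finally show ?case ..
  qed
  ultimately have "((\<lambda>R. contour_integral (truncated_loop \<gamma> R) (\<lambda>s. (\<Sum>i\<in>I. c i * f i s) * of_real t powr (- s))) \<longlongrightarrow>
     (\<Sum>i\<in>I. c i * loop_mellin (f i) t)) at_top"
    by (rule Lim_transform_eventually)
  thus ?thesis unfolding loop_integral_def[of \<gamma> "\<lambda>s. (\<Sum>i\<in>I. c i * f i s) * of_real t powr (- s)"]
    by (intro tendsto_Lim) auto
qed

lemma loop_integral_add:
  assumes "f holomorphic_on - P - Q" "poly_bounded_on outside_strip f"
    and "g holomorphic_on - P - Q" "poly_bounded_on outside_strip g" and t: "0 < t" "t < 1"
  shows "loop_mellin (\<lambda>s. (f s + g s)) t =
     loop_mellin f t + loop_mellin g t"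
proof -
  have "loop_mellin (\<lambda>s. (\<Sum>i\<in>{True, False}. 1 * (if i then f else g) s)) t =
    (\<Sum>i\<in>{True, False}. 1 * loop_mellin (\<lambda>s. (if i then f else g) s) t)"
    by (rule loop_integral_sum[OF _ _ _ t]) (use assms in auto)
  thus ?thesis by simp
qed

end

lemma degree_pochhammer_linear:
  fixes c :: complex
  shows "degree (pochhammer [:c, 1:] j) = j" "coeff (pochhammer [:c, 1:] j) j = 1"
proof -
  have "degree (pochhammer [:c, 1:] j) = j \<and> lead_coeff (pochhammer [:c, 1:] j) = 1"
  proof (induction j)
    case (Suc j)
    have f: "[:c, 1:] + of_nat j = [:c + of_nat j, 1:]" by (simp add: of_nat_poly)
    have "pochhammer [:c, 1:] j \<noteq> 0" using Suc by auto
    hence d: "degree (pochhammer [:c, 1:] j * [:c + of_nat j, 1:]) = Suc j"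
      using Suc by (simp add: degree_mult_eq del: mult_pCons_right)
    have "coeff (pochhammer [:c, 1:] j) j = 1" using Suc by metis
    thus ?case
      using d Suc lead_coeff_mult[of "pochhammer [:c, 1:] j" "[:c + of_nat j, 1:]"]
      unfolding pochhammer_Suc f by (simp del: mult_pCons_right)
  qed simp
  thus "degree (pochhammer [:c, 1:] j) = j" "coeff (pochhammer [:c, 1:] j) j = 1" by auto
qed

text \<open>
  The term for \<open>j = m\<close> has degree \<open>m\<close> and leading coefficient \<open>g\<^sub>0 = 1\<close>; all others have smaller degree.
\<close>

lemma degree_norlund_poly:
  assumes "p \<ge> 1"
  shows "degree (norlund_poly p m a b) = m"
proof (rule antisym)
  show "degree (norlund_poly p m a b) \<le> m"
    unfolding norlund_poly_def
    by (intro degree_sum_le) (auto intro: order_trans[OF degree_smult_le] simp: degree_pochhammer_linear)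
  have "coeff (norlund_poly p m a b) m =
      (\<Sum>j=0..m. norlund_coeff p a b (m - j) * coeff (pochhammer [:a p - of_nat j, 1:] j) m)"
    by (simp add: norlund_poly_def coeff_sum)
  also have "\<dots> = (\<Sum>j=0..m. if j = m then 1 else 0)"
    using assms by (intro sum.cong refl)
      (auto simp: degree_pochhammer_linear norlund_coeff_0 intro!: coeff_eq_0)
  finally have "coeff (norlund_poly p m a b) m = 1" by simp
  thus "m \<le> degree (norlund_poly p m a b)" by (intro le_degree) simp
qed

lemma poly_norlund_poly:
  "poly (norlund_poly p m a b) x =
     (\<Sum>j=0..m. norlund_coeff p a b (m - j) * pochhammer (x + a p - of_nat j) j)"
proof -
  have "poly (pochhammer [:c, 1:] j) x = pochhammer (x + c) j" for c :: complex and j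
    by (induction j) (simp_all add: pochhammer_Suc of_nat_poly algebra_simps)
  thus ?thesis by (simp add: norlund_poly_def poly_sum add_diff_eq)
qed

lemma Gamma_reflected_quotient:
  assumes "\<And>k::nat. s \<noteq> 1 - of_nat n + of_nat k"
  shows "Gamma (1 - of_nat n - s) * rGamma (1 - s) = (- 1) ^ n / pochhammer s n"
proof -
  define z where "z = 1 - of_nat n - s"
  have z: "z \<notin> \<int>\<^sub>\<le>\<^sub>0"
  proof
    assume "z \<in> \<int>\<^sub>\<le>\<^sub>0"
    then obtain k where "z = - of_nat k" by (elim nonpos_Ints_cases')
    hence "s = 1 - of_nat n + of_nat k" by (simp add: z_def algebra_simps)
    thus False using assms by blast
  qed
  have r: "rGamma z \<noteq> 0" using z by (simp add: rGamma_eq_zero_iff)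
  have "rGamma z = pochhammer z n * rGamma (1 - s)"
    using pochhammer_rGamma[of z n] by (simp add: z_def)
  moreover from this have "pochhammer z n \<noteq> 0" using r by auto
  ultimately have "Gamma z * rGamma (1 - s) = 1 / pochhammer z n"
    using r by (simp add: Gamma_def field_simps)
  also have "pochhammer z n = (- 1) ^ n * pochhammer s n"
    using pochhammer_minus[of "of_nat n - 1 + s" n] by (simp add: z_def algebra_simps)
  finally show ?thesis by (simp add: z_def divide_inverse power_inverse[symmetric])
qed

text \<open>
  The pole \<open>- k\<close> on the right corresponds to the summation index \<open>j = n - 1 - k\<close>.
\<close>

lemma residue_sum_reindex:
  fixes h :: "complex \<Rightarrow> complex"
  assumes "n \<ge> 1"
  shows "- ((- 1) ^ n * (\<Sum>k<n. pole_residue n k * h (- of_nat k))) =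
     (\<Sum>j=0..n-1. (- 1) ^ j * h (of_nat j - (of_nat n - 1)) / (fact (n - 1 - j) * fact j))"
proof -
  obtain m where m: "n = Suc m" using assms by (cases n) auto
  have sgn: "- ((- 1) ^ n * x) = (- 1) ^ m * x" for x :: complex by (simp add: m)
  have "- ((- 1) ^ n * (\<Sum>k<n. pole_residue n k * h (- of_nat k))) =
      (\<Sum>k<n. (- 1) ^ m * (pole_residue n k * h (- of_nat k)))"
    unfolding sum_distrib_left[symmetric] by (rule sgn)
  also have "\<dots> = (\<Sum>k<n. (- 1) ^ m * (pole_residue n (n - Suc k) * h (- of_nat (n - Suc k))))"
    by (rule sum.nat_diff_reindex[symmetric])
  also have "\<dots> = (\<Sum>j<n. (- 1) ^ j * h (of_nat j - (of_nat n - 1)) / (fact (n - 1 - j) * fact j))"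
  proof (rule sum.cong[OF refl])
    fix j assume "j \<in> {..<n}"
    hence j: "j \<le> m" by (simp add: m)
    have "(- 1) ^ m * (- 1) ^ (m - j) = ((- 1) ^ j :: complex)"
    proof -
      obtain d where "m = j + d" using j le_iff_add by blast
      thus ?thesis by (simp add: power_add flip: power_mult_distrib)
    qed
    thus "(- 1) ^ m * (pole_residue n (n - Suc j) * h (- of_nat (n - Suc j))) =
        (- 1) ^ j * h (of_nat j - (of_nat n - 1)) / (fact (n - 1 - j) * fact j)"
      using j by (simp add: m pole_residue_def of_nat_diff)
  qed
  also have "\<dots> = (\<Sum>j=0..n-1. (- 1) ^ j * h (of_nat j - (of_nat n - 1)) / (fact (n - 1 - j) * fact j))"
    using assms by (intro sum.cong) auto
  finally show ?thesis .
qed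

section \<open>The limit when the integrand decays\<close>

locale norlund_setting =
  fixes p n :: nat and a b :: "nat \<Rightarrow> complex" and \<gamma> :: "real \<Rightarrow> complex"
  assumes p: "p \<ge> 1" and n: "n \<ge> 1"
    and nonpole: "\<And>k. k \<in> {1..p} \<Longrightarrow> - a k \<notin> \<nat>"
    and separating: "separating_left_loop p n a \<gamma>"
begin

definition A where "A = (\<lambda>k. a k + of_nat n - 1)"
definition B where "B = (\<lambda>k. b k + of_nat n - 1)"
definition P where "P = (\<Union>k\<in>{1..p}. gamma_poles (A k))"
definition F where "F = (\<lambda>s. \<Prod>k=1..p. Gamma (s + A k) * rGamma (s + B k))"
definition \<psi> where "\<psi> = (\<Sum>k=1..p. b k - a k)"

lemma psi_shift: "(\<Sum>k=1..p. B k - A k) = \<psi>"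
  by (simp add: A_def B_def \<psi>_def)

sublocale separating_loop \<gamma> P n
proof
  show "left_loop \<gamma>" using separating by (simp add: separating_left_loop_def)
  show "closed P" unfolding P_def by (intro closed_UN ballI closed_gamma_poles) auto
  show "countable P" unfolding P_def by (intro countable_UN countable_gamma_poles) auto
  show "z - 1 \<in> P" if z: "z \<in> P" for z
  proof -
    obtain k l where k: "k \<in> {1..p}" "z = - A k - of_nat l" using z by (auto simp: P_def gamma_poles_def)
    hence "z - 1 = - A k - of_nat (Suc l)" by simp
    thus ?thesis using k(1) unfolding P_def gamma_poles_def by blast
  qed
  show "finite {z \<in> P. x \<le> Re z}" for x
  proof -
    have "{z \<in> P. x \<le> Re z} = (\<Union>k\<in>{1..p}. {z \<in> gamma_poles (A k). x \<le> Re z})" by (auto simp: P_def)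
    thus ?thesis by (simp only:) (intro finite_UN_I finite_gamma_poles, auto)
  qed
  show "on_left_of_loop \<gamma> z" if z: "z \<in> P" for z
  proof -
    obtain k l where k: "k \<in> {1..p}" "z = - A k - of_nat l" using z by (auto simp: P_def gamma_poles_def)
    have "z = 1 - a k - of_nat n - of_nat l" using k by (simp add: A_def)
    thus ?thesis using separating k(1) by (auto simp: separating_left_loop_def)
  qed
  show "on_right_of_loop \<gamma> (- of_nat k)" if "k < n" for k
  proof -
    have "(- of_nat k :: complex) = 1 - of_nat n + of_nat (n - 1 - k)"
      using that by (simp add: of_nat_diff)
    thus ?thesis using separating by (simp only: separating_left_loop_def)
  qed
qed

lemma P_subset: "k \<in> {1..p} \<Longrightarrow> gamma_poles (A k) \<subseteq> P"
  by (auto simp: P_def)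

lemma F_holomorphic: "F holomorphic_on - P"
  unfolding F_def
  by (intro holomorphic_intros holomorphic_on_subset[OF Gamma_quotient_holomorphic])
     (use P_subset in auto)

lemma F_poly_bounded: "poly_bounded_on outside_strip F"
  unfolding F_def by (intro poly_bounded_on_prod Gamma_quotient_poly_bounded_outside_strip P_subset)

text \<open>
  The quotient \<open>\<Gamma>(1 - n - s) / \<Gamma>(1 - s)\<close> is rational away from the points \<open>1 - n + k\<close>, and the loop avoids all
  of these, including the removable ones with \<open>k \<ge> n\<close>.
\<close>

lemma G_hat_eq:
  "G_hat \<gamma> p n a b t = 1 / (2 * of_real pi * \<i>) *
     loop_mellin (\<lambda>s. (- 1) ^ n * F s / pochhammer s n) t"
proof -
  have "loop_integral \<gamma> (\<lambda>s.
       (\<Prod>k=1..p. Gamma (a k + of_nat n - 1 + s)) * Gamma (1 - of_nat n - s) *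
       (\<Prod>k=1..p. rGamma (b k + of_nat n - 1 + s)) * rGamma (1 - s) * of_real t powr (- s)) =
     loop_mellin (\<lambda>s. (- 1) ^ n * F s / pochhammer s n) t"
    unfolding loop_integral_def
  proof (rule Lim_cong[OF _ refl], use eventually_ge_at_top[of 0] in eventually_elim)
    case (elim R)
    show ?case
    proof (rule contour_integral_eq)
      fix s assume s: "s \<in> path_image (truncated_loop \<gamma> R)"
      have "s \<noteq> 1 - of_nat n + of_nat k" for k
        using on_side_of_loop_avoids[OF _ elim] s separating unfolding separating_left_loop_def by blast
      hence G: "Gamma (1 - of_nat n - s) * rGamma (1 - s) = (- 1) ^ n / pochhammer s n"
        by (rule Gamma_reflected_quotient)
      have F: "F s = (\<Prod>k=1..p. Gamma (a k + of_nat n - 1 + s)) * (\<Prod>k=1..p. rGamma (b k + of_nat n - 1 + s))"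
        unfolding F_def prod.distrib A_def B_def by (simp add: add_ac add_diff_eq)
      have "(\<Prod>k=1..p. Gamma (a k + of_nat n - 1 + s)) * Gamma (1 - of_nat n - s) *
          (\<Prod>k=1..p. rGamma (b k + of_nat n - 1 + s)) * rGamma (1 - s) * of_real t powr (- s) =
          F s * (Gamma (1 - of_nat n - s) * rGamma (1 - s)) * of_real t powr (- s)"
        unfolding F by (simp only: mult_ac)
      also have "\<dots> = (- 1) ^ n * F s / pochhammer s n * of_real t powr (- s)"
        unfolding G by simp
      finally show "(\<Prod>k=1..p. Gamma (a k + of_nat n - 1 + s)) * Gamma (1 - of_nat n - s) *
          (\<Prod>k=1..p. rGamma (b k + of_nat n - 1 + s)) * rGamma (1 - s) * of_real t powr (- s) =
          (- 1) ^ n * F s / pochhammer s n * of_real t powr (- s)" .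
    qed
  qed
  thus ?thesis by (simp add: G_hat_def)
qed

lemma Gamma_a_nonzero: "(\<Prod>k=1..p. Gamma (a k)) \<noteq> 0"
proof -
  have "a k \<notin> \<int>\<^sub>\<le>\<^sub>0" if "k \<in> {1..p}" for k
  proof
    assume "a k \<in> \<int>\<^sub>\<le>\<^sub>0"
    then obtain l where "a k = - of_nat l" by (elim nonpos_Ints_cases')
    thus False using nonpole[OF that] by simp
  qed
  thus ?thesis by (auto simp: Gamma_eq_zero_iff)
qed

lemma F_residue_sum:
  "(\<Sum>j=0..n-1. (- 1) ^ j * F (of_nat j - (of_nat n - 1)) / (fact (n - 1 - j) * fact j)) =
     (\<Prod>k=1..p. Gamma (a k)) * hyp_F_one_div_Gamma p n a b / fact (n - 1)"
proof -
  have "(- 1) ^ j * F (of_nat j - (of_nat n - 1)) / (fact (n - 1 - j) * fact j) =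
      (\<Prod>k=1..p. Gamma (a k)) * (pochhammer (1 - of_nat n) j * (\<Prod>k=1..p. pochhammer (a k) j) *
        (\<Prod>k=1..p. rGamma (b k + of_nat j)) / fact j) / fact (n - 1)" if "j \<in> {0..n-1}" for j
  proof -
    have j: "j \<le> n - 1" using that by simp
    have G: "Gamma (a k + of_nat j) = pochhammer (a k) j * Gamma (a k)" if "k \<in> {1..p}" for k
    proof -
      have "a k \<notin> \<int>\<^sub>\<le>\<^sub>0" using Gamma_a_nonzero that by (auto simp: Gamma_eq_zero_iff)
      thus ?thesis using pochhammer_Gamma[of "a k" j] by (simp add: Gamma_eq_zero_iff)
    qed
    have F: "F (of_nat j - (of_nat n - 1)) =
        (\<Prod>k=1..p. Gamma (a k)) * (\<Prod>k=1..p. pochhammer (a k) j) * (\<Prod>k=1..p. rGamma (b k + of_nat j))"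
    proof -
      have "F (of_nat j - (of_nat n - 1)) = (\<Prod>k=1..p. Gamma (a k + of_nat j) * rGamma (b k + of_nat j))"
        unfolding F_def A_def B_def by (intro prod.cong refl) (simp add: algebra_simps)
      also have "\<dots> = (\<Prod>k=1..p. Gamma (a k) * pochhammer (a k) j * rGamma (b k + of_nat j))"
        by (intro prod.cong refl) (simp add: G)
      finally show ?thesis by (simp add: prod.distrib)
    qed
    have "pochhammer (1 - of_nat n :: complex) j = (- 1) ^ j * (fact (n - 1) / fact (n - 1 - j))"
    proof -
      have "pochhammer (- of_nat (n - 1) :: complex) j = (- 1) ^ j * pochhammer (of_nat (n - 1) - of_nat j + 1) j"
        by (rule pochhammer_minus)
      also have "pochhammer (of_nat (n - 1) - of_nat j + 1 :: complex) j = fact (n - 1) / fact (n - 1 - j)"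
      proof -
        have "(fact (n - 1) :: complex) = fact (n - 1 - j) * pochhammer (of_nat (n - 1 - j) + 1) j"
          using pochhammer_product'[of "1 :: complex" "n - 1 - j" j]
          unfolding le_add_diff_inverse2[OF j] pochhammer_fact by (simp add: add.commute)
        thus ?thesis unfolding of_nat_diff[OF j] by simp
      qed
      finally show ?thesis using n by (simp add: of_nat_diff)
    qed
    thus ?thesis unfolding F by simp
  qed
  thus ?thesis
    unfolding hyp_F_one_div_Gamma_def by (simp add: sum_distrib_left sum_divide_distrib)
qed

lemma F_bigo: "F \<in> O[at_sector](\<lambda>s. s powr (- \<psi>))"
  using norlund_expansion[OF p, of A B 0] unfolding psi_shift F_def by simp

lemma over_pochhammer_bigo:
  assumes "f \<in> O[at_sector](\<lambda>s. s powr w)"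
  shows "(\<lambda>s. (- 1) ^ n * f s / pochhammer s n) \<in> O[at_sector](\<lambda>s. s powr (w - of_nat n))"
proof -
  have "(\<lambda>s. (- 1) ^ n * (f s * (1 / pochhammer (s + 0) n))) \<in> O[at_sector](\<lambda>s. s powr w * (1 / s ^ n))"
    by (intro bigo_cmult_left landau_o.big.mult assms bigo_inverse_pochhammer_shift)
  moreover have "\<forall>\<^sub>F s in at_sector. s powr w * (1 / s ^ n) = s powr (w - of_nat n)"
    using eventually_at_sector_nonzero[of 0] by eventually_elim (simp add: powr_diff powr_nat)
  ultimately show ?thesis by (simp add: landau_o.big.cong)
qed

lemma over_pochhammer_holomorphic:
  "\<Phi> holomorphic_on - P \<Longrightarrow> (\<lambda>s. \<Phi> s / pochhammer s n) holomorphic_on - P - Q"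
  by (rule holomorphic_on_divide, erule holomorphic_on_subset)
     (auto intro!: holomorphic_intros simp: pochhammer_eq_0_iff)

lemma over_pochhammer_poly_bounded:
  "poly_bounded_on outside_strip \<Phi> \<Longrightarrow> poly_bounded_on outside_strip (\<lambda>s. (- 1) ^ n * \<Phi> s / pochhammer s n)"
  using poly_bounded_on_mult[OF poly_bounded_on_mult[OF poly_bounded_on_const[of outside_strip "(- 1) ^ n"], of \<Phi>]
      poly_bounded_on_inverse_pochhammer[of outside_strip n]] by simp

lemma normalized_loop_integral_tendsto:
  assumes hol: "\<Phi> holomorphic_on - P" and pb: "poly_bounded_on outside_strip \<Phi>"
    and dec: "\<Phi> \<in> O[at_sector](\<lambda>s. s powr w)" and w: "Re w < real n - 1"
  shows "((\<lambda>t. 1 / (2 * of_real pi * \<i>) *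
       loop_mellin (\<lambda>s. (- 1) ^ n * \<Phi> s / pochhammer s n) t) \<longlongrightarrow>
     (\<Sum>j=0..n-1. (- 1) ^ j * \<Phi> (of_nat j - (of_nat n - 1)) / (fact (n - 1 - j) * fact j))) (at_left 1)"
proof -
  have "((\<lambda>t. loop_mellin (\<lambda>s. (- 1) ^ n * \<Phi> s / pochhammer s n) t) \<longlongrightarrow>
      - (2 * of_real pi * \<i>) * (\<Sum>k<n. pole_residue n k * ((- 1) ^ n * \<Phi> (- of_nat k)))) (at_left 1)"
    using w by (intro loop_integral_tendsto_residue_sum[where w = "w - of_nat n"] holomorphic_intros hol
        over_pochhammer_poly_bounded pb over_pochhammer_bigo dec) auto
  from tendsto_mult[OF tendsto_const[of "1 / (2 * of_real pi * \<i>)"] this]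
  have "((\<lambda>t. 1 / (2 * of_real pi * \<i>) *
       loop_mellin (\<lambda>s. (- 1) ^ n * \<Phi> s / pochhammer s n) t) \<longlongrightarrow>
     - ((- 1) ^ n * (\<Sum>k<n. pole_residue n k * \<Phi> (- of_nat k)))) (at_left 1)"
    by (simp add: sum_distrib_left sum_negf mult_ac)
  thus ?thesis unfolding residue_sum_reindex[OF n] .
qed

theorem G_hat_tendsto:
  assumes "Re \<psi> + real n - 1 > 0"
  shows "((\<lambda>x. G_hat \<gamma> p n a b x / (\<Prod>k=1..p. Gamma (a k))) \<longlongrightarrow>
           hyp_F_one_div_Gamma p n a b / fact (n - 1)) (at_left 1)"
proof -
  have "(G_hat \<gamma> p n a b \<longlongrightarrow>
     (\<Prod>k=1..p. Gamma (a k)) * hyp_F_one_div_Gamma p n a b / fact (n - 1)) (at_left 1)"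
    unfolding F_residue_sum[symmetric] G_hat_eq
    by (rule normalized_loop_integral_tendsto[OF F_holomorphic F_poly_bounded F_bigo]) (use assms in auto)
  from tendsto_divide[OF this tendsto_const Gamma_a_nonzero] show ?thesis using Gamma_a_nonzero by simp
qed

end

section \<open>The limit when the integrand does not decay\<close>

context norlund_setting
begin

definition norlund_shifted_poly :: "nat \<Rightarrow> complex \<Rightarrow> complex" where
  "norlund_shifted_poly m s = poly (norlund_poly p m a b) (s + (of_nat n - 1))"

lemma norlund_coeff_shift: "norlund_coeff p A B = norlund_coeff p a b"
proof -
  have "B (m + 1) - A m = b (m + 1) - a m" "B i - A i = b i - a i" for m i
    by (simp_all add: A_def B_def)
  thus ?thesis unfolding norlund_coeff_def fun_eq_iff by simp
qed

text \<open>
  For \<open>\<psi> = - m\<close> the first \<open>m + 1\<close> terms of the expansion are polynomials: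
  \<open>\<Gamma>(z) / \<Gamma>(z - i) = (z - i)\<^sub>i\<close>.
\<close>

lemma F_minus_norlund_poly_bigo:
  assumes "\<psi> = - of_nat m"
  shows "(\<lambda>s. F s - norlund_shifted_poly m s) \<in> O[at_sector](\<lambda>s. s powr (- 1))"
proof -
  have "(\<lambda>s. F s - (\<Sum>j<m+1. norlund_coeff p a b j * (Gamma (s + A p) * rGamma (s + A p + \<psi> + of_nat j))))
      \<in> O[at_sector](\<lambda>s. s powr (- \<psi> - of_nat (m + 1)))"
    using norlund_expansion[OF p, of A B "m + 1"] unfolding psi_shift F_def norlund_coeff_shift .
  also have "- \<psi> - of_nat (m + 1) = - 1" by (simp add: assms)
  finally have "(\<lambda>s. F s - (\<Sum>j<m+1. norlund_coeff p a b j * (Gamma (s + A p) * rGamma (s + A p + \<psi> + of_nat j))))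
      \<in> O[at_sector](\<lambda>s. s powr (- 1))" .
  moreover have "\<forall>\<^sub>F s in at_sector. F s - (\<Sum>j<m+1. norlund_coeff p a b j * (Gamma (s + A p) * rGamma (s + A p + \<psi> + of_nat j))) =
      F s - norlund_shifted_poly m s"
    using eventually_at_sector_nonpole[of "A p"]
  proof eventually_elim
    case (elim s)
    have 1: "Gamma (s + A p) * rGamma (s + A p + \<psi> + of_nat j) = pochhammer (s + A p - of_nat (m - j)) (m - j)"
      if "j \<le> m" for j
    proof -
      have e: "s + A p + \<psi> + of_nat j = s + A p - of_nat (m - j)" using that by (simp add: assms of_nat_diff)
      have "rGamma (s + A p - of_nat (m - j)) = pochhammer (s + A p - of_nat (m - j)) (m - j) * rGamma (s + A p)"
        using pochhammer_rGamma[of "s + A p - of_nat (m - j)" "m - j"] by simp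
      moreover have "Gamma (s + A p) * rGamma (s + A p) = 1"
        using elim by (simp add: Gamma_def rGamma_eq_zero_iff)
      ultimately show ?thesis unfolding e by (metis mult.left_commute mult_1_right)
    qed
    have "(\<Sum>j<m+1. norlund_coeff p a b j * (Gamma (s + A p) * rGamma (s + A p + \<psi> + of_nat j))) =
        (\<Sum>j<Suc m. norlund_coeff p a b (Suc m - Suc j) * (Gamma (s + A p) * rGamma (s + A p + \<psi> + of_nat (Suc m - Suc j))))"
      unfolding Suc_eq_plus1[symmetric] by (rule sum.nat_diff_reindex[symmetric])
    also have "\<dots> = (\<Sum>j=0..m. norlund_coeff p a b (m - j) * pochhammer (s + A p - of_nat j) j)"
    proof (rule sum.cong)
      fix j assume "j \<in> {0..m}"
      thus "norlund_coeff p a b (Suc m - Suc j) * (Gamma (s + A p) * rGamma (s + A p + \<psi> + of_nat (Suc m - Suc j))) =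
          norlund_coeff p a b (m - j) * pochhammer (s + A p - of_nat j) j"
        using 1[of "m - j"] by simp
    qed auto
    also have "\<dots> = norlund_shifted_poly m s"
      unfolding norlund_shifted_poly_def poly_norlund_poly A_def by (simp add: algebra_simps)
    finally show ?case by simp
  qed
  ultimately show ?thesis by (simp only: landau_o.big.in_cong)
qed

text \<open>
  Subtracting the polynomial from \<open>F\<close> does not change the loop integral, but makes the integrand
  decay like \<open>s\<^bsup>-1-n\<^esup>\<close>.
\<close>

theorem G_hat_tendsto_integer_psi:
  assumes "\<psi> = - of_nat m"
  shows "((\<lambda>x. G_hat \<gamma> p n a b x / (\<Prod>k=1..p. Gamma (a k))) \<longlongrightarrow>
           hyp_F_one_div_Gamma p n a b / fact (n - 1) -
           1 / (\<Prod>k=1..p. Gamma (a k)) *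
             (\<Sum>j=0..n-1. (-1) ^ j * poly (norlund_poly p m a b) (of_nat j) / (fact (n - 1 - j) * fact j)))
           (at_left 1)"
proof -
  define q where "q = norlund_shifted_poly m"
  define T where "T = (\<Sum>j=0..n-1. (-1) ^ j * poly (norlund_poly p m a b) (of_nat j) / (fact (n - 1 - j) * fact j))"
  define \<Phi> where "\<Phi> = (\<lambda>s. F s - q s)"
  have q: "q holomorphic_on X" for X
    unfolding q_def norlund_shifted_poly_def by (intro holomorphic_intros)
  have qpb: "poly_bounded_on S q" for S
    unfolding q_def norlund_shifted_poly_def by (rule poly_bounded_on_poly)
  have hol: "\<Phi> holomorphic_on - P" and pb: "poly_bounded_on outside_strip \<Phi>"
    unfolding \<Phi>_def by (intro holomorphic_intros F_holomorphic q poly_bounded_on_diff F_poly_bounded qpb)+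
  have "\<Phi> \<in> O[at_sector](\<lambda>s. s powr (- 1))"
    unfolding \<Phi>_def q_def by (rule F_minus_norlund_poly_bigo[OF assms])
  hence "((\<lambda>t. 1 / (2 * of_real pi * \<i>) *
       loop_mellin (\<lambda>s. (- 1) ^ n * \<Phi> s / pochhammer s n) t) \<longlongrightarrow>
     (\<Sum>j=0..n-1. (- 1) ^ j * \<Phi> (of_nat j - (of_nat n - 1)) / (fact (n - 1 - j) * fact j))) (at_left 1)"
    using n by (intro normalized_loop_integral_tendsto[OF hol pb, of "- 1"]) auto
  also have "(\<Sum>j=0..n-1. (- 1) ^ j * \<Phi> (of_nat j - (of_nat n - 1)) / (fact (n - 1 - j) * fact j)) =
      (\<Prod>k=1..p. Gamma (a k)) * hyp_F_one_div_Gamma p n a b / fact (n - 1) - T"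
    unfolding \<Phi>_def q_def norlund_shifted_poly_def T_def F_residue_sum[symmetric]
    by (simp add: right_diff_distrib diff_divide_distrib sum_subtractf)
  finally have lim: "((\<lambda>t. 1 / (2 * of_real pi * \<i>) *
       loop_mellin (\<lambda>s. (- 1) ^ n * \<Phi> s / pochhammer s n) t) \<longlongrightarrow>
     (\<Prod>k=1..p. Gamma (a k)) * hyp_F_one_div_Gamma p n a b / fact (n - 1) - T) (at_left 1)" .
  have "\<forall>\<^sub>F t in at_left (1::real). 1 / (2 * of_real pi * \<i>) *
       loop_mellin (\<lambda>s. (- 1) ^ n * \<Phi> s / pochhammer s n) t = G_hat \<gamma> p n a b t"
    using eventually_at_left_real[of 0 "1::real"]
  proof (rule eventually_mono)
    show "1 / (2 * of_real pi * \<i>) *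
       loop_mellin (\<lambda>s. (- 1) ^ n * \<Phi> s / pochhammer s n) t = G_hat \<gamma> p n a b t"
      if "t \<in> {0<..<1}" for t
    proof -
      have t: "0 < t" "t < 1" using that by auto
      have "(\<lambda>s. (- 1) ^ n * F s / pochhammer s n) =
          (\<lambda>s. (- 1) ^ n * \<Phi> s / pochhammer s n + (- 1) ^ n * q s / pochhammer s n)"
        by (simp add: \<Phi>_def algebra_simps diff_divide_distrib)
      hence "loop_mellin (\<lambda>s. (- 1) ^ n * F s / pochhammer s n) t =
          loop_mellin (\<lambda>s. ((- 1) ^ n * \<Phi> s / pochhammer s n + (- 1) ^ n * q s / pochhammer s n)) t"
        by (metis (no_types, lifting))
      also have "\<dots> = loop_mellin (\<lambda>s. (- 1) ^ n * \<Phi> s / pochhammer s n) t +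
          loop_mellin (\<lambda>s. (- 1) ^ n * q s / pochhammer s n) t"
        by (intro loop_integral_add over_pochhammer_holomorphic over_pochhammer_poly_bounded
            holomorphic_intros hol pb q qpb t)
      also have "loop_mellin (\<lambda>s. (- 1) ^ n * q s / pochhammer s n) t = 0"
        using loop_integral_rational_eq_0[OF t, of "smult ((- 1) ^ n) (norlund_poly p m a b)" "of_nat n - 1"]
        by (simp add: q_def norlund_shifted_poly_def)
      finally show ?thesis unfolding G_hat_eq by simp
    qed
  qed simp
  from Lim_transform_eventually[OF lim this]
  have "(G_hat \<gamma> p n a b \<longlongrightarrow>
     (\<Prod>k=1..p. Gamma (a k)) * hyp_F_one_div_Gamma p n a b / fact (n - 1) - T) (at_left 1)" .
  from tendsto_divide[OF this tendsto_const Gamma_a_nonzero] show ?thesis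
    unfolding T_def[symmetric] using Gamma_a_nonzero by (simp add: diff_divide_distrib)
qed

text \<open>
  The function \<open>h\<close> is the relative deviation of \<open>G\<close> from its asymptotic form. After \<open>N\<close> terms of the
  expansion, with \<open>N > 1 - Re \<delta>\<close>, the remainder contributes a bounded function, which is negligible because
  \<open>Re \<delta> < 1\<close>.
\<close>

theorem G_hat_asymp:
  assumes neg: "Re \<psi> + real n - 1 < 0" and psi: "- \<psi> \<notin> \<nat>"
  defines "h \<equiv> \<lambda>x. G_hat \<gamma> p n a b x * ((- 1) ^ n * Gamma (\<psi> + of_nat n)) *
      of_real (1 - x) powr (- (\<psi> + of_nat n - 1)) - 1"
  shows "(h \<longlongrightarrow> 0) (at_left 1)" and "Gamma (\<psi> + of_nat n) \<noteq> 0"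
proof -
  define \<delta> where "\<delta> = \<psi> + of_nat n"
  have "\<delta> \<notin> \<int>\<^sub>\<le>\<^sub>0"
  proof
    assume "\<delta> \<in> \<int>\<^sub>\<le>\<^sub>0"
    then obtain l where "\<delta> = - of_nat l" by (elim nonpos_Ints_cases')
    hence "\<psi> = - of_nat l - of_nat n" by (simp add: \<delta>_def eq_diff_eq)
    hence "- \<psi> = of_nat (n + l)" by simp
    thus False using psi by (metis of_nat_in_Nats)
  qed
  hence Gd: "Gamma \<delta> \<noteq> 0" "Gamma \<delta> * rGamma \<delta> = 1"
    by (auto simp: Gamma_eq_zero_iff Gamma_def rGamma_eq_zero_iff)
  thus "Gamma (\<psi> + of_nat n) \<noteq> 0" by (simp add: \<delta>_def)
  obtain N :: nat where N: "1 - Re \<delta> < real N" using reals_Archimedean2 by blast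
  have N1: "N \<ge> 1" using N neg by (cases N) (auto simp: \<delta>_def)
  \<comment> \<open>The factor \<open>1 / (s)\<^sub>n = \<Gamma>(s) / \<Gamma>(s + n)\<close> is treated as one more pair of parameters.\<close>
  define A' where "A' = (\<lambda>k. if k = 1 then 0 else A (k - 1))"
  define B' where "B' = (\<lambda>k. if k = 1 then of_nat n else B (k - 1))"
  define c where "c = norlund_coeff (Suc p) A' B'"
  define X where "X = (\<lambda>j s. Gamma (s + A p) * rGamma (s + (A p + (\<delta> + of_nat j))))"
  define \<Phi> where "\<Phi> = (\<lambda>s. F s - pochhammer s n * (\<Sum>j<N. c j * X j s))"
  have c0: "c 0 = 1" unfolding c_def by (rule norlund_coeff_0) simp
  have Ap: "gamma_poles (A p) \<subseteq> P" using p by (intro P_subset) auto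
  have Xhol: "X j holomorphic_on - P" for j
    unfolding X_def by (rule holomorphic_on_subset[OF Gamma_quotient_holomorphic]) (use Ap in auto)
  have Xpb: "poly_bounded_on outside_strip (X j)" for j
    unfolding X_def by (rule Gamma_quotient_poly_bounded_outside_strip[OF Ap])
  have hol: "\<Phi> holomorphic_on - P"
    unfolding \<Phi>_def by (intro holomorphic_intros F_holomorphic Xhol)
  have pb: "poly_bounded_on outside_strip \<Phi>"
    unfolding \<Phi>_def using poly_bounded_on_pochhammer[of outside_strip 0 n]
    by (intro poly_bounded_on_diff poly_bounded_on_mult poly_bounded_on_sum F_poly_bounded Xpb poly_bounded_on_const)
       simp
  have shift: "(\<Prod>k=1..Suc p. f k) = f 1 * (\<Prod>k=1..p. f (Suc k))" for f :: "nat \<Rightarrow> complex"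
    using prod.atLeast_Suc_atMost[of 1 "Suc p" f] unfolding prod.atLeast_Suc_atMost_Suc_shift
    by (simp add: o_def)
  have shift': "(\<Sum>k=1..Suc p. f k) = f 1 + (\<Sum>k=1..p. f (Suc k))" for f :: "nat \<Rightarrow> complex"
    using sum.atLeast_Suc_atMost[of 1 "Suc p" f] unfolding sum.atLeast_Suc_atMost_Suc_shift
    by (simp add: o_def)
  have psi': "(\<Sum>k=1..Suc p. B' k - A' k) = \<delta>"
    unfolding shift' using psi_shift by (simp add: A'_def B'_def \<delta>_def)
  have "(\<lambda>s. (\<Prod>k=1..Suc p. Gamma (s + A' k) * rGamma (s + B' k)) -
      (\<Sum>j<N. c j * (Gamma (s + A' (Suc p)) * rGamma (s + A' (Suc p) + \<delta> + of_nat j))))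
      \<in> O[at_sector](\<lambda>s. s powr (- \<delta> - of_nat N))"
    using norlund_expansion[of "Suc p" A' B' N] unfolding psi' c_def by simp
  moreover have "\<forall>\<^sub>F s in at_sector. (\<Prod>k=1..Suc p. Gamma (s + A' k) * rGamma (s + B' k)) -
      (\<Sum>j<N. c j * (Gamma (s + A' (Suc p)) * rGamma (s + A' (Suc p) + \<delta> + of_nat j))) = \<Phi> s / pochhammer s n"
    using eventually_at_sector_nonpole[of 0]
  proof eventually_elim
    case (elim s)
    have s: "s \<notin> \<int>\<^sub>\<le>\<^sub>0" using elim by simp
    have rs: "rGamma s \<noteq> 0" using s by (simp add: rGamma_eq_zero_iff)
    have "rGamma s = pochhammer s n * rGamma (s + of_nat n)" by (rule pochhammer_rGamma)
    moreover from this have pn: "pochhammer s n \<noteq> 0" using rs by auto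
    ultimately have "Gamma s * rGamma (s + of_nat n) = 1 / pochhammer s n"
      using rs by (simp add: Gamma_def field_simps)
    moreover have "(\<Prod>k=1..Suc p. Gamma (s + A' k) * rGamma (s + B' k)) =
        Gamma s * rGamma (s + of_nat n) * F s"
      unfolding shift F_def by (simp add: A'_def B'_def)
    moreover have "A' (Suc p) = A p" using p by (simp add: A'_def)
    ultimately show ?case
      using pn by (simp add: \<Phi>_def X_def diff_divide_distrib add.assoc)
  qed
  ultimately have "(\<lambda>s. \<Phi> s / pochhammer s n) \<in> O[at_sector](\<lambda>s. s powr (- \<delta> - of_nat N))"
    by (simp only: landau_o.big.in_cong)
  hence dec: "(\<lambda>s. ((- 1) ^ n * \<Phi> s) / pochhammer s n) \<in> O[at_sector](\<lambda>s. s powr (- \<delta> - of_nat N))"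
    using bigo_cmult_left[of "\<lambda>s. \<Phi> s / pochhammer s n" at_sector _ "(- 1) ^ n"] by simp
  define J where "J = (\<lambda>t. loop_mellin (\<lambda>s. (- 1) ^ n * \<Phi> s / pochhammer s n) t)"
  have "(\<lambda>s. (- 1) ^ n * \<Phi> s) holomorphic_on - P" by (intro holomorphic_intros hol)
  moreover have "Re (- \<delta> - of_nat N) < - 1" using N by simp
  ultimately obtain l where J: "(J \<longlongrightarrow> l) (at_left 1)"
    using loop_integral_tendsto_residue_sum[OF _ over_pochhammer_poly_bounded[OF pb] _ dec]
    unfolding J_def by blast
  have G: "G_hat \<gamma> p n a b t = 1 / (2 * of_real pi * \<i>) * J t +
      (- 1) ^ n * (\<Sum>j<N. c j * (of_real t powr A p * rGamma (\<delta> + of_nat j) * of_real (1 - t) powr (\<delta> + of_nat j - 1)))"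
    if t: "0 < t" "t < 1" for t
  proof -
    have XholQ: "X j holomorphic_on - P - Q" for j by (rule holomorphic_on_subset[OF Xhol]) auto
    have "loop_mellin (\<lambda>s. (- 1) ^ n * F s / pochhammer s n) t =
        loop_mellin (\<lambda>s. ((- 1) ^ n * \<Phi> s / pochhammer s n + (\<Sum>j<N. ((- 1) ^ n * c j) * X j s))) t"
    proof (rule loop_integral_cong)
      fix s assume "s \<in> - P - Q"
      hence "pochhammer s n \<noteq> 0" by (auto simp: pochhammer_eq_0_iff)
      hence "(- 1) ^ n * F s / pochhammer s n =
          (- 1) ^ n * \<Phi> s / pochhammer s n + (- 1) ^ n * (\<Sum>j<N. c j * X j s)"
        unfolding \<Phi>_def by (simp add: right_diff_distrib diff_divide_distrib)
      thus "(- 1) ^ n * F s / pochhammer s n * of_real t powr (- s) =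
          ((- 1) ^ n * \<Phi> s / pochhammer s n + (\<Sum>j<N. ((- 1) ^ n * c j) * X j s)) * of_real t powr (- s)"
        by (simp add: sum_distrib_left mult.assoc)
    qed
    also have "\<dots> = J t + loop_mellin (\<lambda>s. (\<Sum>j<N. ((- 1) ^ n * c j) * X j s)) t"
      unfolding J_def
      by (intro loop_integral_add over_pochhammer_holomorphic over_pochhammer_poly_bounded
          holomorphic_intros hol pb XholQ t poly_bounded_on_sum poly_bounded_on_mult poly_bounded_on_const Xpb)
    also have "loop_mellin (\<lambda>s. (\<Sum>j<N. ((- 1) ^ n * c j) * X j s)) t =
        (\<Sum>j<N. ((- 1) ^ n * c j) * loop_mellin (\<lambda>s. X j s) t)"
      by (intro loop_integral_sum XholQ Xpb t) simp
    also have "\<dots> = (\<Sum>j<N. ((- 1) ^ n * c j) * (2 * of_real pi * \<i> *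
        (of_real t powr A p * rGamma (\<delta> + of_nat j) * of_real (1 - t) powr (\<delta> + of_nat j - 1))))"
      unfolding X_def loop_integral_Gamma_quotient[OF Ap t] ..
    also have "\<dots> = 2 * of_real pi * \<i> * ((- 1) ^ n * (\<Sum>j<N. c j *
        (of_real t powr A p * rGamma (\<delta> + of_nat j) * of_real (1 - t) powr (\<delta> + of_nat j - 1))))"
      by (simp add: sum_distrib_left mult_ac)
    finally show ?thesis unfolding G_hat_eq by (simp add: distrib_left)
  qed
  define K where "K = (\<lambda>t. 1 / (2 * of_real pi * \<i>) * J t * ((- 1) ^ n * Gamma \<delta>) * of_real (1 - t) powr (1 - \<delta>) +
      (\<Sum>j<N. c j * (of_real t powr A p * rGamma (\<delta> + of_nat j)) * Gamma \<delta> * of_real (1 - t) ^ j) - 1)"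
  have "\<forall>\<^sub>F t in at_left (1::real). K t = h t"
    using eventually_at_left_real[of 0 "1::real"]
  proof (rule eventually_mono)
    fix t :: real assume "t \<in> {0<..<1}"
    hence t: "0 < t" "t < 1" by auto
    have e: "- (\<psi> + of_nat n - 1) = 1 - \<delta>" by (simp add: \<delta>_def)
    have pw: "of_real (1 - t) powr (\<delta> + of_nat j - 1) * of_real (1 - t) powr (1 - \<delta>) = (of_real (1 - t) ^ j :: complex)" for j
      using t by (simp add: powr_nat flip: powr_add)
    have sg: "(- 1) ^ n * (- 1) ^ n = (1 :: complex)" by (simp flip: power_mult_distrib)
    define u where "u = (of_real (1 - t) powr (1 - \<delta>) :: complex)"
    define v where "v = (\<lambda>j. (of_real (1 - t) powr (\<delta> + of_nat j - 1) :: complex))"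
    have uv: "v j * u = of_real (1 - t) ^ j" for j unfolding u_def v_def by (rule pw)
    have "h t = (1 / (2 * of_real pi * \<i>) * J t + (- 1) ^ n * (\<Sum>j<N. c j * (of_real t powr A p * rGamma (\<delta> + of_nat j) * v j)))
        * ((- 1) ^ n * Gamma \<delta>) * u - 1"
      unfolding h_def G[OF t] e u_def v_def \<delta>_def[symmetric] by simp
    also have "\<dots> = 1 / (2 * of_real pi * \<i>) * J t * ((- 1) ^ n * Gamma \<delta>) * u +
        ((- 1) ^ n * (- 1) ^ n) * ((\<Sum>j<N. c j * (of_real t powr A p * rGamma (\<delta> + of_nat j) * v j)) * Gamma \<delta> * u) - 1"
      by (simp only: distrib_right distrib_left mult_ac)
    also have "(\<Sum>j<N. c j * (of_real t powr A p * rGamma (\<delta> + of_nat j) * v j)) * Gamma \<delta> * u =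
        (\<Sum>j<N. c j * (of_real t powr A p * rGamma (\<delta> + of_nat j)) * Gamma \<delta> * (v j * u))"
      unfolding sum_distrib_right by (intro sum.cong refl) (simp only: mult_ac)
    finally show "K t = h t" unfolding sg uv K_def u_def[symmetric] by simp
  qed simp
  moreover have "(K \<longlongrightarrow> 0) (at_left 1)"
  proof -
    have 1: "((\<lambda>t. (of_real (1 - t) powr (1 - \<delta>) :: complex)) \<longlongrightarrow> 0) (at_left (1::real))"
    proof (rule tendsto_norm_zero_cancel, rule Lim_transform_eventually)
      have "((\<lambda>t::real. 1 - t) \<longlongrightarrow> 1 - 1) (at_left 1)" by (intro tendsto_intros)
      thus "((\<lambda>t::real. (1 - t) powr (1 - Re \<delta>)) \<longlongrightarrow> 0) (at_left 1)"
        using neg by (intro tendsto_zero_powrI[where b = "1 - Re \<delta>"])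
          (auto simp: \<delta>_def intro!: tendsto_intros eventually_at_leftI[of 0])
      show "\<forall>\<^sub>F t in at_left (1::real). (1 - t) powr (1 - Re \<delta>) = norm (of_real (1 - t) powr (1 - \<delta>) :: complex)"
        using eventually_at_left_real[of 0 "1::real"]
        by (rule eventually_mono) (auto simp: norm_powr_real_powr simp del: of_real_diff)
    qed
    have 2: "((\<lambda>t. (of_real (1 - t) :: complex) ^ j) \<longlongrightarrow> (if j = 0 then 1 else 0)) (at_left (1::real))" for j
    proof -
      have "((\<lambda>t. (of_real (1 - t) :: complex) ^ j) \<longlongrightarrow> of_real (1 - 1) ^ j) (at_left (1::real))"
        by (intro tendsto_intros)
      thus ?thesis by (simp add: power_0_left)
    qed
    have 3: "((\<lambda>t. (of_real t powr A p :: complex)) \<longlongrightarrow> 1) (at_left (1::real))"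
    proof -
      have "((\<lambda>t. (of_real t powr A p :: complex)) \<longlongrightarrow> of_real 1 powr A p) (at_left (1::real))"
        by (intro tendsto_intros) auto
      thus ?thesis by simp
    qed
    have "(K \<longlongrightarrow> 1 / (2 * of_real pi * \<i>) * l * ((- 1) ^ n * Gamma \<delta>) * 0 +
      (\<Sum>j<N. c j * (1 * rGamma (\<delta> + of_nat j)) * Gamma \<delta> * (if j = 0 then 1 else 0)) - 1) (at_left 1)"
      unfolding K_def by (intro tendsto_intros J 1 2 3)
    also have "(\<Sum>j<N. c j * (1 * rGamma (\<delta> + of_nat j)) * Gamma \<delta> * (if j = 0 then 1 else 0)) = (\<Sum>j<N. if j = 0 then 1 else 0)"
      using Gd c0 by (intro sum.cong refl) (auto simp: mult.commute)
    also have "\<dots> = 1" using N1 by (simp add: sum.delta)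
    finally show ?thesis by simp
  qed
  ultimately show "(h \<longlongrightarrow> 0) (at_left 1)" by (rule Lim_transform_eventually[rotated])
qed

end

theorem proposition3:
  fixes p n :: nat and a b :: "nat \<Rightarrow> complex" and \<psi> :: complex and \<gamma> :: "real \<Rightarrow> complex"
  assumes "p \<ge> 1" and "n \<ge> 1"
    and psi: "\<psi> = (\<Sum>k=1..p. b k - a k)"
    and loop: "(\<forall>k\<in>{1..p}. - a k \<notin> \<nat>) \<longrightarrow> separating_left_loop p n a \<gamma>"
  shows
    "(Re \<psi> + real n - 1 > 0 \<or> (\<exists>k\<in>{1..p}. - a k \<in> \<nat>) \<longrightarrow>
       (\<lambda>x. G_hat_div_Gamma \<gamma> p n a b x - hyp_F_one_div_Gamma p n a b / fact (n - 1))
         \<in> o[at_left 1](\<lambda>_. 1))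
     \<and>
     (\<forall>m::nat. \<psi> = - of_nat m \<and> m \<ge> n - 1 \<and> (\<forall>k\<in>{1..p}. - a k \<notin> \<nat>) \<longrightarrow>
       degree (norlund_poly p m a b) = m \<and>
       (\<lambda>x. G_hat_div_Gamma \<gamma> p n a b x -
            (hyp_F_one_div_Gamma p n a b / fact (n - 1) -
             1 / (\<Prod>k=1..p. Gamma (a k)) *
             (\<Sum>j=0..n-1. (-1) ^ j * poly (norlund_poly p m a b) (of_nat j) /
                          (fact (n - 1 - j) * fact j))))
         \<in> o[at_left 1](\<lambda>_. 1))
     \<and>
     (Re \<psi> + real n - 1 < 0 \<and> - \<psi> \<notin> \<nat> \<and> (\<forall>k\<in>{1..p}. - a k \<notin> \<nat>) \<longrightarrow>
       (\<exists>h :: real \<Rightarrow> complex. h \<in> o[at_left 1](\<lambda>_. 1) \<and>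
         (\<forall>\<^sub>F x in at_left 1.
            G_hat_div_Gamma \<gamma> p n a b x =
              (-1) ^ n * of_real (1 - x) powr (\<psi> + of_nat n - 1) /
              ((\<Prod>k=1..p. Gamma (a k)) * Gamma (\<psi> + of_nat n)) * (1 + h x))))"
proof -
  have small: "f \<in> o[at_left 1](\<lambda>_. 1)" if "(f \<longlongrightarrow> 0) (at_left (1::real))" for f :: "real \<Rightarrow> complex"
    using that by (intro smalloI_tendsto) auto
  show ?thesis
  proof (cases "\<exists>k\<in>{1..p}. - a k \<in> \<nat>")
    case True
    define w where "w = (\<lambda>j. pochhammer (1 - of_nat n) j * (\<Prod>k=1..p. pochhammer (a k) j) *
        (\<Prod>k=1..p. rGamma (b k + of_nat j)) / fact j)"
    have "((\<lambda>x. of_real x ^ (n - 1) / fact (n - 1) * (\<Sum>j=0..n-1. w j * of_real x powi (- int j))) \<longlongrightarrow>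
        of_real 1 ^ (n - 1) / fact (n - 1) * (\<Sum>j=0..n-1. w j * of_real 1 powi (- int j))) (at_left (1::real))"
      by (intro tendsto_intros) auto
    hence "((\<lambda>x. G_hat_div_Gamma \<gamma> p n a b x) \<longlongrightarrow> hyp_F_one_div_Gamma p n a b / fact (n - 1)) (at_left 1)"
      using True unfolding G_hat_div_Gamma_def hyp_F_one_div_Gamma_def w_def by simp
    hence "((\<lambda>x. G_hat_div_Gamma \<gamma> p n a b x - hyp_F_one_div_Gamma p n a b / fact (n - 1)) \<longlongrightarrow> 0) (at_left 1)"
      by (simp add: LIM_zero)
    thus ?thesis using True by (auto intro: small)
  next
    case False
    interpret norlund_setting p n a b \<gamma>
      by unfold_locales (use assms False in auto)
    have psi_eq: "norlund_setting.\<psi> p a b = \<psi>" using psi \<psi>_def by simp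
    have G: "G_hat_div_Gamma \<gamma> p n a b x = G_hat \<gamma> p n a b x / (\<Prod>k=1..p. Gamma (a k))" for x
      using False by (simp add: G_hat_div_Gamma_def)
    show ?thesis
      (is "_ \<and> (\<forall>m. ?A2 m \<longrightarrow> ?D2 m \<and> ?R2 m) \<and> (_ \<longrightarrow> ?R3)")
    proof (intro conjI impI allI)
      assume "Re \<psi> + real n - 1 > 0 \<or> (\<exists>k\<in>{1..p}. - a k \<in> \<nat>)"
      hence "Re \<psi> + real n - 1 > 0" using False by blast
      thus "(\<lambda>x. G_hat_div_Gamma \<gamma> p n a b x - hyp_F_one_div_Gamma p n a b / fact (n - 1)) \<in> o[at_left 1](\<lambda>_. 1)"
        unfolding G using G_hat_tendsto by (intro small LIM_zero) (simp add: psi_eq)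
    next
      fix m assume "\<psi> = - of_nat m \<and> m \<ge> n - 1 \<and> (\<forall>k\<in>{1..p}. - a k \<notin> \<nat>)"
      hence m: "\<psi> = - of_nat m" by blast
      show "degree (norlund_poly p m a b) = m" using \<open>p \<ge> 1\<close> by (rule degree_norlund_poly)
      show "?R2 m"
        unfolding G using G_hat_tendsto_integer_psi m by (intro small LIM_zero) (simp only: psi_eq)
    next
      assume "Re \<psi> + real n - 1 < 0 \<and> - \<psi> \<notin> \<nat> \<and> (\<forall>k\<in>{1..p}. - a k \<notin> \<nat>)"
      hence neg: "Re \<psi> + real n - 1 < 0" "- \<psi> \<notin> \<nat>" by auto
      define h where "h = (\<lambda>x. G_hat \<gamma> p n a b x * ((- 1) ^ n * Gamma (\<psi> + of_nat n)) *
          of_real (1 - x) powr (- (\<psi> + of_nat n - 1)) - 1)"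
      have h: "(h \<longlongrightarrow> 0) (at_left 1)" and Gz: "Gamma (\<psi> + of_nat n) \<noteq> 0"
        using G_hat_asymp neg unfolding psi_eq h_def by auto
      have "G_hat_div_Gamma \<gamma> p n a b x =
              (-1) ^ n * of_real (1 - x) powr (\<psi> + of_nat n - 1) /
              ((\<Prod>k=1..p. Gamma (a k)) * Gamma (\<psi> + of_nat n)) * (1 + h x)" if "x \<in> {0<..<1}" for x
      proof -
        have "of_real (1 - x) \<noteq> (0 :: complex)" using that by (metis diff_gt_0_iff_gt greaterThanLessThan_iff less_irrefl of_real_eq_0_iff)
        hence "of_real (1 - x) powr (\<psi> + of_nat n - 1) * of_real (1 - x) powr (- (\<psi> + of_nat n - 1)) = (1 :: complex)"
          by (simp flip: powr_add)
        moreover have "(- 1) ^ n * (- 1) ^ n = (1 :: complex)" by (simp flip: power_mult_distrib)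
        moreover define u v s where "u = (of_real (1 - x) powr (\<psi> + of_nat n - 1) :: complex)"
          and "v = (of_real (1 - x) powr (- (\<psi> + of_nat n - 1)) :: complex)" and "s = ((- 1) ^ n :: complex)"
        ultimately have uv: "u * v = 1" "s * s = 1" by simp_all
        define \<Gamma>a where "\<Gamma>a = (\<Prod>k=1..p. Gamma (a k))"
        have "s * u / (\<Gamma>a * Gamma (\<psi> + of_nat n)) * (1 + h x) =
            (s * s) * (u * v) * G_hat \<gamma> p n a b x / \<Gamma>a"
          using Gz unfolding h_def u_def[symmetric] v_def[symmetric] s_def[symmetric]
          by (simp add: field_simps)
        also have "\<dots> = G_hat \<gamma> p n a b x / \<Gamma>a" unfolding uv by simp
        finally show ?thesis unfolding G u_def v_def s_def \<Gamma>a_def ..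
      qed
      hence "\<forall>\<^sub>F x in at_left (1::real). G_hat_div_Gamma \<gamma> p n a b x =
              (-1) ^ n * of_real (1 - x) powr (\<psi> + of_nat n - 1) /
              ((\<Prod>k=1..p. Gamma (a k)) * Gamma (\<psi> + of_nat n)) * (1 + h x)"
        by (intro eventually_mono[OF eventually_at_left_real[of 0 1]]) auto
      thus "?R3"
        using small[OF h] by blast
    qed
  qed
qed

end
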